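(* $\mathsf{\Sigma QSO(\Sigma_2\text{-}2SAT)}\subseteq\mathsf{TotP}$.
   Context: $\mathsf{TotP}=\{tot_M \mid M \text{ a nondeterministic polynomial-time Turing machine}\}$, where $tot_M(x)$ is the number of all computation paths of $M$ on input $x$ minus $1$. Counting functions on finite ordered structures are viewed as functions on their standard string encodings. $\mathsf{\Sigma QSO(\Sigma_2\text{-}2SAT)}$: first-order formulae over a relational vocabulary $\sigma$ are built by $\phi ::= x=y \mid R(\vec x) \mid \neg\phi \mid \phi\vee\phi \mid \exists x\phi \mid \top \mid \bot$ with $R\in\sigma$. A literal is $X(\vec x)$ or $\neg X(\vec x)$ with $X$ a second-order variable. A 2SAT clause over $\sigma$ is $\phi_1\vee\phi_2\vee\phi_3$ where each $\phi_i$ is a literal or a first-order formula over $\sigma$, at least one $\phi_i$ being a first-order formula. A $\Sigma_2$-2SAT formula is $\exists\vec x\forall\vec y\bigwedge_{j=1}^k C_j(\vec x,\vec y)$ with each $C_j$ a 2SAT clause. $\mathsf{\Sigma QSO(\Sigma_2\text{-}2SAT)}$ formulae: $\alpha ::= \phi \mid s \mid (\alpha+\alpha)\mid \Sigma x.\alpha \mid \Sigma X.\alpha$, with $\phi$ a $\Sigma_2$-2SAT formula, $s\in\mathbb{N}$. Semantics: $[[\phi]]=1$ if the structure (with the current assignments) satisfies $\phi$, else $0$; $[[s]]=s$; $+$ is addition; $[[\Sigma x.\alpha]](\mathcal{A},v,V)=\sum_{a\in A}[[\alpha]](\mathcal{A},v[a/x],V)$; $[[\Sigma X.\alpha]](\mathcal{A},v,V)=\sum_{B\subseteq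 A^{\mathrm{arity}(X)}}[[\alpha]](\mathcal{A},v,V[B/X])$. A sentence $\alpha$ defines the counting function $\mathcal{A}\mapsto[[\alpha]](\mathcal{A})$; the class consists of all such functions. *)

theory Defs
  imports "HOL-Computational_Algebra.Polynomial"
begin

section \<open>Nondeterministic polynomial-time Turing machines and TotP\<close>

datatype symbol = Blank | Bit bool | Work nat

datatype move = MoveLeft | Stay | MoveRight

text \<open>
  A transition \<open>(q, as, q', bs, ds)\<close> applies in state \<open>q\<close> when the heads read \<open>as\<close>, one symbol
  per tape; the heads write \<open>bs\<close>, move along \<open>ds\<close>, and the state becomes \<open>q'\<close>. The set of
  transitions is finite (see \<open>ntm\<close>), so only finitely many states and symbols matter. There
  are no accepting states because the total number of paths does not depend on acceptance;
  a machine halts when no transition applies.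
\<close>

type_synonym transition = "nat \<times> symbol list \<times> nat \<times> symbol list \<times> move list"

record machine =
  num_tapes :: nat
  start_state :: nat
  transitions :: "transition set"

definition ntm :: "machine \<Rightarrow> bool" where
  "ntm M \<longleftrightarrow> num_tapes M \<ge> 1 \<and> finite (transitions M) \<and>
     (\<forall>(q, as, q', bs, ds) \<in> transitions M.
        length as = num_tapes M \<and> length bs = num_tapes M \<and> length ds = num_tapes M)"

text \<open>
  Tapes are infinite in both directions. Head positions are absolute, so distinct applicable
  transitions always lead to distinct configurations, and counting sequences of configurations
  is the same as counting sequences of nondeterministic choices.
\<close>

type_synonym config = "nat \<times> ((int \<Rightarrow> symbol) \<times> int) list"

fun shift :: "move \<Rightarrow> int" where
  "shift MoveLeft = -1"
| "shift Stay = 0"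
| "shift MoveRight = 1"

definition initial_config :: "machine \<Rightarrow> bool list \<Rightarrow> config" where
  "initial_config M x =
     (start_state M,
      (\<lambda>i. if 0 \<le> i \<and> i < int (length x) then Bit (x ! nat i) else Blank, 0)
        # replicate (num_tapes M - 1) (\<lambda>_. Blank, 0))"

fun step :: "machine \<Rightarrow> config \<Rightarrow> config \<Rightarrow> bool" where
  "step M (q, ts) (q', ts') \<longleftrightarrow>
     (\<exists>bs ds. (q, map (\<lambda>(t, h). t h) ts, q', bs, ds) \<in> transitions M \<and>
        ts' = map (\<lambda>((t, h), b, d). (t(h := b), h + shift d)) (zip ts (zip bs ds)))"

definition halted :: "machine \<Rightarrow> config \<Rightarrow> bool" where
  "halted M c \<longleftrightarrow> (\<nexists>c'. step M c c')"

definition partial_computation :: "machine \<Rightarrow> bool list \<Rightarrow> config list \<Rightarrow> bool" where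
  "partial_computation M x cs \<longleftrightarrow> cs \<noteq> [] \<and> hd cs = initial_config M x \<and>
     (\<forall>i. Suc i < length cs \<longrightarrow> step M (cs ! i) (cs ! Suc i))"

definition computation_paths :: "machine \<Rightarrow> bool list \<Rightarrow> config list set" where
  "computation_paths M x = {cs. partial_computation M x cs \<and> halted M (last cs)}"

definition polynomial_time :: "machine \<Rightarrow> bool" where
  "polynomial_time M \<longleftrightarrow>
     (\<exists>p :: nat poly. \<forall>x cs. partial_computation M x cs \<longrightarrow> length cs - 1 \<le> poly p (length x))"

text \<open>
  For a polynomial-time machine the set of paths is finite and nonempty, so neither \<open>card\<close>
  nor the subtraction on the natural numbers is degenerate.
\<close>

definition tot :: "machine \<Rightarrow> bool list \<Rightarrow> nat" where
  "tot M x = card (computation_paths M x) - 1"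

definition TotP :: "(bool list \<Rightarrow> nat) set" where
  "TotP = {tot M | M. ntm M \<and> polynomial_time M}"


section \<open>Finite ordered structures and their encodings\<close>

text \<open>
  A vocabulary lists the arities of its relation symbols, which are named \<open>0, 1, \<dots>\<close>.
  Symbol \<open>0\<close> is the binary symbol that ordered structures interpret as a (reflexive)
  linear order.
\<close>

type_synonym vocabulary = "nat list"

definition ordered_vocabulary :: "vocabulary \<Rightarrow> bool" where
  "ordered_vocabulary \<sigma> \<longleftrightarrow> \<sigma> \<noteq> [] \<and> \<sigma> ! 0 = 2"

record 'a rel_structure =
  universe :: "'a set"
  interp :: "nat \<Rightarrow> 'a list set"

definition tuples :: "'a set \<Rightarrow> nat \<Rightarrow> 'a list set" where
  "tuples A k = {t. set t \<subseteq> A \<and> length t = k}"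

definition order_of :: "'a rel_structure \<Rightarrow> 'a rel" where
  "order_of \<A> = {(a, b). [a, b] \<in> interp \<A> 0}"

definition ordered_structures :: "vocabulary \<Rightarrow> 'a rel_structure set" where
  "ordered_structures \<sigma> =
     {\<A>. finite (universe \<A>) \<and> universe \<A> \<noteq> {} \<and>
          (\<forall>i < length \<sigma>. interp \<A> i \<subseteq> tuples (universe \<A>) (\<sigma> ! i)) \<and>
          linear_order_on (universe \<A>) (order_of \<A>)}"

definition enumeration :: "'a rel_structure \<Rightarrow> 'a list" where
  "enumeration \<A> =
     (THE as. set as = universe \<A> \<and> distinct as \<and> sorted_wrt (\<lambda>a b. (a, b) \<in> order_of \<A>) as)"

text \<open>
  A structure with \<open>n\<close> elements is encoded as \<open>0\<^sup>n 1\<close> followed, for each relation symbol of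
  arity \<open>k\<close>, by its characteristic string of length \<open>n\<^sup>k\<close>: \<open>product_lists\<close> enumerates
  the \<open>k\<close>-tuples in the lexicographic order induced by the linear order of the structure.
\<close>

definition encode :: "vocabulary \<Rightarrow> 'a rel_structure \<Rightarrow> bool list" where
  "encode \<sigma> \<A> =
     replicate (card (universe \<A>)) False @ [True] @
     concat (map (\<lambda>i. map (\<lambda>t. t \<in> interp \<A> i)
                          (product_lists (replicate (\<sigma> ! i) (enumeration \<A>))))
                 [0..<length \<sigma>])"

text \<open>
  A function on ordered structures belongs to a class \<open>F\<close> of functions on strings if it is
  computed by a member of \<open>F\<close> from the encodings. Values on strings that do not encode a
  structure are irrelevant.
\<close>

definition on_encodings ::
  "vocabulary \<Rightarrow> (bool list \<Rightarrow> nat) set \<Rightarrow> ('a rel_structure \<Rightarrow> nat) set" where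
  "on_encodings \<sigma> F = {f. \<exists>g \<in> F. \<forall>\<A> \<in> ordered_structures \<sigma>. f \<A> = g (encode \<sigma> \<A>)}"


section \<open>First-order formulae and \<open>\<Sigma>\<^sub>2\<close>-2SAT formulae\<close>

type_synonym fo_var = nat

text \<open>A second-order variable is a name together with its arity.\<close>

type_synonym so_var = "nat \<times> nat"

abbreviation arity :: "so_var \<Rightarrow> nat" where
  "arity X \<equiv> snd X"

type_synonym 'a fo_assignment = "fo_var \<Rightarrow> 'a"
type_synonym 'a so_assignment = "so_var \<Rightarrow> 'a list set"

datatype fo_formula =
    Eq fo_var fo_var
  | Rel nat "fo_var list"
  | Neg fo_formula
  | Or fo_formula fo_formula
  | Ex fo_var fo_formula
  | Top
  | Bot

datatype literal =
    PosLit so_var "fo_var list"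
  | NegLit so_var "fo_var list"

datatype disjunct =
    Lit literal
  | FO fo_formula

type_synonym clause = "disjunct \<times> disjunct \<times> disjunct"

text \<open>\<open>ExAll xs ys Cs\<close> stands for \<open>\<exists>xs. \<forall>ys. \<And>Cs\<close>.\<close>

datatype sigma2_formula = ExAll "fo_var list" "fo_var list" "clause list"

fun over_fo :: "vocabulary \<Rightarrow> fo_formula \<Rightarrow> bool" where
  "over_fo \<sigma> (Eq x y) \<longleftrightarrow> True"
| "over_fo \<sigma> (Rel i xs) \<longleftrightarrow> i < length \<sigma> \<and> length xs = \<sigma> ! i"
| "over_fo \<sigma> (Neg \<phi>) \<longleftrightarrow> over_fo \<sigma> \<phi>"
| "over_fo \<sigma> (Or \<phi> \<psi>) \<longleftrightarrow> over_fo \<sigma> \<phi> \<and> over_fo \<sigma> \<psi>"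
| "over_fo \<sigma> (Ex x \<phi>) \<longleftrightarrow> over_fo \<sigma> \<phi>"
| "over_fo \<sigma> Top \<longleftrightarrow> True"
| "over_fo \<sigma> Bot \<longleftrightarrow> True"

fun over_literal :: "literal \<Rightarrow> bool" where
  "over_literal (PosLit X xs) \<longleftrightarrow> length xs = arity X"
| "over_literal (NegLit X xs) \<longleftrightarrow> length xs = arity X"

fun over_disjunct :: "vocabulary \<Rightarrow> disjunct \<Rightarrow> bool" where
  "over_disjunct \<sigma> (Lit l) \<longleftrightarrow> over_literal l"
| "over_disjunct \<sigma> (FO \<phi>) \<longleftrightarrow> over_fo \<sigma> \<phi>"

fun is_2SAT_clause :: "vocabulary \<Rightarrow> clause \<Rightarrow> bool" where
  "is_2SAT_clause \<sigma> (d1, d2, d3) \<longleftrightarrow>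
     over_disjunct \<sigma> d1 \<and> over_disjunct \<sigma> d2 \<and> over_disjunct \<sigma> d3 \<and>
     (\<exists>\<phi>. d1 = FO \<phi> \<or> d2 = FO \<phi> \<or> d3 = FO \<phi>)"

fun is_Sigma2_2SAT :: "vocabulary \<Rightarrow> sigma2_formula \<Rightarrow> bool" where
  "is_Sigma2_2SAT \<sigma> (ExAll xs ys Cs) \<longleftrightarrow> (\<forall>C \<in> set Cs. is_2SAT_clause \<sigma> C)"

fun sat_fo :: "'a rel_structure \<Rightarrow> 'a fo_assignment \<Rightarrow> fo_formula \<Rightarrow> bool" where
  "sat_fo \<A> v (Eq x y) \<longleftrightarrow> v x = v y"
| "sat_fo \<A> v (Rel i xs) \<longleftrightarrow> map v xs \<in> interp \<A> i"
| "sat_fo \<A> v (Neg \<phi>) \<longleftrightarrow> \<not> sat_fo \<A> v \<phi>"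
| "sat_fo \<A> v (Or \<phi> \<psi>) \<longleftrightarrow> sat_fo \<A> v \<phi> \<or> sat_fo \<A> v \<psi>"
| "sat_fo \<A> v (Ex x \<phi>) \<longleftrightarrow> (\<exists>a \<in> universe \<A>. sat_fo \<A> (v(x := a)) \<phi>)"
| "sat_fo \<A> v Top \<longleftrightarrow> True"
| "sat_fo \<A> v Bot \<longleftrightarrow> False"

fun sat_literal :: "'a fo_assignment \<Rightarrow> 'a so_assignment \<Rightarrow> literal \<Rightarrow> bool" where
  "sat_literal v V (PosLit X xs) \<longleftrightarrow> map v xs \<in> V X"
| "sat_literal v V (NegLit X xs) \<longleftrightarrow> map v xs \<notin> V X"

fun sat_disjunct ::
  "'a rel_structure \<Rightarrow> 'a fo_assignment \<Rightarrow> 'a so_assignment \<Rightarrow> disjunct \<Rightarrow> bool" where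
  "sat_disjunct \<A> v V (Lit l) \<longleftrightarrow> sat_literal v V l"
| "sat_disjunct \<A> v V (FO \<phi>) \<longleftrightarrow> sat_fo \<A> v \<phi>"

fun sat_clause ::
  "'a rel_structure \<Rightarrow> 'a fo_assignment \<Rightarrow> 'a so_assignment \<Rightarrow> clause \<Rightarrow> bool" where
  "sat_clause \<A> v V (d1, d2, d3) \<longleftrightarrow>
     sat_disjunct \<A> v V d1 \<or> sat_disjunct \<A> v V d2 \<or> sat_disjunct \<A> v V d3"

fun ex_block :: "'a set \<Rightarrow> fo_var list \<Rightarrow> ('a fo_assignment \<Rightarrow> bool) \<Rightarrow> 'a fo_assignment \<Rightarrow> bool"
  where
  "ex_block A [] P v \<longleftrightarrow> P v"
| "ex_block A (x # xs) P v \<longleftrightarrow> (\<exists>a \<in> A. ex_block A xs P (v(x := a)))"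

fun all_block :: "'a set \<Rightarrow> fo_var list \<Rightarrow> ('a fo_assignment \<Rightarrow> bool) \<Rightarrow> 'a fo_assignment \<Rightarrow> bool"
  where
  "all_block A [] P v \<longleftrightarrow> P v"
| "all_block A (x # xs) P v \<longleftrightarrow> (\<forall>a \<in> A. all_block A xs P (v(x := a)))"

fun sat_sigma2 ::
  "'a rel_structure \<Rightarrow> 'a fo_assignment \<Rightarrow> 'a so_assignment \<Rightarrow> sigma2_formula \<Rightarrow> bool" where
  "sat_sigma2 \<A> v V (ExAll xs ys Cs) \<longleftrightarrow>
     ex_block (universe \<A>) xs
       (all_block (universe \<A>) ys (\<lambda>w. \<forall>C \<in> set Cs. sat_clause \<A> w V C)) v"


section \<open>Quantitative second-order formulae\<close>

datatype qso =
    Form sigma2_formula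
  | Const nat
  | Plus qso qso
  | SumFO fo_var qso
  | SumSO so_var qso

fun is_SigmaQSO_Sigma2_2SAT :: "vocabulary \<Rightarrow> qso \<Rightarrow> bool" where
  "is_SigmaQSO_Sigma2_2SAT \<sigma> (Form \<phi>) \<longleftrightarrow> is_Sigma2_2SAT \<sigma> \<phi>"
| "is_SigmaQSO_Sigma2_2SAT \<sigma> (Const s) \<longleftrightarrow> True"
| "is_SigmaQSO_Sigma2_2SAT \<sigma> (Plus \<alpha> \<beta>) \<longleftrightarrow>
     is_SigmaQSO_Sigma2_2SAT \<sigma> \<alpha> \<and> is_SigmaQSO_Sigma2_2SAT \<sigma> \<beta>"
| "is_SigmaQSO_Sigma2_2SAT \<sigma> (SumFO x \<alpha>) \<longleftrightarrow> is_SigmaQSO_Sigma2_2SAT \<sigma> \<alpha>"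
| "is_SigmaQSO_Sigma2_2SAT \<sigma> (SumSO X \<alpha>) \<longleftrightarrow> is_SigmaQSO_Sigma2_2SAT \<sigma> \<alpha>"

fun eval :: "'a rel_structure \<Rightarrow> 'a fo_assignment \<Rightarrow> 'a so_assignment \<Rightarrow> qso \<Rightarrow> nat" where
  "eval \<A> v V (Form \<phi>) = (if sat_sigma2 \<A> v V \<phi> then 1 else 0)"
| "eval \<A> v V (Const s) = s"
| "eval \<A> v V (Plus \<alpha> \<beta>) = eval \<A> v V \<alpha> + eval \<A> v V \<beta>"
| "eval \<A> v V (SumFO x \<alpha>) = (\<Sum>a \<in> universe \<A>. eval \<A> (v(x := a)) V \<alpha>)"
| "eval \<A> v V (SumSO X \<alpha>) =
     (\<Sum>B \<in> Pow (tuples (universe \<A>) (arity X)). eval \<A> v (V(X := B)) \<alpha>)"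

fun fv_fo :: "fo_formula \<Rightarrow> fo_var set" where
  "fv_fo (Eq x y) = {x, y}"
| "fv_fo (Rel i xs) = set xs"
| "fv_fo (Neg \<phi>) = fv_fo \<phi>"
| "fv_fo (Or \<phi> \<psi>) = fv_fo \<phi> \<union> fv_fo \<psi>"
| "fv_fo (Ex x \<phi>) = fv_fo \<phi> - {x}"
| "fv_fo Top = {}"
| "fv_fo Bot = {}"

fun fv_literal :: "literal \<Rightarrow> fo_var set" where
  "fv_literal (PosLit X xs) = set xs"
| "fv_literal (NegLit X xs) = set xs"

fun fv_disjunct :: "disjunct \<Rightarrow> fo_var set" where
  "fv_disjunct (Lit l) = fv_literal l"
| "fv_disjunct (FO \<phi>) = fv_fo \<phi>"

fun fv_clause :: "clause \<Rightarrow> fo_var set" where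
  "fv_clause (d1, d2, d3) = fv_disjunct d1 \<union> fv_disjunct d2 \<union> fv_disjunct d3"

fun fv_sigma2 :: "sigma2_formula \<Rightarrow> fo_var set" where
  "fv_sigma2 (ExAll xs ys Cs) = (\<Union>C \<in> set Cs. fv_clause C) - set xs - set ys"

fun fv :: "qso \<Rightarrow> fo_var set" where
  "fv (Form \<phi>) = fv_sigma2 \<phi>"
| "fv (Const s) = {}"
| "fv (Plus \<alpha> \<beta>) = fv \<alpha> \<union> fv \<beta>"
| "fv (SumFO x \<alpha>) = fv \<alpha> - {x}"
| "fv (SumSO X \<alpha>) = fv \<alpha>"

fun sov_disjunct :: "disjunct \<Rightarrow> so_var set" where
  "sov_disjunct (Lit (PosLit X xs)) = {X}"
| "sov_disjunct (Lit (NegLit X xs)) = {X}"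
| "sov_disjunct (FO \<phi>) = {}"

fun sov_clause :: "clause \<Rightarrow> so_var set" where
  "sov_clause (d1, d2, d3) = sov_disjunct d1 \<union> sov_disjunct d2 \<union> sov_disjunct d3"

fun sov_sigma2 :: "sigma2_formula \<Rightarrow> so_var set" where
  "sov_sigma2 (ExAll xs ys Cs) = (\<Union>C \<in> set Cs. sov_clause C)"

fun fsov :: "qso \<Rightarrow> so_var set" where
  "fsov (Form \<phi>) = sov_sigma2 \<phi>"
| "fsov (Const s) = {}"
| "fsov (Plus \<alpha> \<beta>) = fsov \<alpha> \<union> fsov \<beta>"
| "fsov (SumFO x \<alpha>) = fsov \<alpha>"
| "fsov (SumSO X \<alpha>) = fsov \<alpha> - {X}"

definition sentence :: "qso \<Rightarrow> bool" where
  "sentence \<alpha> \<longleftrightarrow> fv \<alpha> = {} \<and> fsov \<alpha> = {}"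

text \<open>
  The initial assignments are arbitrary: by the coincidence lemma below they do not affect the
  value of a sentence.
\<close>

definition counting_function :: "qso \<Rightarrow> 'a rel_structure \<Rightarrow> nat" where
  "counting_function \<alpha> \<A> = eval \<A> (\<lambda>_. undefined) (\<lambda>_. {}) \<alpha>"

definition SigmaQSO_Sigma2_2SAT :: "vocabulary \<Rightarrow> ('a rel_structure \<Rightarrow> nat) set" where
  "SigmaQSO_Sigma2_2SAT \<sigma> =
     {counting_function \<alpha> | \<alpha>. is_SigmaQSO_Sigma2_2SAT \<sigma> \<alpha> \<and> sentence \<alpha>}"

lemma sat_fo_cong:
  "(\<And>x. x \<in> fv_fo \<phi> \<Longrightarrow> v x = w x) \<Longrightarrow> sat_fo \<A> v \<phi> = sat_fo \<A> w \<phi>"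
proof (induction \<phi> arbitrary: v w)
  case (Rel i xs)
  then have "map v xs = map w xs" by simp
  then show ?case by (simp only: sat_fo.simps)
next
  case (Or \<phi> \<psi>)
  have "sat_fo \<A> v \<phi> = sat_fo \<A> w \<phi>" "sat_fo \<A> v \<psi> = sat_fo \<A> w \<psi>"
    using Or.prems by (auto intro!: Or.IH)
  then show ?case by simp
next
  case (Ex x \<phi>)
  have "sat_fo \<A> (v(x := a)) \<phi> = sat_fo \<A> (w(x := a)) \<phi>" for a
    using Ex.prems by (intro Ex.IH) auto
  then show ?case by simp
next
  case (Neg \<phi>)
  have "sat_fo \<A> v \<phi> = sat_fo \<A> w \<phi>"
    using Neg.prems by (auto intro!: Neg.IH)
  then show ?case by simp
qed auto

lemma sat_disjunct_cong:
  assumes "\<And>x. x \<in> fv_disjunct d \<Longrightarrow> v x = w x" and "\<And>X. X \<in> sov_disjunct d \<Longrightarrow> V X = W X"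
  shows "sat_disjunct \<A> v V d = sat_disjunct \<A> w W d"
proof (cases d)
  case (Lit l)
  show ?thesis
  proof (cases l)
    case (PosLit X xs)
    have "map v xs = map w xs" "V X = W X" using assms Lit PosLit by auto
    then show ?thesis by (simp only: Lit PosLit sat_disjunct.simps sat_literal.simps)
  next
    case (NegLit X xs)
    have "map v xs = map w xs" "V X = W X" using assms Lit NegLit by auto
    then show ?thesis by (simp only: Lit NegLit sat_disjunct.simps sat_literal.simps)
  qed
next
  case (FO \<phi>)
  then show ?thesis using assms sat_fo_cong[of \<phi> v w] by simp
qed

lemma sat_clause_cong:
  assumes "\<And>x. x \<in> fv_clause C \<Longrightarrow> v x = w x" and "\<And>X. X \<in> sov_clause C \<Longrightarrow> V X = W X"
  shows "sat_clause \<A> v V C = sat_clause \<A> w W C"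
proof -
  obtain d1 d2 d3 where C: "C = (d1, d2, d3)" by (cases C)
  have "sat_disjunct \<A> v V d = sat_disjunct \<A> w W d" if "d \<in> {d1, d2, d3}" for d
    using assms that by (intro sat_disjunct_cong) (auto simp: C)
  then show ?thesis by (simp add: C)
qed

lemma ex_block_cong:
  assumes "\<And>v w. (\<And>x. x \<in> S \<Longrightarrow> v x = w x) \<Longrightarrow> P v = Q w"
    and "\<And>x. x \<in> S - set xs \<Longrightarrow> v x = w x"
  shows "ex_block A xs P v = ex_block A xs Q w"
  using assms(2)
proof (induction xs arbitrary: v w)
  case Nil
  have "P v = Q w" using Nil.prems by (intro assms(1)) simp
  then show ?case by simp
next
  case (Cons y ys)
  have "ex_block A ys P (v(y := a)) = ex_block A ys Q (w(y := a))" for a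
    using Cons.prems by (intro Cons.IH) auto
  then show ?case by simp
qed

lemma all_block_cong:
  assumes "\<And>v w. (\<And>x. x \<in> S \<Longrightarrow> v x = w x) \<Longrightarrow> P v = Q w"
    and "\<And>x. x \<in> S - set xs \<Longrightarrow> v x = w x"
  shows "all_block A xs P v = all_block A xs Q w"
  using assms(2)
proof (induction xs arbitrary: v w)
  case Nil
  have "P v = Q w" using Nil.prems by (intro assms(1)) simp
  then show ?case by simp
next
  case (Cons y ys)
  have "all_block A ys P (v(y := a)) = all_block A ys Q (w(y := a))" for a
    using Cons.prems by (intro Cons.IH) auto
  then show ?case by simp
qed

lemma sat_sigma2_cong:
  assumes "\<And>x. x \<in> fv_sigma2 \<phi> \<Longrightarrow> v x = w x" and "\<And>X. X \<in> sov_sigma2 \<phi> \<Longrightarrow> V X = W X"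
  shows "sat_sigma2 \<A> v V \<phi> = sat_sigma2 \<A> w W \<phi>"
proof -
  obtain xs ys Cs where \<phi>: "\<phi> = ExAll xs ys Cs" by (cases \<phi>)
  let ?S = "\<Union>C \<in> set Cs. fv_clause C"
  have "(\<forall>C \<in> set Cs. sat_clause \<A> v V C) = (\<forall>C \<in> set Cs. sat_clause \<A> w W C)"
    if "\<And>x. x \<in> ?S \<Longrightarrow> v x = w x" for v w
  proof (rule ball_cong[OF refl])
    fix C assume C: "C \<in> set Cs"
    show "sat_clause \<A> v V C = sat_clause \<A> w W C"
    proof (rule sat_clause_cong)
      show "v x = w x" if "x \<in> fv_clause C" for x
        using that C \<open>\<And>x. x \<in> ?S \<Longrightarrow> v x = w x\<close> by blast
      have "sov_clause C \<subseteq> sov_sigma2 \<phi>" using C by (auto simp: \<phi>)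
      then show "V X = W X" if "X \<in> sov_clause C" for X
        using that assms(2) by blast
    qed
  qed
  then show ?thesis
    unfolding \<phi> sat_sigma2.simps
    apply (intro ex_block_cong[where S = "?S - set ys"] all_block_cong[where S = "?S"])
    using assms(1) by (auto simp: \<phi>)
qed

lemma eval_cong:
  assumes "\<And>x. x \<in> fv \<alpha> \<Longrightarrow> v x = w x" and "\<And>X. X \<in> fsov \<alpha> \<Longrightarrow> V X = W X"
  shows "eval \<A> v V \<alpha> = eval \<A> w W \<alpha>"
  using assms
proof (induction \<alpha> arbitrary: v w V W)
  case (Form \<phi>)
  then show ?case using sat_sigma2_cong[of \<phi> v w V W] by simp
next
  case (Plus \<alpha> \<beta>)
  have "eval \<A> v V \<alpha> = eval \<A> w W \<alpha>" "eval \<A> v V \<beta> = eval \<A> w W \<beta>"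
    using Plus.prems by (auto intro!: Plus.IH)
  then show ?case by simp
next
  case (SumFO x \<alpha>)
  have "eval \<A> (v(x := a)) V \<alpha> = eval \<A> (w(x := a)) W \<alpha>" for a
    using SumFO.prems by (intro SumFO.IH) auto
  then show ?case by simp
next
  case (SumSO X \<alpha>)
  have "eval \<A> v (V(X := B)) \<alpha> = eval \<A> w (W(X := B)) \<alpha>" for B
    using SumSO.prems by (intro SumSO.IH) auto
  then show ?case by simp
qed simp

corollary eval_sentence:
  "sentence \<alpha> \<Longrightarrow> eval \<A> v V \<alpha> = counting_function \<alpha> \<A>"
  unfolding counting_function_def by (rule eval_cong) (auto simp: sentence_def)

end

theory Submission
  imports Defs
begin

text \<open>
  The value of a sentence is the number of its witnesses: bit strings that name a summand, the
  values of the summed first-order variables (by blocks with a single one) and the summed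
  relations (by characteristic strings). A nondeterministic machine fixes the bits of a witness one
  after the other and branches only if both values can be extended to a witness, so its paths
  correspond to the witnesses. One extra summand with value \<open>1\<close> accounts for the subtracted path
  and guarantees that the search never fails.

  Whether a prefix can be extended is decidable in polynomial time: for each of the polynomially
  many values of the summed and existentially quantified first-order variables, the first-order
  parts of the clauses can be evaluated, and what remains is a 2-CNF formula in the bits, which is
  satisfiable unless its implication graph has a path from some literal to its negation and back.

  To obtain a concrete machine, the test is written in a language whose loops are bounded by
  polynomials in the size of the structure, so that the time bound is a matter of syntax. It is
  compiled to structured programs on counters with attached memory; a counter is the head position
  on a tape, and the states of the machine are the commands that remain to be executed.
\<close>

section \<open>Programs on counter registers\<close>

text \<open>Guessing a complete witness and checking it afterwards is impossible, because
  \<open>tot\<close> counts the failing paths as well; every branching must be backed by the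
  extension test. What makes the test feasible is the form of 2SAT clauses: one disjunct of three is
  first-order and becomes a truth value once the first-order variables are fixed, so at most two
  unknown literals remain. Universally quantified variables only multiply the number of clauses by a
  polynomial. Existential ones would turn the conjunction of clauses into a disjunction of
  conjunctions; their values are enumerated outside the 2-CNF formula, and they stay out of the
  witness because a formula has value 1 no matter how many values satisfy it. The time bound has to
  hold on all strings, also on those that encode no structure and on which the test means nothing.
  Hence time is bounded unconditionally, while the number of paths is determined under hypotheses
  that encodings fulfil. As the count must be exact, the simulation matches the sets of successors
  with equality, and the witnesses of all summands are padded to a common length.\<close>

datatype reg = Arr nat | Var nat | Tmp nat

datatype instr = Inc reg | Dec reg | Write reg bool

datatype test = Pos reg | Holds reg "bool option"

datatype com =
    Skip
  | Act instr
  | Seq com com  (infixr ";;" 60)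
  | Cond test com com
  | While test com
  | Choice com com

text \<open>The first component gives the value of each register, which is also the cell that its
  instructions access; the second gives the cells, with \<open>None\<close> for a cell never
  written.\<close>

type_synonym store = "(reg \<Rightarrow> nat) \<times> (reg \<Rightarrow> nat \<Rightarrow> bool option)"

fun passes :: "store \<Rightarrow> test \<Rightarrow> bool" where
  "passes (h, m) (Pos r) \<longleftrightarrow> 0 < h r"
| "passes (h, m) (Holds r x) \<longleftrightarrow> m r (h r) = x"

fun perform :: "instr option \<Rightarrow> store \<Rightarrow> store" where
  "perform None s = s"
| "perform (Some (Inc r)) (h, m) = (h(r := Suc (h r)), m)"
| "perform (Some (Dec r)) (h, m) = (h(r := h r - 1), m)"
| "perform (Some (Write r b)) (h, m) = (h, m(r := (m r)(h r := Some b)))"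

text \<open>Control flow is separated from the store: only the truth values of the tests enter. The
  machine reads the same values off the scanned symbols (\<open>observe\<close>), so one function
  yields both the semantics and the transition table.\<close>

fun nxt :: "(test \<Rightarrow> bool) \<Rightarrow> com \<Rightarrow> (com \<times> instr option) set" where
  "nxt \<tau> Skip = {}"
| "nxt \<tau> (Act i) = {(Skip, Some i)}"
| "nxt \<tau> (c1 ;; c2) =
     (if c1 = Skip then {(c2, None)} else (\<lambda>(c, i). (c ;; c2, i)) ` nxt \<tau> c1)"
| "nxt \<tau> (Cond b c1 c2) = {(if \<tau> b then c1 else c2, None)}"
| "nxt \<tau> (While b c) = {(if \<tau> b then c ;; While b c else Skip, None)}"
| "nxt \<tau> (Choice c1 c2) = {(c1, None), (c2, None)}"

definition succs :: "com \<times> store \<Rightarrow> (com \<times> store) set" where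
  "succs x = (\<lambda>(c, i). (c, perform i (snd x))) ` nxt (passes (snd x)) (fst x)"

text \<open>One entry of the list per path: a set would merge paths that end in equal stores. The
  number bounds the length of the longest path from above. \<open>branch\<close> asks for distinct
  successors because \<open>succs\<close> is a set, in which equal ones would be a single
  one.\<close>

inductive outcomes :: "com \<times> store \<Rightarrow> store list \<Rightarrow> nat \<Rightarrow> bool" where
  finished: "outcomes (Skip, s) [s] t"
| forced: "succs x = {y} \<Longrightarrow> outcomes y ss t \<Longrightarrow> outcomes x ss (Suc t)"
| branch: "succs x = {y, z} \<Longrightarrow> y \<noteq> z \<Longrightarrow> outcomes y ss t \<Longrightarrow> outcomes z ss' t \<Longrightarrow>
    outcomes x (ss @ ss') (Suc t)"

abbreviation run :: "com \<Rightarrow> store \<Rightarrow> store \<Rightarrow> nat \<Rightarrow> bool" where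
  "run c s s' t \<equiv> outcomes (c, s) [s'] t"

lemma outcomes_mono: "outcomes x ss t \<Longrightarrow> t \<le> t' \<Longrightarrow> outcomes x ss t'"
proof (induction arbitrary: t' rule: outcomes.induct)
  case (forced x y ss t)
  then obtain u where "t' = Suc u" "t \<le> u" by (cases t') auto
  then show ?case using forced outcomes.forced by blast
next
  case (branch x y z ss t ss')
  then obtain u where "t' = Suc u" "t \<le> u" by (cases t') auto
  then show ?case using branch outcomes.branch by blast
qed (rule outcomes.finished)

lemma succs_Seq_Skip: "succs (Skip ;; c, s) = {(c, s)}"
  by (simp add: succs_def)

lemma succs_Seq:
  "c1 \<noteq> Skip \<Longrightarrow> succs (c1 ;; c2, s) = (\<lambda>(c, s'). (c ;; c2, s')) ` succs (c1, s)"
  by (force simp: succs_def)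

text \<open>The paths of \<open>c1\<close> are continued independently, \<open>f\<close> listing the
  outcomes of \<open>c2\<close> from each final store. The \<open>+ 1\<close> is the step that drops
  the exhausted \<open>Skip\<close> in front of \<open>c2\<close>.\<close>

lemma outcomes_Seq:
  assumes "outcomes (c1, s) ss t" and "\<And>s'. s' \<in> set ss \<Longrightarrow> outcomes (c2, s') (f s') t'"
  shows "outcomes (c1 ;; c2, s) (concat (map f ss)) (t + 1 + t')"
  using assms
proof (induction "(c1, s)" ss t arbitrary: c1 s rule: outcomes.induct)
  case (finished s t)
  have "outcomes (Skip ;; c2, s) (f s) (Suc t')"
    by (rule outcomes.forced[OF succs_Seq_Skip]) (use finished in auto)
  then show ?case by (auto elim: outcomes_mono)
next
  case (forced y ss t)
  obtain d u where y: "y = (d, u)" by (cases y)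
  have "c1 \<noteq> Skip" using forced.hyps(1) by (auto simp: succs_def)
  then have "succs (c1 ;; c2, s) = {(d ;; c2, u)}"
    using forced.hyps(1) by (simp add: succs_Seq y)
  then show ?case using forced.hyps(3)[OF y] forced.prems outcomes.forced by simp
next
  case (branch y z ss t ss')
  obtain d u where y: "y = (d, u)" by (cases y)
  obtain e v where z: "z = (e, v)" by (cases z)
  have "c1 \<noteq> Skip" using branch.hyps(1) by (auto simp: succs_def)
  then have "succs (c1 ;; c2, s) = {(d ;; c2, u), (e ;; c2, v)}"
    using branch.hyps(1) by (simp add: succs_Seq y z)
  moreover have "(d ;; c2, u) \<noteq> (e ;; c2, v)" using branch.hyps(2) by (simp add: y z)
  ultimately show ?case
    using branch.hyps(4)[OF y] branch.hyps(6)[OF z] branch.prems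
    by (simp add: outcomes.branch)
qed

lemma run_Seq: "run c1 s s1 t1 \<Longrightarrow> run c2 s1 s2 t2 \<Longrightarrow> run (c1 ;; c2) s s2 (t1 + 1 + t2)"
  using outcomes_Seq[of c1 s "[s1]" t1 c2 "\<lambda>_. [s2]" t2] by simp

lemma run_Seq_outcomes:
  "run c1 s s1 t1 \<Longrightarrow> outcomes (c2, s1) ss t2 \<Longrightarrow> outcomes (c1 ;; c2, s) ss (t1 + 1 + t2)"
  using outcomes_Seq[of c1 s "[s1]" t1 c2 "\<lambda>_. ss" t2] by simp

lemma run_Skip: "run Skip s s 0"
  by (rule outcomes.finished)

lemma run_Act: "run (Act i) s (perform (Some i) s) 1"
  using outcomes.forced[OF _ outcomes.finished, of "(Act i, s)" "perform (Some i) s" 0]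
  by (simp add: succs_def)

lemma run_Inc: "run (Act (Inc r)) (h, m) (h(r := Suc (h r)), m) 1"
  using run_Act[of "Inc r" "(h, m)"] by simp

lemma run_Dec: "run (Act (Dec r)) (h, m) (h(r := h r - 1), m) 1"
  using run_Act[of "Dec r" "(h, m)"] by simp

lemma run_Write: "run (Act (Write r b)) (h, m) (h, m(r := (m r)(h r := Some b))) 1"
  using run_Act[of "Write r b" "(h, m)"] by simp

lemma run_eq: "run c s s1 t1 \<Longrightarrow> s1 = s' \<Longrightarrow> t1 \<le> t' \<Longrightarrow> run c s s' t'"
  using outcomes_mono by blast

lemma outcomes_Cond:
  "outcomes (if passes s b then c1 else c2, s) ss t \<Longrightarrow> outcomes (Cond b c1 c2, s) ss (Suc t)"
  by (rule outcomes.forced[rotated]) (auto simp: succs_def)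

lemma outcomes_While_True:
  "passes s b \<Longrightarrow> outcomes (c ;; While b c, s) ss t \<Longrightarrow> outcomes (While b c, s) ss (Suc t)"
  by (rule outcomes.forced[rotated]) (auto simp: succs_def)

lemma run_While_False: "\<not> passes s b \<Longrightarrow> run (While b c) s s 1"
  using outcomes.forced[OF _ outcomes.finished, of "(While b c, s)" s 0]
  by (simp add: succs_def)

lemma outcomes_Choice:
  assumes "c1 \<noteq> c2" "outcomes (c1, s) ss1 t" "outcomes (c2, s) ss2 t"
  shows "outcomes (Choice c1 c2, s) (ss1 @ ss2) (Suc t)"
  by (rule outcomes.branch[OF _ _ assms(2,3)]) (use assms(1) in \<open>auto simp: succs_def\<close>)

text \<open>A loop is verified by giving the store \<open>\<sigma> i\<close> after \<open>i\<close>
  rounds. Each round costs two steps beyond the body, for unfolding the loop and for dropping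
  \<open>Skip\<close>; the last step is the failing test.\<close>

lemma run_While:
  assumes "\<And>i. i < k \<Longrightarrow> passes (\<sigma> i) b" and "\<not> passes (\<sigma> k) b"
    and "\<And>i. i < k \<Longrightarrow> run c (\<sigma> i) (\<sigma> (Suc i)) t"
  shows "run (While b c) (\<sigma> 0) (\<sigma> k) (k * (t + 2) + 1)"
  using assms
proof (induction k arbitrary: \<sigma>)
  case 0
  then show ?case using run_While_False by simp
next
  case (Suc k)
  have "run (While b c) (\<sigma> (Suc 0)) (\<sigma> (Suc k)) (k * (t + 2) + 1)"
    using Suc.IH[of "\<lambda>i. \<sigma> (Suc i)"] Suc.prems by simp
  then have "run (c ;; While b c) (\<sigma> 0) (\<sigma> (Suc k)) (t + 1 + (k * (t + 2) + 1))"
    by (rule run_Seq[OF Suc.prems(3)[of 0], rotated]) simp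
  then show ?case
    using outcomes_While_True[OF Suc.prems(1)[of 0]] by (simp add: ac_simps)
qed

section \<open>Bounded-loop programs with arrays\<close>

datatype aexp = Cst nat | Lev nat | Add aexp aexp | Mul aexp aexp

datatype bexp = BLess aexp aexp | BRead nat aexp | BNot bexp | BAnd bexp bexp | BEx aexp bexp

datatype cmd = Nop | Assign nat aexp bexp | Then cmd cmd | For aexp cmd

type_synonym arrays = "nat \<Rightarrow> nat \<Rightarrow> bool"

text \<open>
  Variables are de Bruijn levels: \<open>Lev k\<close> is the \<open>k\<close>-th entry of the environment, and \<open>BEx\<close> and
  \<open>For\<close> bind the first level that is not yet in the environment.
\<close>

definition look :: "nat list \<Rightarrow> nat \<Rightarrow> nat" where
  "look \<rho> k = (if k < length \<rho> then \<rho> ! k else 0)"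

fun aval :: "nat list \<Rightarrow> aexp \<Rightarrow> nat" where
  "aval \<rho> (Cst c) = c"
| "aval \<rho> (Lev k) = look \<rho> k"
| "aval \<rho> (Add a b) = aval \<rho> a + aval \<rho> b"
| "aval \<rho> (Mul a b) = aval \<rho> a * aval \<rho> b"

fun bval :: "nat list \<Rightarrow> arrays \<Rightarrow> bexp \<Rightarrow> bool" where
  "bval \<rho> S (BLess a b) \<longleftrightarrow> aval \<rho> a < aval \<rho> b"
| "bval \<rho> S (BRead A e) \<longleftrightarrow> S A (aval \<rho> e)"
| "bval \<rho> S (BNot b) \<longleftrightarrow> \<not> bval \<rho> S b"
| "bval \<rho> S (BAnd b c) \<longleftrightarrow> bval \<rho> S b \<and> bval \<rho> S c"
| "bval \<rho> S (BEx e b) \<longleftrightarrow> (\<exists>i < aval \<rho> e. bval (\<rho> @ [i]) S b)"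

fun exec :: "nat list \<Rightarrow> cmd \<Rightarrow> arrays \<Rightarrow> arrays" where
  "exec \<rho> Nop S = S"
| "exec \<rho> (Assign A e b) S = S(A := (S A)(aval \<rho> e := bval \<rho> S b))"
| "exec \<rho> (Then c d) S = exec \<rho> d (exec \<rho> c S)"
| "exec \<rho> (For e c) S = fold (\<lambda>i. exec (\<rho> @ [i]) c) [0..<aval \<rho> e] S"

section \<open>Compilation of bounded-loop programs to counter programs\<close>

fun repeat :: "nat \<Rightarrow> com \<Rightarrow> com" where
  "repeat 0 c = Skip"
| "repeat (Suc n) c = c ;; repeat n c"

definition reset :: "reg \<Rightarrow> com" where
  "reset r = While (Pos r) (Act (Dec r))"

text \<open>
  \<open>add_code t r e\<close> adds \<open>e\<close> to \<open>r\<close>, and \<open>bool_code d t b\<close> leaves the truth value of \<open>b\<close> in \<open>Tmp t\<close>.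
  Here \<open>d\<close> is the length of the environment, and the scratch registers \<open>Tmp t, Tmp (t + 1), \<dots>\<close> are
  zero before and (except for the result) after.
\<close>

fun add_code :: "nat \<Rightarrow> reg \<Rightarrow> aexp \<Rightarrow> com" where
  "add_code t r (Cst c) = repeat c (Act (Inc r))"
| "add_code t r (Lev k) =
     While (Pos (Var k)) (Act (Dec (Var k)) ;; (Act (Inc r) ;; Act (Inc (Tmp t)))) ;;
     While (Pos (Tmp t)) (Act (Dec (Tmp t)) ;; Act (Inc (Var k)))"
| "add_code t r (Add a b) = add_code t r a ;; add_code t r b"
| "add_code t r (Mul a b) =
     add_code (t + 1) (Tmp t) a ;;
     While (Pos (Tmp t)) (Act (Dec (Tmp t)) ;; add_code (t + 1) r b)"

fun bool_code :: "nat \<Rightarrow> nat \<Rightarrow> bexp \<Rightarrow> com" where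
  "bool_code d t (BLess a b) =
     add_code (t + 3) (Tmp (t + 1)) a ;; (add_code (t + 3) (Tmp (t + 2)) b ;;
     (While (Pos (Tmp (t + 1))) (Act (Dec (Tmp (t + 1))) ;; Act (Dec (Tmp (t + 2)))) ;;
     (Cond (Pos (Tmp (t + 2))) (Act (Inc (Tmp t))) Skip ;; reset (Tmp (t + 2)))))"
| "bool_code d t (BRead A e) =
     add_code (t + 1) (Arr A) e ;;
     (Cond (Holds (Arr A) (Some True)) (Act (Inc (Tmp t))) Skip ;; reset (Arr A))"
| "bool_code d t (BNot b) =
     bool_code d (t + 1) b ;;
     Cond (Pos (Tmp (t + 1))) (Act (Dec (Tmp (t + 1)))) (Act (Inc (Tmp t)))"
| "bool_code d t (BAnd b c) =
     bool_code d (t + 1) b ;;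
     Cond (Pos (Tmp (t + 1))) (Act (Dec (Tmp (t + 1))) ;; bool_code d t c) Skip"
| "bool_code d t (BEx e b) =
     add_code (t + 2) (Tmp (t + 1)) e ;;
     (While (Pos (Tmp (t + 1)))
        (Act (Dec (Tmp (t + 1))) ;; (bool_code (d + 1) (t + 2) b ;;
         (Cond (Pos (Tmp (t + 2)))
            (Act (Dec (Tmp (t + 2))) ;; Cond (Pos (Tmp t)) Skip (Act (Inc (Tmp t)))) Skip ;;
          Act (Inc (Var d))))) ;;
      reset (Var d))"

fun code :: "nat \<Rightarrow> nat \<Rightarrow> cmd \<Rightarrow> com" where
  "code d t Nop = Skip"
| "code d t (Assign A e b) =
     bool_code d t b ;; (add_code (t + 1) (Arr A) e ;;
     (Cond (Pos (Tmp t)) (Act (Dec (Tmp t)) ;; Act (Write (Arr A) True))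
        (Act (Write (Arr A) False)) ;;
      reset (Arr A)))"
| "code d t (Then c1 c2) = code d t c1 ;; code d t c2"
| "code d t (For e c) =
     add_code (t + 1) (Tmp t) e ;;
     (While (Pos (Tmp t))
        (Act (Dec (Tmp t)) ;; (code (d + 1) (t + 1) c ;; Act (Inc (Var d)))) ;;
      reset (Var d))"

section \<open>Polynomial bounds on values and running times, read off the syntax\<close>

fun abound :: "aexp \<Rightarrow> nat poly" where
  "abound (Cst c) = [:c:]"
| "abound (Lev k) = [:0, 1:]"
| "abound (Add a b) = abound a + abound b"
| "abound (Mul a b) = abound a * abound b"

fun atime :: "aexp \<Rightarrow> nat poly" where
  "atime (Cst c) = [:2 * c:]"
| "atime (Lev k) = [:3, 12:]"
| "atime (Add a b) = atime a + atime b + [:1:]"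
| "atime (Mul a b) = atime a + abound a * (atime b + [:4:]) + [:2:]"

text \<open>The argument of the polynomial bounds all entries of the environment. Below a quantifier
  or loop there is one more entry, smaller than the value of \<open>e\<close>; this is the
  composition with \<open>[:0, 1:] + abound e\<close>. The numerals round up the fixed numbers of
  control steps.\<close>

fun btime :: "bexp \<Rightarrow> nat poly" where
  "btime (BLess a b) = atime a + atime b + [:5:] * abound a + [:3:] * abound b + [:20:]"
| "btime (BRead A e) = atime e + [:3:] * abound e + [:10:]"
| "btime (BNot b) = btime b + [:5:]"
| "btime (BAnd b c) = btime b + btime c + [:10:]"
| "btime (BEx e b) = atime e +
     abound e * (pcompose (btime b) ([:0, 1:] + abound e) + [:20:]) + [:10:]"

fun ctime :: "cmd \<Rightarrow> nat poly" where
  "ctime Nop = 0"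
| "ctime (Assign A e b) = btime b + atime e + [:3:] * abound e + [:20:]"
| "ctime (Then c d) = ctime c + ctime d + [:1:]"
| "ctime (For e c) = atime e +
     abound e * (pcompose (ctime c) ([:0, 1:] + abound e) + [:10:]) + [:10:]"

lemma look_snoc: "look (\<rho> @ [i]) k = (if k = length \<rho> then i else look \<rho> k)"
  by (auto simp: look_def nth_append)

lemma look_le: "\<forall>x \<in> set \<rho>. x \<le> M \<Longrightarrow> look \<rho> k \<le> M"
  by (auto simp: look_def)

lemma aval_le: "\<forall>x \<in> set \<rho>. x \<le> M \<Longrightarrow> aval \<rho> e \<le> poly (abound e) M"
  by (induction e) (auto intro: add_mono mult_mono look_le)

lemma run_repeat_Inc: "run (repeat c (Act (Inc r))) (h, m) (h(r := h r + c), m) (2 * c)"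
proof (induction c arbitrary: h)
  case 0
  show ?case unfolding repeat.simps by (rule run_eq[OF run_Skip]) (auto simp: fun_eq_iff)
next
  case (Suc c)
  show ?case unfolding repeat.simps
    by (rule run_eq[OF run_Seq[OF run_Inc Suc.IH]]) (auto simp: fun_eq_iff)
qed

lemma run_reset: "run (reset r) (h, m) (h(r := 0), m) (h r * 3 + 1)"
proof -
  let ?\<sigma> = "\<lambda>i. (h(r := h r - i), m)"
  have "run (Act (Dec r)) (?\<sigma> i) (?\<sigma> (Suc i)) 1" for i
    by (rule run_eq[OF run_Dec]) (auto simp: fun_eq_iff)
  then have loop: "run (reset r) (?\<sigma> 0) (?\<sigma> (h r)) (h r * (1 + 2) + 1)"
    unfolding reset_def by (intro run_While[where \<sigma> = "?\<sigma>"]) auto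
  have eq: "?\<sigma> 0 = (h, m)" by simp
  show ?thesis by (rule run_eq[OF loop[unfolded eq]]) auto
qed

text \<open>A counter can be evaluated only by counting it down. For \<open>Lev k\<close> the value
  is therefore moved both to \<open>r\<close> and to a scratch counter, from which
  \<open>Var k\<close> is restored.\<close>

lemma run_add_code:
  assumes "\<And>k. h (Var k) = look \<rho> k" "\<And>t'. t \<le> t' \<Longrightarrow> h (Tmp t') = 0 \<and> r \<noteq> Tmp t'"
    and "\<And>k. r \<noteq> Var k" "\<forall>x \<in> set \<rho>. x \<le> M"
  shows "run (add_code t r e) (h, m) (h(r := h r + aval \<rho> e), m) (poly (atime e) M)"
  using assms
proof (induction e arbitrary: t r h)
  case (Cst c)
  show ?case unfolding add_code.simps
    by (rule run_eq[OF run_repeat_Inc]) auto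
next
  case (Lev k)
  let ?v = "look \<rho> k"
  \<comment> \<open>\<open>?\<sigma> i\<close> and \<open>?\<tau> i\<close> are the stores after
    \<open>i\<close> rounds of the transfer and of the restoring loop.\<close>
  let ?\<sigma> = "\<lambda>i. (h(Var k := ?v - i, r := h r + i, Tmp t := i), m)"
  let ?\<tau> = "\<lambda>i. (h(Var k := i, r := h r + ?v, Tmp t := ?v - i), m)"
  have r: "r \<noteq> Tmp t" "r \<noteq> Var k" using Lev.prems by auto
  have "run (Act (Dec (Var k)) ;; (Act (Inc r) ;; Act (Inc (Tmp t)))) (?\<sigma> i) (?\<sigma> (Suc i)) 5" for i
    by (rule run_eq[OF run_Seq[OF run_Dec run_Seq[OF run_Inc run_Inc]]])
       (use r in \<open>auto simp: fun_eq_iff\<close>)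
  then have 1: "run (While (Pos (Var k)) (Act (Dec (Var k)) ;; (Act (Inc r) ;; Act (Inc (Tmp t)))))
      (?\<sigma> 0) (?\<sigma> ?v) (?v * (5 + 2) + 1)"
    by (intro run_While[where \<sigma> = "?\<sigma>"]) (use r in auto)
  have "run (Act (Dec (Tmp t)) ;; Act (Inc (Var k))) (?\<tau> i) (?\<tau> (Suc i)) 3" if "i < ?v" for i
    by (rule run_eq[OF run_Seq[OF run_Dec run_Inc]]) (use r that in \<open>auto simp: fun_eq_iff\<close>)
  then have 2: "run (While (Pos (Tmp t)) (Act (Dec (Tmp t)) ;; Act (Inc (Var k))))
      (?\<tau> 0) (?\<tau> ?v) (?v * (3 + 2) + 1)"
    by (intro run_While[where \<sigma> = "?\<tau>"]) (use r in auto)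
  have eq: "?\<sigma> 0 = (h, m)" "?\<sigma> ?v = ?\<tau> 0" "?\<tau> ?v = (h(r := h r + ?v), m)"
    using Lev.prems(1)[of k] Lev.prems(2)[of t] r by (auto simp: fun_eq_iff)
  have "?v \<le> M" using Lev.prems(4) by (rule look_le)
  then show ?case unfolding add_code.simps aval.simps
    by (intro run_eq[OF run_Seq[OF 1[unfolded eq] 2[unfolded eq]]]) auto
next
  case (Add a b)
  have a: "run (add_code t r a) (h, m) (h(r := h r + aval \<rho> a), m) (poly (atime a) M)"
    by (rule Add.IH(1)) (use Add.prems in auto)
  have b: "run (add_code t r b) (h(r := h r + aval \<rho> a), m)
      (h(r := h r + aval \<rho> a, r := (h(r := h r + aval \<rho> a)) r + aval \<rho> b), m) (poly (atime b) M)"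
    by (rule Add.IH(2)) (use Add.prems in auto)
  show ?case unfolding add_code.simps
    by (rule run_eq[OF run_Seq[OF a b]]) (auto simp: fun_eq_iff)
next
  case (Mul a b)
  let ?x = "aval \<rho> a" and ?y = "aval \<rho> b"
  let ?\<sigma> = "\<lambda>i. (h(Tmp t := ?x - i, r := h r + i * ?y), m)"
  let ?\<tau> = "\<lambda>i. h(Tmp t := ?x - Suc i, r := h r + i * ?y)"
  have r: "r \<noteq> Tmp t" using Mul.prems by auto
  have z: "?\<tau> i (Tmp t') = 0 \<and> r \<noteq> Tmp t'" if "t + 1 \<le> t'" for i t'
    using Mul.prems(2)[of t'] that by auto
  have a: "run (add_code (t + 1) (Tmp t) a) (h, m) (h(Tmp t := h (Tmp t) + ?x), m)
      (poly (atime a) M)"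
    by (rule Mul.IH(1)) (use Mul.prems in auto)
  have 1: "run (Act (Dec (Tmp t))) (?\<sigma> i) (?\<tau> i, m) 1" for i
    by (rule run_eq[OF run_Dec]) (use r in \<open>auto simp: fun_eq_iff\<close>)
  have 2: "run (add_code (t + 1) r b) (?\<tau> i, m) ((?\<tau> i)(r := ?\<tau> i r + ?y), m)
      (poly (atime b) M)" for i
    by (rule Mul.IH(2); (rule z, assumption | use Mul.prems(1,3,4) in auto))
  have "run (Act (Dec (Tmp t)) ;; add_code (t + 1) r b) (?\<sigma> i) (?\<sigma> (Suc i))
      (poly (atime b) M + 2)" for i
    by (rule run_eq[OF run_Seq[OF 1 2]]) (auto simp: fun_eq_iff)
  then have loop: "run (While (Pos (Tmp t)) (Act (Dec (Tmp t)) ;; add_code (t + 1) r b))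
      (?\<sigma> 0) (?\<sigma> ?x) (?x * (poly (atime b) M + 2 + 2) + 1)"
    by (intro run_While[where \<sigma> = "?\<sigma>"]) (use r in auto)
  have eq: "?\<sigma> 0 = (h(Tmp t := h (Tmp t) + ?x), m)" "?\<sigma> ?x = (h(r := h r + ?x * ?y), m)"
    using Mul.prems(2)[of t] r by (auto simp: fun_eq_iff)
  have "?x * (poly (atime b) M + 4) \<le> poly (abound a) M * (poly (atime b) M + 4)"
    using aval_le[OF Mul.prems(4)] by (rule mult_right_mono) simp
  then show ?case unfolding add_code.simps aval.simps
    by (intro run_eq[OF run_Seq[OF a loop[unfolded eq]]]) (auto simp: algebra_simps)
qed

definition ready :: "nat list \<Rightarrow> nat \<Rightarrow> (reg \<Rightarrow> nat) \<Rightarrow> bool" where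
  "ready \<rho> t h \<longleftrightarrow> (\<forall>k. h (Var k) = look \<rho> k) \<and> (\<forall>t' \<ge> t. h (Tmp t') = 0) \<and> (\<forall>A. h (Arr A) = 0)"

text \<open>\<open>None\<close> and \<open>Some False\<close> both stand for \<open>False\<close>,
  so blank arrays, and the cells behind the input, already represent \<open>False\<close>.\<close>

definition represents :: "(reg \<Rightarrow> nat \<Rightarrow> bool option) \<Rightarrow> arrays \<Rightarrow> bool" where
  "represents m S \<longleftrightarrow> (\<forall>A i. (m (Arr A) i = Some True) = S A i)"

lemma run_bool_code:
  assumes "ready \<rho> t h" "represents m S" "\<forall>x \<in> set \<rho>. x \<le> M"
  shows "run (bool_code (length \<rho>) t b) (h, m) (h(Tmp t := of_bool (bval \<rho> S b)), m)
    (poly (btime b) M)"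
  using assms
proof (induction b arbitrary: \<rho> t h M)
  case (BLess a b)
  let ?x = "aval \<rho> a" and ?y = "aval \<rho> b"
  let ?T = "Tmp t" and ?T1 = "Tmp (t + 1)" and ?T2 = "Tmp (t + 2)"
  note h = BLess.prems(1)[unfolded ready_def]
  have x: "?x \<le> poly (abound a) M" and y: "?y \<le> poly (abound b) M"
    using aval_le[OF BLess.prems(3)] by auto
  have 1: "run (add_code (t + 3) ?T1 a) (h, m) (h(?T1 := h ?T1 + ?x), m) (poly (atime a) M)"
    by (rule run_add_code) (use h BLess.prems(3) in auto)
  have 2: "run (add_code (t + 3) ?T2 b) (h(?T1 := h ?T1 + ?x), m)
      (h(?T1 := h ?T1 + ?x, ?T2 := (h(?T1 := h ?T1 + ?x)) ?T2 + ?y), m) (poly (atime b) M)"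
    by (rule run_add_code) (use h BLess.prems(3) in auto)
  \<comment> \<open>\<open>Dec\<close> stops at 0. After \<open>?x\<close> rounds the second counter
    holds the truncated difference \<open>?y - ?x\<close>, which is positive iff
    \<open>?x < ?y\<close>.\<close>
  let ?\<sigma> = "\<lambda>i. (h(?T1 := ?x - i, ?T2 := ?y - i), m)"
  have "run (Act (Dec ?T1) ;; Act (Dec ?T2)) (?\<sigma> i) (?\<sigma> (Suc i)) 3" for i
    by (rule run_eq[OF run_Seq[OF run_Dec run_Dec]]) (auto simp: fun_eq_iff)
  then have 3: "run (While (Pos ?T1) (Act (Dec ?T1) ;; Act (Dec ?T2)))
      (?\<sigma> 0) (?\<sigma> ?x) (?x * (3 + 2) + 1)"
    by (intro run_While[where \<sigma> = "?\<sigma>"]) auto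
  have eq: "(h(?T1 := h ?T1 + ?x, ?T2 := (h(?T1 := h ?T1 + ?x)) ?T2 + ?y), m) = ?\<sigma> 0"
    using h by (auto simp: fun_eq_iff)
  let ?h = "h(?T := of_bool (?x < ?y), ?T1 := 0, ?T2 := ?y - ?x)"
  have 4: "run (Cond (Pos ?T2) (Act (Inc ?T)) Skip) (?\<sigma> ?x) (?h, m) 2"
  proof (cases "?x < ?y")
    case True
    then show ?thesis
      by (intro run_eq[OF outcomes_Cond[where t = 1]]) (auto intro: run_eq[OF run_Inc] simp: fun_eq_iff h)
  next
    case False
    then show ?thesis
      by (intro run_eq[OF outcomes_Cond[where t = 1]])
        (use h in \<open>auto intro!: run_eq[OF run_Skip] simp: fun_eq_iff\<close>)
  qed
  show ?case unfolding bool_code.simps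
    by (rule run_eq[OF run_Seq[OF 1 run_Seq[OF 2[unfolded eq] run_Seq[OF 3 run_Seq[OF 4 run_reset]]]]])
       (use x y h in \<open>auto simp: fun_eq_iff\<close>)
next
  case (BRead A e)
  let ?x = "aval \<rho> e" and ?T = "Tmp t"
  note h = BRead.prems(1)[unfolded ready_def]
  have x: "?x \<le> poly (abound e) M" using aval_le[OF BRead.prems(3)] by auto
  let ?h = "h(Arr A := h (Arr A) + ?x)"
  have 1: "run (add_code (t + 1) (Arr A) e) (h, m) (?h, m) (poly (atime e) M)"
    by (rule run_add_code) (use h BRead.prems(3) in auto)
  have 2: "run (Cond (Holds (Arr A) (Some True)) (Act (Inc ?T)) Skip) (?h, m)
      (?h(?T := of_bool (S A ?x)), m) 2"
  proof (cases "S A ?x")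
    case True
    then show ?thesis
      using h BRead.prems(2) by (intro run_eq[OF outcomes_Cond[where t = 1]])
        (auto intro: run_eq[OF run_Inc] simp: fun_eq_iff represents_def)
  next
    case False
    then show ?thesis
      using h BRead.prems(2) by (intro run_eq[OF outcomes_Cond[where t = 1]])
        (auto intro!: run_eq[OF run_Skip] simp: fun_eq_iff represents_def)
  qed
  show ?case
    unfolding bool_code.simps
    by (rule run_eq[OF run_Seq[OF 1 run_Seq[OF 2 run_reset]]])
      (use x h in \<open>auto simp: fun_eq_iff\<close>)
next
  case (BNot b)
  let ?T = "Tmp t" and ?T1 = "Tmp (t + 1)"
  note h = BNot.prems(1)[unfolded ready_def]
  have 1: "run (bool_code (length \<rho>) (t + 1) b) (h, m) (h(?T1 := of_bool (bval \<rho> S b)), m)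
      (poly (btime b) M)"
    using BNot.prems by (intro BNot.IH) (auto simp: ready_def)
  have 2: "run (Cond (Pos ?T1) (Act (Dec ?T1)) (Act (Inc ?T))) (h(?T1 := of_bool (bval \<rho> S b)), m)
      (h(?T := of_bool (\<not> bval \<rho> S b)), m) 2"
    using h by (intro run_eq[OF outcomes_Cond[where t = 1]])
      (auto intro!: run_eq[OF run_Inc] run_eq[OF run_Dec] simp: fun_eq_iff)
  show ?case unfolding bool_code.simps
    by (rule run_eq[OF run_Seq[OF 1 2]]) auto
next
  case (BAnd b c)
  let ?T = "Tmp t" and ?T1 = "Tmp (t + 1)"
  note h = BAnd.prems(1)[unfolded ready_def]
  have 1: "run (bool_code (length \<rho>) (t + 1) b) (h, m) (h(?T1 := of_bool (bval \<rho> S b)), m)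
      (poly (btime b) M)"
    using BAnd.prems by (intro BAnd.IH) (auto simp: ready_def)
  have 2: "run (bool_code (length \<rho>) t c) (h, m) (h(?T := of_bool (bval \<rho> S c)), m)
      (poly (btime c) M)"
    using BAnd.prems by (intro BAnd.IH)
  have 3: "run (Act (Dec ?T1)) (h(?T1 := 1), m) (h, m) 1"
    using h by (intro run_eq[OF run_Dec]) (auto simp: fun_eq_iff)
  have 4: "run (Cond (Pos ?T1) (Act (Dec ?T1) ;; bool_code (length \<rho>) t c) Skip)
      (h(?T1 := of_bool (bval \<rho> S b)), m) (h(?T := of_bool (bval \<rho> S (BAnd b c))), m)
      (Suc (1 + 1 + poly (btime c) M))"
  proof (cases "bval \<rho> S b")
    case True
    then show ?thesis
      using run_Seq[OF 3 2] by (intro outcomes_Cond) simp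
  next
    case False
    then show ?thesis
      using h by (intro outcomes_Cond) (auto intro!: run_eq[OF run_Skip] simp: fun_eq_iff)
  qed
  show ?case unfolding bool_code.simps
    by (rule run_eq[OF run_Seq[OF 1 4]]) auto
next
  case (BEx e b)
  let ?x = "aval \<rho> e" and ?T = "Tmp t" and ?T1 = "Tmp (t + 1)" and ?T2 = "Tmp (t + 2)"
  let ?d = "length \<rho>"
  note h = BEx.prems(1)[unfolded ready_def]
  have x: "?x \<le> poly (abound e) M" using aval_le[OF BEx.prems(3)] by auto
  have d: "h (Var ?d) = 0" using h by (simp add: look_def)
  \<comment> \<open>The bound variable takes values below \<open>?x\<close>, so \<open>?M\<close>
    bounds the extended environment.\<close>
  let ?M = "M + poly (abound e) M"
  let ?Q = "\<lambda>i. \<exists>j < i. bval (\<rho> @ [j]) S b"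
  let ?\<sigma> = "\<lambda>i. (h(?T1 := ?x - i, ?T := of_bool (?Q i), Var ?d := i), m)"
  let ?h = "\<lambda>i. h(?T1 := ?x - Suc i, ?T := of_bool (?Q i), Var ?d := i)"
  let ?body = "Act (Dec ?T1) ;; (bool_code (?d + 1) (t + 2) b ;;
         (Cond (Pos ?T2) (Act (Dec ?T2) ;; Cond (Pos ?T) Skip (Act (Inc ?T))) Skip ;;
          Act (Inc (Var ?d))))"
  have 1: "run (add_code (t + 2) ?T1 e) (h, m) (?\<sigma> 0) (poly (atime e) M)"
    by (rule run_eq[OF run_add_code[of h \<rho> _ _ M]]) (use h BEx.prems(3) d in \<open>auto simp: fun_eq_iff\<close>)
  have body: "run ?body (?\<sigma> i) (?\<sigma> (Suc i)) (poly (btime b) ?M + 10)" if i: "i < ?x" for i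
  proof -
    have 2: "run (Act (Dec ?T1)) (?\<sigma> i) (?h i, m) 1"
      by (rule run_eq[OF run_Dec]) (auto simp: fun_eq_iff)
    let ?g = "(?h i)(?T2 := of_bool (bval (\<rho> @ [i]) S b))"
    have "run (bool_code (length (\<rho> @ [i])) (t + 2) b) (?h i, m) (?g, m) (poly (btime b) ?M)"
      by (rule BEx.IH) (use h BEx.prems x i in \<open>auto simp: ready_def look_snoc\<close>)
    then have 3: "run (bool_code (?d + 1) (t + 2) b) (?h i, m) (?g, m) (poly (btime b) ?M)" by simp
    have Q: "?Q (Suc i) = (?Q i \<or> bval (\<rho> @ [i]) S b)" by (auto simp: less_Suc_eq)
    have 4: "run (Cond (Pos ?T2) (Act (Dec ?T2) ;; Cond (Pos ?T) Skip (Act (Inc ?T))) Skip)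
        (?g, m) ((?h i)(?T := of_bool (?Q (Suc i))), m) 5"
    proof (cases "bval (\<rho> @ [i]) S b")
      case False
      then show ?thesis unfolding Q using h
        by (intro run_eq[OF outcomes_Cond[where t = 3]])
           (auto intro!: run_eq[OF run_Skip] simp: fun_eq_iff)
    next
      case True
      have 5: "run (Act (Dec ?T2)) (?g, m) (?h i, m) 1"
        by (rule run_eq[OF run_Dec]) (use True h in \<open>auto simp: fun_eq_iff\<close>)
      have 6: "run (Cond (Pos ?T) Skip (Act (Inc ?T))) (?h i, m) ((?h i)(?T := 1), m) 2"
        by (intro run_eq[OF outcomes_Cond[where t = 1]])
           (auto intro!: run_eq[OF run_Skip] run_eq[OF run_Inc] simp: fun_eq_iff)
      have 7: "run (Act (Dec ?T2) ;; Cond (Pos ?T) Skip (Act (Inc ?T))) (?g, m)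
          ((?h i)(?T := 1), m) 4"
        by (rule run_eq[OF run_Seq[OF 5 6]]) auto
      have p: "passes (?g, m) (Pos ?T2)" using True by simp
      show ?thesis
        by (rule run_eq[OF outcomes_Cond[of "(?g, m)" "Pos ?T2", unfolded if_P[OF p], OF 7]])
           (use True Q in auto)
    qed
    show ?thesis
      by (rule run_eq[OF run_Seq[OF 2 run_Seq[OF 3 run_Seq[OF 4 run_Inc]]]])
         (auto simp: fun_eq_iff)
  qed
  have loop: "run (While (Pos ?T1) ?body) (?\<sigma> 0) (?\<sigma> ?x) (?x * (poly (btime b) ?M + 10 + 2) + 1)"
    using body by (intro run_While[where \<sigma> = "?\<sigma>"]) auto
  have le: "?x * (poly (btime b) ?M + 20) \<le> poly (abound e) M * (poly (btime b) ?M + 20)"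
    using x by (rule mult_right_mono) simp
  show ?case unfolding bool_code.simps
    by (rule run_eq[OF run_Seq[OF 1 run_Seq[OF loop run_reset]]])
       (use h d le x in \<open>auto simp: fun_eq_iff poly_pcompose algebra_simps\<close>)
qed

text \<open>The arrays do not determine the final memory, as \<open>False\<close> has two
  representations; it is therefore quantified existentially. The registers return to their initial
  values.\<close>

lemma run_code:
  assumes "ready \<rho> t h" "represents m S" "\<forall>x \<in> set \<rho>. x \<le> M"
  shows "\<exists>m'. represents m' (exec \<rho> c S) \<and>
    run (code (length \<rho>) t c) (h, m) (h, m') (poly (ctime c) M)"
  using assms
proof (induction c arbitrary: \<rho> t m S M h)
  case Nop
  then show ?case by (auto intro: outcomes.finished)
next
  case (Assign A e b)
  let ?x = "aval \<rho> e" and ?T = "Tmp t" and ?b = "bval \<rho> S b"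
  note h = Assign.prems(1)[unfolded ready_def]
  have x: "?x \<le> poly (abound e) M" using aval_le[OF Assign.prems(3)] by auto
  let ?h = "h(?T := of_bool ?b)" 
  let ?h' = "?h(Arr A := ?h (Arr A) + ?x)"
  let ?m = "m(Arr A := (m (Arr A))(?x := Some ?b))"
  have 1: "run (bool_code (length \<rho>) t b) (h, m) (?h, m) (poly (btime b) M)"
    using Assign.prems by (rule run_bool_code)
  have 2: "run (add_code (t + 1) (Arr A) e) (?h, m) (?h', m) (poly (atime e) M)"
    by (rule run_add_code) (use h Assign.prems(3) in auto)
  have 3: "run (Cond (Pos ?T) (Act (Dec ?T) ;; Act (Write (Arr A) True)) (Act (Write (Arr A) False)))
    (?h', m) (?h'(?T := 0), ?m) 4"
  proof (cases ?b)
    case True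
    have "run (Act (Dec ?T) ;; Act (Write (Arr A) True)) (?h', m) (?h'(?T := 0), ?m) 3"
      by (rule run_eq[OF run_Seq[OF run_Dec run_Write]]) (use True h in \<open>auto simp: fun_eq_iff\<close>)
    then show ?thesis
      by (intro run_eq[OF outcomes_Cond[where t = 3]]) (use True in auto)
  next
    case False
    have "run (Act (Write (Arr A) False)) (?h', m) (?h'(?T := 0), ?m) 3"
      by (rule run_eq[OF run_Write]) (use False h in \<open>auto simp: fun_eq_iff\<close>)
    then show ?thesis
      by (intro run_eq[OF outcomes_Cond[where t = 3]]) (use False in auto)
  qed
  have "run (code (length \<rho>) t (Assign A e b)) (h, m) (h, ?m) (poly (ctime (Assign A e b)) M)"
    unfolding code.simps
    by (rule run_eq[OF run_Seq[OF 1 run_Seq[OF 2 run_Seq[OF 3 run_reset]]]])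
       (use h x in \<open>auto simp: fun_eq_iff\<close>)
  moreover have "represents ?m (exec \<rho> (Assign A e b) S)"
    using Assign.prems(2) by (auto simp: represents_def)
  ultimately show ?case by blast
next
  case (Then c1 c2)
  obtain m1 where 1: "represents m1 (exec \<rho> c1 S)"
      "run (code (length \<rho>) t c1) (h, m) (h, m1) (poly (ctime c1) M)"
    using Then.IH(1)[OF Then.prems] by blast
  obtain m2 where 2: "represents m2 (exec \<rho> c2 (exec \<rho> c1 S))"
      "run (code (length \<rho>) t c2) (h, m1) (h, m2) (poly (ctime c2) M)"
    using Then.IH(2)[OF Then.prems(1) 1(1) Then.prems(3)] by blast
  show ?case
    using 2(1) run_Seq[OF 1(2) 2(2)] by (auto simp: algebra_simps)
next
  case (For e c)
  let ?x = "aval \<rho> e" and ?T = "Tmp t" and ?d = "length \<rho>"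
  note h = For.prems(1)[unfolded ready_def]
  have x: "?x \<le> poly (abound e) M" using aval_le[OF For.prems(3)] by auto
  have d: "h (Var ?d) = 0" using h by (simp add: look_def)
  let ?M = "M + poly (abound e) M"
  let ?S = "\<lambda>i. fold (\<lambda>i. exec (\<rho> @ [i]) c) [0..<i] S"
  let ?h = "\<lambda>i. h(?T := ?x - Suc i, Var ?d := i)"
  have step: "\<exists>m'. represents m' (?S (Suc i)) \<and>
      run (code (?d + 1) (t + 1) c) (?h i, m) (?h i, m') (poly (ctime c) ?M)"
    if "i < ?x" "represents m (?S i)" for i m
  proof -
    have "\<exists>m'. represents m' (exec (\<rho> @ [i]) c (?S i)) \<and>
        run (code (length (\<rho> @ [i])) (t + 1) c) (?h i, m) (?h i, m') (poly (ctime c) ?M)"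
      by (rule For.IH) (use h For.prems x that in \<open>auto simp: ready_def look_snoc\<close>)
    then show ?thesis by simp
  qed
  \<comment> \<open>The memory after each round is chosen recursively, since only its existence is
    known from the induction hypothesis.\<close>
  define \<mu> where "\<mu> = rec_nat m (\<lambda>i m. SOME m'. represents m' (?S (Suc i)) \<and>
      run (code (?d + 1) (t + 1) c) (?h i, m) (?h i, m') (poly (ctime c) ?M))"
  have \<mu>0: "\<mu> 0 = m" by (simp add: \<mu>_def)
  have \<mu>Suc: "represents (\<mu> (Suc i)) (?S (Suc i)) \<and>
      run (code (?d + 1) (t + 1) c) (?h i, \<mu> i) (?h i, \<mu> (Suc i)) (poly (ctime c) ?M)"
    if "i < ?x" "represents (\<mu> i) (?S i)" for i
    using someI_ex[OF step[OF that]] unfolding \<mu>_def by simp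
  have \<mu>: "represents (\<mu> i) (?S i)" if "i \<le> ?x" for i
    using that by (induction i) (use \<mu>0 For.prems(2) \<mu>Suc in auto)
  let ?\<sigma> = "\<lambda>i. (h(?T := ?x - i, Var ?d := i), \<mu> i)"
  have 1: "run (add_code (t + 1) ?T e) (h, m) (?\<sigma> 0) (poly (atime e) M)"
    by (rule run_eq[OF run_add_code[of h \<rho> _ _ M]])
       (use h For.prems(3) d \<mu>0 in \<open>auto simp: fun_eq_iff\<close>)
  have "run (Act (Dec ?T) ;; (code (?d + 1) (t + 1) c ;; Act (Inc (Var ?d)))) (?\<sigma> i) (?\<sigma> (Suc i))
      (poly (ctime c) ?M + 4)" if i: "i < ?x" for i
  proof -
    have 2: "run (Act (Dec ?T)) (?\<sigma> i) (?h i, \<mu> i) 1"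
      by (rule run_eq[OF run_Dec]) (auto simp: fun_eq_iff)
    note 3 = conjunct2[OF \<mu>Suc[OF i \<mu>]]
    show ?thesis
      by (rule run_eq[OF run_Seq[OF 2 run_Seq[OF 3 run_Inc]]]) (use i in \<open>auto simp: fun_eq_iff\<close>)
  qed
  then have loop: "run (While (Pos ?T)
        (Act (Dec ?T) ;; (code (?d + 1) (t + 1) c ;; Act (Inc (Var ?d)))))
      (?\<sigma> 0) (?\<sigma> ?x) (?x * (poly (ctime c) ?M + 4 + 2) + 1)"
    by (intro run_While[where \<sigma> = "?\<sigma>"]) auto
  have le: "?x * (poly (ctime c) ?M + 10) \<le> poly (abound e) M * (poly (ctime c) ?M + 10)"
    using x by (rule mult_right_mono) simp
  have "run (code ?d t (For e c)) (h, m) (h, \<mu> ?x) (poly (ctime (For e c)) M)"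
    unfolding code.simps
    by (rule run_eq[OF run_Seq[OF 1 run_Seq[OF loop run_reset]]])
       (use h d le x in \<open>auto simp: fun_eq_iff poly_pcompose algebra_simps\<close>)
  then show ?case using \<mu>[of ?x] by auto
qed

section \<open>Simulation by Turing machines\<close>

fun plain :: "bool option \<Rightarrow> symbol" where
  "plain None = Blank"
| "plain (Some b) = Bit b"

text \<open>A machine cannot see the position of a head. A second copy of the three cell contents,
  used at cell 0 only, lets it recognise that a counter is zero without losing the content of that
  cell.\<close>

fun marked :: "bool option \<Rightarrow> symbol" where
  "marked None = Work 0"
| "marked (Some b) = Work (if b then 2 else 1)"

fun content :: "symbol \<Rightarrow> bool option" where
  "content Blank = None"
| "content (Bit b) = Some b"
| "content (Work k) = (if k = 0 then None else Some (k = 2))"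

fun is_mark :: "symbol \<Rightarrow> bool" where
  "is_mark (Work k) = True"
| "is_mark _ = False"

lemma content_simps [simp]:
  "content (plain x) = x" "content (marked x) = x" "\<not> is_mark (plain x)" "is_mark (marked x)"
  by (cases x; simp)+

definition alphabet :: "symbol set" where
  "alphabet = range plain \<union> range marked"

lemma finite_alphabet: "finite alphabet"
  by (simp add: alphabet_def)

text \<open>The head of the tape of a register stands at the value of the register; cell \<open>0\<close> is marked.\<close>

definition tape_of :: "store \<Rightarrow> reg \<Rightarrow> (int \<Rightarrow> symbol) \<times> int" where
  "tape_of s r =
     (\<lambda>i. if i < 0 then Blank else if i = 0 then marked (snd s r 0) else plain (snd s r (nat i)),
      int (fst s r))"

definition scan :: "store \<Rightarrow> reg \<Rightarrow> symbol" where
  "scan s r = (if fst s r = 0 then marked (snd s r 0) else plain (snd s r (fst s r)))"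

fun observe :: "(reg \<Rightarrow> symbol) \<Rightarrow> test \<Rightarrow> bool" where
  "observe g (Pos r) \<longleftrightarrow> \<not> is_mark (g r)"
| "observe g (Holds r x) \<longleftrightarrow> content (g r) = x"

fun written :: "instr option \<Rightarrow> (reg \<Rightarrow> symbol) \<Rightarrow> reg \<Rightarrow> symbol" where
  "written (Some (Write r b)) g r' =
     (if r' = r then (if is_mark (g r) then marked (Some b) else plain (Some b)) else g r')"
| "written _ g r' = g r'"

text \<open>Staying on the mark realises the truncated predecessor of 0.\<close>

fun moved :: "instr option \<Rightarrow> (reg \<Rightarrow> symbol) \<Rightarrow> reg \<Rightarrow> move" where
  "moved (Some (Inc r)) g r' = (if r' = r then MoveRight else Stay)"
| "moved (Some (Dec r)) g r' = (if r' = r \<and> \<not> is_mark (g r) then MoveLeft else Stay)"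
| "moved _ g r' = Stay"

lemma scan_tape_of: "(\<lambda>(t, h). t h) (tape_of s r) = scan s r"
  by (simp add: tape_of_def scan_def)

lemma scan_alphabet: "scan s r \<in> alphabet"
  by (simp add: scan_def alphabet_def)

lemma observe_scan: "observe (scan s) = passes s"
proof
  fix b show "observe (scan s) b = passes s b"
    by (cases s; cases b) (auto simp: scan_def)
qed

lemma tape_of_perform:
  "tape_of (perform i s) r =
    (case tape_of s r of (t, h) \<Rightarrow> (t(h := written i (scan s) r), h + shift (moved i (scan s) r)))"
proof -
  obtain h m where s: "s = (h, m)" by (cases s)
  show ?thesis
  proof (cases i)
    case None
    then show ?thesis by (auto simp: tape_of_def s scan_def fun_eq_iff)
  next
    case (Some j)
    then show ?thesis
      by (cases j) (auto simp: tape_of_def s scan_def fun_eq_iff)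
  qed
qed

text \<open>Contains every command that can remain during the execution. It is finite because an
  unfolded loop comes back to the very same \<open>While b c\<close>; it provides the states of the
  machine.\<close>

fun reach :: "com \<Rightarrow> com set" where
  "reach Skip = {Skip}"
| "reach (Act i) = {Act i, Skip}"
| "reach (c1 ;; c2) = (\<lambda>c. c ;; c2) ` reach c1 \<union> reach c2"
| "reach (Cond b c1 c2) = {Cond b c1 c2} \<union> reach c1 \<union> reach c2"
| "reach (While b c) = {While b c, Skip} \<union> (\<lambda>d. d ;; While b c) ` reach c"
| "reach (Choice c1 c2) = {Choice c1 c2} \<union> reach c1 \<union> reach c2"

fun instr_reg :: "instr \<Rightarrow> reg" where
  "instr_reg (Inc r) = r" | "instr_reg (Dec r) = r" | "instr_reg (Write r b) = r"

fun test_reg :: "test \<Rightarrow> reg" where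
  "test_reg (Pos r) = r" | "test_reg (Holds r x) = r"

fun regs :: "com \<Rightarrow> reg set" where
  "regs Skip = {}"
| "regs (Act i) = {instr_reg i}"
| "regs (c1 ;; c2) = regs c1 \<union> regs c2"
| "regs (Cond b c1 c2) = {test_reg b} \<union> regs c1 \<union> regs c2"
| "regs (While b c) = {test_reg b} \<union> regs c"
| "regs (Choice c1 c2) = regs c1 \<union> regs c2"

lemma finite_reach: "finite (reach c)"
  by (induction c) auto

lemma finite_regs: "finite (regs c)"
  by (induction c) auto

lemma reach_self: "c \<in> reach c"
  by (induction c) auto

lemma regs_reach: "d \<in> reach c \<Longrightarrow> regs d \<subseteq> regs c"
  by (induction c arbitrary: d) fastforce+

lemma reach_nxt: "d \<in> reach c \<Longrightarrow> (d', i) \<in> nxt \<tau> d \<Longrightarrow> d' \<in> reach c"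
proof (induction c arbitrary: d d' i)
  case (Seq c1 c2)
  then show ?case by (fastforce simp: reach_self split: if_splits)
next
  case (Cond b c1 c2)
  then show ?case by (auto simp: reach_self split: if_splits)
next
  case (While b c)
  then show ?case by (fastforce simp: reach_self split: if_splits)
next
  case (Choice c1 c2)
  then show ?case by (auto simp: reach_self)
qed auto

text \<open>Distinct successors of one store thus differ in the remaining command, and therefore in
  the state of the machine.\<close>

lemma nxt_unique: "(d, i) \<in> nxt \<tau> c \<Longrightarrow> (d, j) \<in> nxt \<tau> c \<Longrightarrow> i = j"
  by (induction \<tau> c arbitrary: d rule: nxt.induct) (auto split: if_splits)

lemma nxt_cong: "(\<And>r. r \<in> regs c \<Longrightarrow> g r = g' r) \<Longrightarrow> nxt (observe g) c = nxt (observe g') c"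
proof (induction c)
  case (Cond b c1 c2)
  then have "observe g b = observe g' b" by (cases b) auto
  then show ?case by simp
next
  case (While b c)
  then have "observe g b = observe g' b" by (cases b) auto
  then show ?case by simp
qed auto

text \<open>State \<open>0\<close> only marks cell \<open>0\<close> of every tape; state \<open>Suc (f c)\<close> stands for the command \<open>c\<close>.\<close>

definition machine_of :: "com \<Rightarrow> (com \<Rightarrow> nat) \<Rightarrow> reg list \<Rightarrow> machine" where
  "machine_of c0 f rs = \<lparr>num_tapes = length rs, start_state = 0, transitions =
     {(0, map g rs, Suc (f c0), map (\<lambda>r. marked (content (g r))) rs, map (\<lambda>r. Stay) rs) | g.
        range g \<subseteq> alphabet} \<union>
     {(Suc (f c), map g rs, Suc (f c'), map (written i g) rs, map (moved i g) rs) | c c' i g.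
        c \<in> reach c0 \<and> (c', i) \<in> nxt (observe g) c \<and> range g \<subseteq> alphabet}\<rparr>"

definition config_of :: "(com \<Rightarrow> nat) \<Rightarrow> reg list \<Rightarrow> com \<times> store \<Rightarrow> config" where
  "config_of f rs x = (Suc (f (fst x)), map (tape_of (snd x)) rs)"

definition init_store :: "bool list \<Rightarrow> store" where
  "init_store x =
     (\<lambda>_. 0, \<lambda>r i. if r = Arr 0 \<and> i < length x then Some (x ! i) else None)"

lemma written_alphabet: "range g \<subseteq> alphabet \<Longrightarrow> written i g r \<in> alphabet"
proof (cases i)
  case (Some j)
  then show "range g \<subseteq> alphabet \<Longrightarrow> ?thesis"
    by (cases j) (auto simp: alphabet_def simp del: plain.simps marked.simps)
qed auto

text \<open>The functions \<open>g\<close> range over all registers, but a transition contains only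
  their values on \<open>rs\<close>, and the alphabet is finite.\<close>

lemma ntm_machine_of:
  assumes "rs \<noteq> []"
  shows "ntm (machine_of c0 f rs)"
proof -
  let ?Q = "insert 0 ((\<lambda>c. Suc (f c)) ` reach c0)"
  let ?L = "{as. set as \<subseteq> alphabet \<and> length as = length rs}"
  let ?D = "{ds. set ds \<subseteq> {MoveLeft, Stay, MoveRight} \<and> length ds = length rs}"
  have D: "set ds \<subseteq> {MoveLeft, Stay, MoveRight}" for ds :: "move list"
    using move.exhaust by blast
  have "transitions (machine_of c0 f rs) \<subseteq> ?Q \<times> ?L \<times> ?Q \<times> ?L \<times> ?D"
  proof
    fix \<delta> assume "\<delta> \<in> transitions (machine_of c0 f rs)"
    then consider (1) g where
        "\<delta> = (0, map g rs, Suc (f c0), map (\<lambda>r. marked (content (g r))) rs, map (\<lambda>r. Stay) rs)"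
        "range g \<subseteq> alphabet"
      | (2) c c' i g where
        "\<delta> = (Suc (f c), map g rs, Suc (f c'), map (written i g) rs, map (moved i g) rs)"
        "c \<in> reach c0" "(c', i) \<in> nxt (observe g) c" "range g \<subseteq> alphabet"
      unfolding machine_of_def machine.simps Un_iff mem_Collect_eq by blast
    then show "\<delta> \<in> ?Q \<times> ?L \<times> ?Q \<times> ?L \<times> ?D"
    proof cases
      case 1
      then show ?thesis using reach_self[of c0] D
        by (auto simp: alphabet_def)
    next
      case 2
      have "c' \<in> reach c0" using reach_nxt 2 by blast
      moreover have "written i g r \<in> alphabet" for r using written_alphabet 2 by blast
      ultimately show ?thesis using 2 D by auto
    qed
  qed
  moreover have "finite (?Q \<times> ?L \<times> ?Q \<times> ?L \<times> ?D)"
    by (intro finite_cartesian_product finite.insertI finite_imageI finite_lists_length_eq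
        finite_alphabet finite_reach finite.emptyI)
  ultimately have "finite (transitions (machine_of c0 f rs))" by (rule finite_subset)
  then show ?thesis using assms by (auto simp: ntm_def machine_of_def Suc_le_eq)
qed

lemma map_zip3:
  "map (\<lambda>((t, h), b, d). (t(h := b), h + shift d)) (zip (map T rs) (zip (map B rs) (map D rs))) =
   map (\<lambda>r. case T r of (t, h) \<Rightarrow> (t(h := B r), h + shift (D r))) rs"
  by (induction rs) (auto simp: case_prod_unfold)

text \<open>An exact simulation: since paths are counted, the machine may neither lose nor add
  successors. Injectivity of \<open>f\<close> recovers the command from the state, and the symbols
  on \<open>rs\<close> decide everything that the command tests.\<close>

lemma step_config_of:
  assumes f: "inj_on f (reach c0)" and rs: "regs c0 \<subseteq> set rs" and c: "c \<in> reach c0"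
  shows "{d. step (machine_of c0 f rs) (config_of f rs (c, s)) d} = config_of f rs ` succs (c, s)"
    (is "?L = ?R")
proof
  have reads: "map (\<lambda>(t, h). t h) (map (tape_of s) rs) = map (scan s) rs"
    using scan_tape_of by simp
  show "?L \<subseteq> ?R"
  proof
    fix d assume "d \<in> ?L"
    then obtain q' ts' bs ds where d: "d = (q', ts')"
      and tr: "(Suc (f c), map (scan s) rs, q', bs, ds) \<in> transitions (machine_of c0 f rs)"
      and ts': "ts' = map (\<lambda>((t, h), b, d). (t(h := b), h + shift d))
                  (zip (map (tape_of s) rs) (zip bs ds))"
      by (cases d) (auto simp: config_of_def reads simp del: map_map)
    from tr obtain e c' i g where e: "f c = f e" "e \<in> reach c0" "map (scan s) rs = map g rs"
      "q' = Suc (f c')" "bs = map (written i g) rs" "ds = map (moved i g) rs"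
      "(c', i) \<in> nxt (observe g) e"
      unfolding machine_of_def by auto
    have "e = c" using e f c by (auto dest: inj_onD)
    have g: "scan s r = g r" if "r \<in> set rs" for r using e(3) that by simp
    have "nxt (observe (scan s)) c = nxt (observe g) c"
      using g regs_reach[OF c] rs by (intro nxt_cong) auto
    then have c': "(c', i) \<in> nxt (passes s) c" using e(7) \<open>e = c\<close> by (simp add: observe_scan)
    have "written i g r = written i (scan s) r \<and> moved i g r = moved i (scan s) r"
      if "r \<in> set rs" for r
      using g[OF that] by (cases i; cases "the i") auto
    then have "bs = map (written i (scan s)) rs" "ds = map (moved i (scan s)) rs"
      using e(5,6) by auto
    then have "d = config_of f rs (c', perform i s)"
      unfolding d ts' by (simp add: map_zip3 config_of_def tape_of_perform e(4))
    then show "d \<in> ?R" using c' by (force simp: succs_def)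
  qed
  show "?R \<subseteq> ?L"
  proof
    fix d assume "d \<in> ?R"
    then obtain c' i where c': "(c', i) \<in> nxt (passes s) c"
      and d: "d = config_of f rs (c', perform i s)"
      by (auto simp: succs_def)
    have "(Suc (f c), map (scan s) rs, Suc (f c'), map (written i (scan s)) rs,
        map (moved i (scan s)) rs) \<in> transitions (machine_of c0 f rs)"
      unfolding machine_of_def machine.simps Un_iff mem_Collect_eq
      by (rule disjI2, rule exI[of _ c], rule exI[of _ c'], rule exI[of _ i], rule exI[of _ "scan s"])
        (use c c' scan_alphabet[of s] in \<open>auto simp: observe_scan\<close>)
    then show "d \<in> ?L"
      unfolding d mem_Collect_eq config_of_def step.simps fst_conv snd_conv reads
      by (intro exI conjI) (assumption, simp add: map_zip3 tape_of_perform)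
  qed
qed

text \<open>The machine starts on unmarked tapes with the input on the first one, which must
  therefore belong to \<open>Arr 0\<close>; distinctness makes all other tapes blank. The marking
  step is forced and leaves the number of paths unchanged.\<close>

lemma initial_step:
  assumes "distinct (Arr 0 # rs)" 
  shows "{d. step (machine_of c0 f (Arr 0 # rs)) (initial_config (machine_of c0 f (Arr 0 # rs)) x) d}
     = {config_of f (Arr 0 # rs) (c0, init_store x)}"
    (is "{d. step ?M ?i d} = {?c}")
proof -
  let ?rs = "Arr 0 # rs"
  let ?m = "snd (init_store x)"
  let ?raw = "\<lambda>r. (\<lambda>i. if i < 0 then Blank else plain (?m r (nat i)), 0 :: int)"
  have "map ?raw rs = replicate (length rs) (\<lambda>_. Blank, 0)"
    using assms by (intro replicate_eqI) (auto simp: init_store_def fun_eq_iff)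
  moreover have "(\<lambda>i. if 0 \<le> i \<and> i < int (length x) then Bit (x ! nat i) else Blank, 0) = ?raw (Arr 0)"
    by (auto simp: init_store_def fun_eq_iff)
  ultimately have i: "?i = (0, map ?raw ?rs)"
    by (simp add: initial_config_def machine_of_def)
  have reads: "map (\<lambda>(t, h). t h) (map ?raw ?rs) = map (\<lambda>r. plain (?m r 0)) ?rs" by simp
  have mark: "(case ?raw r of (t, h) \<Rightarrow> (t(h := marked (?m r 0)), h + shift Stay))
      = tape_of (init_store x) r" for r
    by (auto simp: tape_of_def init_store_def fun_eq_iff)
  show ?thesis
  proof (intro equalityI subsetI)
    fix d assume "d \<in> {d. step ?M ?i d}"
    then obtain q' ts' bs ds where d: "d = (q', ts')"
      and tr: "(0, map (\<lambda>r. plain (?m r 0)) ?rs, q', bs, ds) \<in> transitions ?M"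
      and ts': "ts' = map (\<lambda>((t, h), b, d). (t(h := b), h + shift d))
                  (zip (map ?raw ?rs) (zip bs ds))"
      unfolding i mem_Collect_eq by (cases d) (simp only: step.simps reads, blast)
    from tr obtain g where g: "map (\<lambda>r. plain (?m r 0)) ?rs = map g ?rs" "q' = Suc (f c0)"
      "bs = map (\<lambda>r. marked (content (g r))) ?rs" "ds = map (\<lambda>r. Stay) ?rs"
      unfolding machine_of_def by auto
    have "content (g r) = ?m r 0" if "r \<in> set ?rs" for r
      using g(1) that by (metis content_simps(1) map_eq_conv)
    then have bs: "bs = map (\<lambda>r. marked (?m r 0)) ?rs" unfolding g(3) by simp
    have "ts' = map (tape_of (init_store x)) ?rs"
      unfolding ts' bs g(4) map_zip3 mark ..
    then show "d \<in> {?c}" unfolding d by (simp add: g(2) config_of_def)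
  next
    fix d assume "d \<in> {?c}"
    moreover have "(0, map (\<lambda>r. plain (?m r 0)) ?rs, Suc (f c0),
        map (\<lambda>r. marked (content (plain (?m r 0)))) ?rs, map (\<lambda>r. Stay) ?rs) \<in> transitions ?M"
      unfolding machine_of_def by (simp only: machine.simps Un_iff mem_Collect_eq)
        (rule disjI1, intro exI conjI, rule refl, auto simp: alphabet_def)
    ultimately show "d \<in> {d. step ?M ?i d}"
      unfolding i mem_Collect_eq config_of_def singleton_iff
      by (simp only: step.simps reads content_simps fst_conv snd_conv)
         (intro exI conjI, assumption, simp only: map_zip3 mark)
  qed
qed

section \<open>Computation paths as chains of a relation\<close>

definition chain :: "('c \<Rightarrow> 'c \<Rightarrow> bool) \<Rightarrow> 'c \<Rightarrow> 'c list \<Rightarrow> bool" where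
  "chain R x cs \<longleftrightarrow> cs \<noteq> [] \<and> hd cs = x \<and> (\<forall>i. Suc i < length cs \<longrightarrow> R (cs ! i) (cs ! Suc i))"

lemma chain_iff:
  "chain R x cs \<longleftrightarrow> cs = [x] \<or> (\<exists>y cs'. R x y \<and> chain R y cs' \<and> cs = x # cs')"
proof (cases cs rule: list.exhaust)
  case (Cons z cs')
  show ?thesis
  proof (cases cs')
    case Nil
    then show ?thesis using Cons by (auto simp: chain_def)
  next
    case C: (Cons y ds)
    have "(\<forall>i. Suc i < length cs \<longrightarrow> R (cs ! i) (cs ! Suc i)) \<longleftrightarrow>
        R z y \<and> (\<forall>i. Suc i < length cs' \<longrightarrow> R (cs' ! i) (cs' ! Suc i))"
      unfolding Cons C by (auto simp: less_Suc_eq_0_disj nth_Cons split: nat.splits)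
    then show ?thesis using Cons C by (auto simp: chain_def)
  qed
qed (simp add: chain_def)

lemma chain_length:
  assumes "chain R x cs" and "\<And>y cs'. R x y \<Longrightarrow> chain R y cs' \<Longrightarrow> length cs' \<le> t"
  shows "length cs \<le> Suc t"
  using assms(1) chain_iff[of R x cs] assms(2) by auto

text \<open>Computation paths from an arbitrary starting point, so that they can be split after the
  first step.\<close>

definition full_chains :: "('c \<Rightarrow> 'c \<Rightarrow> bool) \<Rightarrow> 'c \<Rightarrow> 'c list set" where
  "full_chains R x = {cs. chain R x cs \<and> (\<nexists>c. R (last cs) c)}"

lemma full_chains_halted: "{y. R x y} = {} \<Longrightarrow> full_chains R x = {[x]}"
  unfolding full_chains_def by (subst chain_iff) auto

lemma full_chains_step:
  assumes "{y. R x y} \<noteq> {}"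
  shows "full_chains R x = (\<Union>y \<in> {y. R x y}. (#) x ` full_chains R y)"
proof -
  have "cs \<noteq> []" if "chain R y cs" for y cs using that by (simp add: chain_def)
  then show ?thesis
    unfolding full_chains_def using assms by (subst chain_iff) (auto 0 3)
qed

lemma hd_full_chains: "cs \<in> full_chains R x \<Longrightarrow> cs \<noteq> [] \<and> hd cs = x"
  by (simp add: full_chains_def chain_def)

text \<open>Each path is its first configuration followed by a path from a successor. At a branching
  the two sets of continuations are disjoint because their first configurations differ.\<close>

lemma outcomes_paths:
  assumes f: "inj_on f (reach c0)" and rs: "regs c0 \<subseteq> set rs"
  shows "outcomes x ss t \<Longrightarrow> fst x \<in> reach c0 \<Longrightarrow>
    finite (full_chains (step (machine_of c0 f rs)) (config_of f rs x)) \<and>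
    card (full_chains (step (machine_of c0 f rs)) (config_of f rs x)) = length ss \<and>
    (\<forall>cs. chain (step (machine_of c0 f rs)) (config_of f rs x) cs \<longrightarrow> length cs \<le> Suc t)"
proof (induction rule: outcomes.induct)
  let ?R = "step (machine_of c0 f rs)" and ?C = "config_of f rs"
  have succs: "{d. ?R (?C x) d} = ?C ` succs x" if "fst x \<in> reach c0" for x
    using step_config_of[OF f rs that, of "snd x"] by simp
  have closed: "fst y \<in> reach c0" if "fst x \<in> reach c0" "y \<in> succs x" for x y
    using that reach_nxt by (auto simp: succs_def)
  {
    case (finished s t)
    have "{d. ?R (?C (Skip, s)) d} = {}" unfolding succs[OF finished] by (simp add: succs_def)
    moreover from this have "length cs \<le> Suc t" if "chain ?R (?C (Skip, s)) cs" for cs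
    proof -
      have "cs = [?C (Skip, s)]"
        using that chain_iff[of ?R "?C (Skip, s)" cs] \<open>{d. ?R (?C (Skip, s)) d} = {}\<close> by blast
      then show ?thesis by simp
    qed
    ultimately show ?case by (auto simp: full_chains_halted)
  next
    case (forced x y ss t)
    have R: "{d. ?R (?C x) d} = {?C y}" unfolding succs[OF forced.prems] forced.hyps(1) by simp
    have IH: "finite (full_chains ?R (?C y))" "card (full_chains ?R (?C y)) = length ss"
      "\<And>cs. chain ?R (?C y) cs \<Longrightarrow> length cs \<le> Suc t"
      using forced.IH closed[OF forced.prems] forced.hyps(1) by auto
    have "full_chains ?R (?C x) = (#) (?C x) ` full_chains ?R (?C y)"
      using full_chains_step[of ?R "?C x"] R by simp
    moreover have "length cs \<le> Suc (Suc t)" if "chain ?R (?C x) cs" for cs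
      using that by (rule chain_length) (metis R IH(3) mem_Collect_eq singletonD)
    ultimately show ?case using IH(1,2) by (auto simp: card_image)
  next
    case (branch x y z ss t ss')
    have R: "{d. ?R (?C x) d} = {?C y, ?C z}"
      unfolding succs[OF branch.prems] branch.hyps(1) by simp
    have yz: "fst y \<in> reach c0" "fst z \<in> reach c0"
      using closed[OF branch.prems] branch.hyps(1) by auto
    note IHy = branch.IH(1)[OF yz(1)] and IHz = branch.IH(2)[OF yz(2)]
    obtain c s where x: "x = (c, s)" by (cases x)
    have "fst y \<noteq> fst z"
    proof
      assume eq: "fst y = fst z"
      have two: "(\<lambda>(c, i). (c, perform i s)) ` nxt (passes s) c = {y, z}"
        using branch.hyps(1) by (simp add: succs_def x)
      have "y \<in> {y, z}" "z \<in> {y, z}" by auto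
      then obtain i j where "(fst y, i) \<in> nxt (passes s) c" "y = (fst y, perform i s)"
          "(fst z, j) \<in> nxt (passes s) c" "z = (fst z, perform j s)"
        unfolding two[symmetric] by auto
      then have "y = z" using nxt_unique eq by metis
      then show False using branch.hyps(2) by simp
    qed
    then have "?C y \<noteq> ?C z" using f yz by (auto simp: config_of_def dest: inj_onD)
    then have "full_chains ?R (?C y) \<inter> full_chains ?R (?C z) = {}"
      by (metis disjoint_iff hd_full_chains)
    moreover have "full_chains ?R (?C x) =
        (#) (?C x) ` full_chains ?R (?C y) \<union> (#) (?C x) ` full_chains ?R (?C z)"
      using full_chains_step[of ?R "?C x"] R by simp
    moreover have "length cs \<le> Suc (Suc t)" if "chain ?R (?C x) cs" for cs
      using that by (rule chain_length) (metis R IHy IHz mem_Collect_eq insertE singletonD)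
    ultimately show ?case using IHy IHz
      by (auto simp: card_image card_Un_disjoint image_Un[symmetric])
  }
qed

text \<open>The time bound is demanded on all strings, whereas the number of paths may be computed
  separately for each input, from any derivation of \<open>outcomes\<close>.\<close>

theorem machine_for_command:
  assumes bound: "\<And>x. \<exists>ss. outcomes (c0, init_store x) ss (poly p (length x))"
  obtains M where "ntm M" "polynomial_time M"
    "\<And>x ss t. outcomes (c0, init_store x) ss t \<Longrightarrow> tot M x = length ss - 1"
proof -
  obtain f :: "com \<Rightarrow> nat" where f: "inj_on f (reach c0)"
    using finite_imp_inj_to_nat_seg[OF finite_reach[of c0]] by blast
  obtain rs where rs: "set rs = regs c0 - {Arr 0}" "distinct rs"
    using finite_distinct_list[of "regs c0 - {Arr 0}"] finite_regs by auto
  let ?rs = "Arr 0 # rs"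
  let ?M = "machine_of c0 f ?rs"
  let ?R = "step ?M" and ?C = "config_of f ?rs"
  have regs: "regs c0 \<subseteq> set ?rs" using rs by auto
  have first: "{d. ?R (initial_config ?M x) d} = {?C (c0, init_store x)}" for x
    using rs by (intro initial_step) auto
  have pc: "partial_computation ?M x = chain ?R (initial_config ?M x)" for x
    by (auto simp: partial_computation_def chain_def fun_eq_iff)
  have cp: "computation_paths ?M x = (#) (initial_config ?M x) ` full_chains ?R (?C (c0, init_store x))"
    for x
    using full_chains_step[of ?R "initial_config ?M x"] first[of x]
    by (simp add: computation_paths_def pc full_chains_def halted_def)
  note * = outcomes_paths[OF f regs, of "(c0, init_store x)" for x, simplified, OF _ reach_self]
  have "tot ?M x = length ss - 1" if "outcomes (c0, init_store x) ss t" for x ss t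
    using *[OF that] by (simp add: tot_def cp card_image)
  \<comment> \<open>The additional \<open>[:1:]\<close> pays for the step that marks the
    tapes.\<close>
  moreover have "length cs - 1 \<le> poly (p + [:1:]) (length x)" if "partial_computation ?M x cs" for x cs
  proof -
    obtain ss where "outcomes (c0, init_store x) ss (poly p (length x))" using bound by blast
    note paths = *[OF this]
    have "length cs \<le> Suc (Suc (poly p (length x)))"
      using that unfolding pc by (rule chain_length) (metis first paths mem_Collect_eq singletonD)
    then show ?thesis by simp
  qed
  then have "polynomial_time ?M" unfolding polynomial_time_def by blast
  ultimately show ?thesis using that ntm_machine_of[of ?rs c0 f] by blast
qed

section \<open>Searching for witnesses bit by bit\<close>

text \<open>
  Array \<open>0\<close> is the input, array \<open>1\<close> the witness under construction, array \<open>2\<close> the implication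
  matrix; cell \<open>0\<close> of array \<open>3\<close> receives the outcome of the test, and cell \<open>0\<close> of array \<open>4\<close> keeps
  the outcome for the value \<open>False\<close> of the current bit. Level \<open>0\<close> is the size of the structure, level
  \<open>1\<close> the position of the current bit.
\<close>

definition extension_test :: "cmd \<Rightarrow> nat \<Rightarrow> (nat \<Rightarrow> bool) \<Rightarrow> (nat \<Rightarrow> bool) set \<Rightarrow> nat \<Rightarrow> bool" where
  "extension_test T n I W N \<longleftrightarrow>
     (\<forall>S j. S 0 = I \<longrightarrow> j < N \<longrightarrow>
        (exec [n, j] T S 3 0 \<longleftrightarrow> (\<exists>w \<in> W. \<forall>q \<le> j. w q = S 1 q)) \<and>
        (\<forall>A \<in> {0, 1, 4}. exec [n, j] T S A = S A))"

definition btrue :: bexp where "btrue = BLess (Cst 0) (Cst 1)"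
definition bfalse :: bexp where "bfalse = BLess (Cst 0) (Cst 0)"

lemma bval_const [simp]: "bval \<rho> S btrue" "\<not> bval \<rho> S bfalse"
  by (simp_all add: btrue_def bfalse_def)

text \<open>Both runs of \<open>T\<close> answer in array 3, so the first answer is rescued in array
  4. The value \<open>True\<close> is tried last and remains in the cell.\<close>

definition probe :: "cmd \<Rightarrow> cmd" where
  "probe T = Then (Assign 1 (Lev 1) bfalse) (Then T (Then (Assign 4 (Cst 0) (BRead 3 (Cst 0)))
     (Then (Assign 1 (Lev 1) btrue) T)))"

definition clear_bit :: cmd where
  "clear_bit = Assign 1 (Lev 1) bfalse"

text \<open>Since the probe leaves \<open>True\<close>, choosing it means \<open>Skip\<close>. If
  \<open>False\<close> is not extendable then \<open>True\<close> is taken without looking at array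
  3: for an extendable prefix it must work, and on meaningless inputs the search still goes on along
  a path.\<close>

definition choose_bit :: com where
  "choose_bit = Cond (Holds (Arr 4) (Some True))
     (Cond (Holds (Arr 3) (Some True)) (Choice (code 2 1 clear_bit) Skip) (code 2 1 clear_bit)) Skip"

definition search_body :: "cmd \<Rightarrow> com" where
  "search_body T = Act (Dec (Tmp 0)) ;; (code 2 1 (probe T) ;; (choose_bit ;; Act (Inc (Var 1))))"

text \<open>The input begins with \<open>n\<close> zeros and a one, so the first loop leaves the
  size of the structure in \<open>Var 0\<close>. \<open>Tmp 0\<close> counts the bits that are still
  to be chosen.\<close>

definition search :: "aexp \<Rightarrow> cmd \<Rightarrow> com" where
  "search NE T =
     While (Holds (Arr 0) (Some False)) (Act (Inc (Arr 0)) ;; Act (Inc (Var 0))) ;;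
     (reset (Arr 0) ;; (add_code 1 (Tmp 0) NE ;; While (Pos (Tmp 0)) (search_body T)))"

definition agreeing :: "(nat \<Rightarrow> bool) set \<Rightarrow> nat \<Rightarrow> (nat \<Rightarrow> bool) \<Rightarrow> (nat \<Rightarrow> bool) set" where
  "agreeing W j u = {w \<in> W. \<forall>q < j. w q = u q}"

lemma agreeing_split:
  "agreeing W j u = agreeing W (Suc j) (u(j := False)) \<union> agreeing W (Suc j) (u(j := True))"
  "agreeing W (Suc j) (u(j := False)) \<inter> agreeing W (Suc j) (u(j := True)) = {}"
  by (auto simp: agreeing_def less_Suc_eq)

text \<open>Witnesses vanish from \<open>N\<close> on, so their first \<open>N\<close> bits
  determine them: a path that has fixed all bits stands for exactly one witness.\<close>

lemma agreeing_full:
  assumes "\<And>w q. w \<in> W \<Longrightarrow> N \<le> q \<Longrightarrow> \<not> w q" "agreeing W N u \<noteq> {}"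
  shows "card (agreeing W N u) = 1"
proof -
  obtain w where w: "w \<in> agreeing W N u" using assms(2) by blast
  have "w' = w" if "w' \<in> agreeing W N u" for w'
  proof
    fix q show "w' q = w q"
      using w that assms(1)[of w q] assms(1)[of w' q]
      by (cases "q < N") (auto simp: agreeing_def)
  qed
  then have "agreeing W N u = {w}" using w by blast
  then show ?thesis by simp
qed

definition bit_time :: "cmd \<Rightarrow> nat \<Rightarrow> nat" where
  "bit_time T M = poly (ctime (probe T)) M + poly (ctime clear_bit) M + 10"

text \<open>Nothing is assumed about \<open>T\<close>, because the time bound must not depend on its
  correctness. The proviso \<open>S' 1 j\<close> reflects that the \<open>True\<close> branch keeps
  the cell as the probe left it.\<close>

lemma search_body_outcomes:
  fixes T :: cmd
  assumes h: "ready [n, j] 1 h" and k: "h (Tmp 0) = Suc k" and m: "represents m S"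
    and M: "n \<le> M" "j \<le> M"
  defines "S' \<equiv> exec [n, j] (probe T) S"
  shows "\<exists>\<mu>. (\<forall>b. S' 1 j \<longrightarrow> represents (\<mu> b) (S'(1 := (S' 1)(j := b)))) \<and>
    outcomes (search_body T, (h, m))
      (map (\<lambda>b. (h(Tmp 0 := k, Var 1 := Suc j), \<mu> b))
        (if S' 4 0 \<and> S' 3 0 then [False, True] else if S' 4 0 then [False] else [True]))
      (bit_time T M)"
proof -
  let ?h = "h(Tmp 0 := k)"
  let ?bs = "if S' 4 0 \<and> S' 3 0 then [False, True] else if S' 4 0 then [False] else [True]"
  let ?t = "poly (ctime clear_bit) M"
  have r: "ready [n, j] 1 ?h" using h by (auto simp: ready_def)
  have M': "\<forall>x \<in> set [n, j]. x \<le> M" using M by simp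
  have 1: "run (Act (Dec (Tmp 0))) (h, m) (?h, m) 1"
    by (rule run_eq[OF run_Dec]) (use k in auto)
  obtain m1 where m1: "represents m1 S'"
    and "run (code (length [n, j]) 1 (probe T)) (?h, m) (?h, m1) (poly (ctime (probe T)) M)"
    unfolding S'_def using run_code[OF r m M'] by blast
  then have 2: "run (code 2 1 (probe T)) (?h, m) (?h, m1) (poly (ctime (probe T)) M)"
    by (simp add: numeral_2_eq_2)
  obtain m2 where m2: "represents m2 (exec [n, j] clear_bit S')"
    and "run (code (length [n, j]) 1 clear_bit) (?h, m1) (?h, m2) ?t"
    using run_code[OF r m1 M'] by blast
  then have clear: "run (code 2 1 clear_bit) (?h, m1) (?h, m2) ?t"
    by (simp add: numeral_2_eq_2)
  have cb: "exec [n, j] clear_bit S' = S'(1 := (S' 1)(j := False))"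
    by (simp add: clear_bit_def look_def)
  define \<mu> where "\<mu> = (\<lambda>b. if b then m1 else m2)"
  have head: "?h (Arr A) = 0" for A using h by (simp add: ready_def)
  have t4: "passes (?h, m1) (Holds (Arr 4) (Some True)) = S' 4 0"
    and t3: "passes (?h, m1) (Holds (Arr 3) (Some True)) = S' 3 0"
    using m1 head by (auto simp: represents_def)
  have both: "outcomes (Choice (code 2 1 clear_bit) Skip, (?h, m1)) [(?h, m2), (?h, m1)] (Suc ?t)"
    using outcomes_Choice[OF _ clear outcomes_mono[OF run_Skip]]
    by (simp add: clear_bit_def)
  have 3: "outcomes (choose_bit, (?h, m1)) (map (\<lambda>b. (?h, \<mu> b)) ?bs) (Suc (Suc (Suc ?t)))"
    unfolding choose_bit_def
  proof (rule outcomes_Cond)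
    consider "S' 4 0" "S' 3 0" | "S' 4 0" "\<not> S' 3 0" | "\<not> S' 4 0" by blast
    then show "outcomes (if passes (?h, m1) (Holds (Arr 4) (Some True))
      then Cond (Holds (Arr 3) (Some True)) (Choice (code 2 1 clear_bit) Skip) (code 2 1 clear_bit)
      else Skip, (?h, m1)) (map (\<lambda>b. (?h, \<mu> b)) ?bs) (Suc (Suc ?t))"
    proof cases
      case 1
      have "outcomes (Cond (Holds (Arr 3) (Some True)) (Choice (code 2 1 clear_bit) Skip)
          (code 2 1 clear_bit), (?h, m1)) [(?h, m2), (?h, m1)] (Suc (Suc ?t))"
        by (rule outcomes_Cond) (simp only: t3 1 if_True both)
      then show ?thesis unfolding t4 using 1 by (simp add: \<mu>_def)
    next
      case 2
      have "outcomes (Cond (Holds (Arr 3) (Some True)) (Choice (code 2 1 clear_bit) Skip)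
          (code 2 1 clear_bit), (?h, m1)) [(?h, m2)] (Suc (Suc ?t))"
        by (rule outcomes_Cond) (simp only: t3 2 if_False outcomes_mono[OF clear le_SucI[OF order_refl]])
      then show ?thesis unfolding t4 using 2 by (simp add: \<mu>_def)
    next
      case 3
      then show ?thesis unfolding t4 by (auto simp: \<mu>_def intro!: outcomes.finished)
    qed
  qed
  have "outcomes (choose_bit ;; Act (Inc (Var 1)), (?h, m1))
      (concat (map (\<lambda>s. [(h(Tmp 0 := k, Var 1 := Suc j), snd s)]) (map (\<lambda>b. (?h, \<mu> b)) ?bs)))
      (Suc (Suc (Suc ?t)) + 1 + 1)"
  proof (rule outcomes_Seq[OF 3])
    fix s assume "s \<in> set (map (\<lambda>b. (?h, \<mu> b)) ?bs)"
    then have s: "s = (?h, snd s)" by (auto split: if_splits)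
    have "h (Var 1) = j" using h by (simp add: ready_def look_def)
    then show "run (Act (Inc (Var 1))) s (h(Tmp 0 := k, Var 1 := Suc j), snd s) 1"
      by (subst (1) s, intro run_eq[OF run_Inc]) auto
  qed
  then have 4: "outcomes (choose_bit ;; Act (Inc (Var 1)), (?h, m1))
      (map (\<lambda>b. (h(Tmp 0 := k, Var 1 := Suc j), \<mu> b)) ?bs) (Suc (Suc (Suc ?t)) + 1 + 1)"
    by (simp add: comp_def split del: if_split)
  have "outcomes (search_body T, (h, m))
      (map (\<lambda>b. (h(Tmp 0 := k, Var 1 := Suc j), \<mu> b)) ?bs) (bit_time T M)"
    unfolding search_body_def
    by (rule outcomes_mono[OF run_Seq_outcomes[OF 1 run_Seq_outcomes[OF 2 4]]])
      (simp add: bit_time_def)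
  moreover have "represents (\<mu> b) (S'(1 := (S' 1)(j := b)))" if "S' 1 j" for b
  proof (cases b)
    case True
    have "S'(1 := (S' 1)(j := True)) = S'" using that by (auto simp: fun_eq_iff)
    then show ?thesis using m1 True by (simp add: \<mu>_def)
  next
    case False
    then show ?thesis using m2 cb by (simp add: \<mu>_def)
  qed
  ultimately show ?thesis by blast
qed

lemma exec_probe:
  fixes T :: cmd
  assumes T: "extension_test T n I W N" and S: "S 0 = I" "j < N"
  defines "S' \<equiv> exec [n, j] (probe T) S"
  shows "S' 0 = I" "S' 1 = (S 1)(j := True)"
    "S' 4 0 \<longleftrightarrow> agreeing W (Suc j) ((S 1)(j := False)) \<noteq> {}" (is ?goal3)
    "S' 3 0 \<longleftrightarrow> agreeing W (Suc j) ((S 1)(j := True)) \<noteq> {}" (is ?goal4)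
proof -
  note T' = T[unfolded extension_test_def, rule_format]
  define S1 where "S1 = S(1 := (S 1)(j := False))"
  define S2 where "S2 = exec [n, j] T S1"
  define S3 where "S3 = S2(4 := (S2 4)(0 := S2 3 0), 1 := (S2 1)(j := True))"
  have S': "S' = exec [n, j] T S3"
    by (simp add: S'_def probe_def S3_def S2_def S1_def look_def)
  have "S1 0 = I" using S by (simp add: S1_def)
  note 1 = T'[of S1 j, OF this S(2)]
  have S2: "S2 0 = I" "S2 1 = (S 1)(j := False)"
    "S2 3 0 \<longleftrightarrow> (\<exists>w \<in> W. \<forall>q \<le> j. w q = ((S 1)(j := False)) q)"
    unfolding S2_def using 1 \<open>S1 0 = I\<close> by (auto simp: S1_def)
  have S3: "S3 0 = I" "S3 1 = (S 1)(j := True)" "S3 4 0 = S2 3 0"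
    using S2 by (auto simp: S3_def)
  note 2 = T'[of S3 j, OF S3(1) S(2)]
  show "S' 0 = I" "S' 1 = (S 1)(j := True)" unfolding S' using 2 S3 by auto
  show ?goal3
    unfolding S' using 2 S3 S2(3) by (auto simp: agreeing_def less_Suc_eq_le)
  show ?goal4
    unfolding S' using 2 S3(2) by (auto simp: agreeing_def less_Suc_eq_le)
qed

text \<open>The time bound is unconditional; the number of outcomes is claimed only if
  \<open>T\<close> is a correct test and the prefix is extendable. The witnesses that agree with the
  prefix split according to the next bit, and the test discards empty parts.\<close>

lemma search_loop_outcomes:
  assumes "ready [n, j] 1 h" "h (Tmp 0) = k" "represents m S" "n \<le> M" "j + k \<le> M"
  shows "\<exists>ss. outcomes (While (Pos (Tmp 0)) (search_body T), (h, m)) ss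
      (k * (bit_time T M + 2) + 1) \<and>
    (\<forall>I W. extension_test T n I W (j + k) \<longrightarrow> S 0 = I \<longrightarrow> finite W \<longrightarrow>
      (\<forall>w \<in> W. \<forall>q \<ge> j + k. \<not> w q) \<longrightarrow> agreeing W j (S 1) \<noteq> {} \<longrightarrow>
      length ss = card (agreeing W j (S 1)))"
  using assms
proof (induction k arbitrary: j h m S)
  case 0
  have "run (While (Pos (Tmp 0)) (search_body T)) (h, m) (h, m) 1"
    using 0 by (intro run_While_False) simp
  moreover have "length [(h, m)] = card (agreeing W j (S 1))"
    if "\<forall>w \<in> W. \<forall>q \<ge> j + 0. \<not> w q" "agreeing W j (S 1) \<noteq> {}" for W
  proof -
    have "card (agreeing W j (S 1)) = 1"
      by (rule agreeing_full) (use that in auto)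
    then show ?thesis by simp
  qed
  ultimately show ?case by (metis add.commute add_0 mult_0)
next
  case (Suc k)
  let ?S = "exec [n, j] (probe T) S"
  let ?bs = "if ?S 4 0 \<and> ?S 3 0 then [False, True] else if ?S 4 0 then [False] else [True]"
  let ?h = "h(Tmp 0 := k, Var 1 := Suc j)"
  let ?Sb = "\<lambda>b. ?S(1 := (?S 1)(j := b))"
  let ?loop = "While (Pos (Tmp 0)) (search_body T)"
  obtain \<mu> where \<mu>: "\<And>b. ?S 1 j \<Longrightarrow> represents (\<mu> b) (?Sb b)"
    and body: "outcomes (search_body T, (h, m)) (map (\<lambda>b. (?h, \<mu> b)) ?bs) (bit_time T M)"
    using search_body_outcomes[OF Suc.prems(1,2,3), of M T] Suc.prems(4,5) by auto
  have h: "ready [n, Suc j] 1 ?h"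
    using Suc.prems(1) by (auto simp: ready_def look_def nth_Cons split: nat.splits)
  \<comment> \<open>Reading the arrays off the memory makes the induction hypothesis applicable to
    every memory, so the outcomes can be chosen as a function of \<open>m\<close> alone.\<close>
  let ?C = "\<lambda>m A i. m (Arr A) i = Some True"
  have "\<exists>ss. outcomes (?loop, (?h, m)) ss (k * (bit_time T M + 2) + 1) \<and>
    (\<forall>I W. extension_test T n I W (j + Suc k) \<longrightarrow> ?C m 0 = I \<longrightarrow> finite W \<longrightarrow>
      (\<forall>w \<in> W. \<forall>q \<ge> j + Suc k. \<not> w q) \<longrightarrow> agreeing W (Suc j) (?C m 1) \<noteq> {} \<longrightarrow>
      length ss = card (agreeing W (Suc j) (?C m 1)))" for m
  proof -
    have "represents m (?C m)" by (simp add: represents_def)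
    moreover define h' where "h' = ?h"
    moreover have "h' (Tmp 0) = k" by (simp add: h'_def)
    ultimately show ?thesis
      using Suc.IH[of "Suc j" h' m "?C m"] h Suc.prems(4,5) unfolding h'_def[symmetric]
      by (simp add: \<open>h' (Tmp 0) = k\<close>)
  qed
  then obtain g where g: "\<And>m. outcomes (?loop, (?h, m)) (g m) (k * (bit_time T M + 2) + 1)"
    and len: "\<And>m I W. extension_test T n I W (j + Suc k) \<Longrightarrow> ?C m 0 = I \<Longrightarrow> finite W \<Longrightarrow>
      (\<forall>w \<in> W. \<forall>q \<ge> j + Suc k. \<not> w q) \<Longrightarrow> agreeing W (Suc j) (?C m 1) \<noteq> {} \<Longrightarrow>
      length (g m) = card (agreeing W (Suc j) (?C m 1))"
    by metis
  define ss where "ss = (\<lambda>b. g (\<mu> b))"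
  have "outcomes (search_body T ;; ?loop, (h, m))
      (concat (map (\<lambda>s. g (snd s)) (map (\<lambda>b. (?h, \<mu> b)) ?bs)))
      (bit_time T M + 1 + (k * (bit_time T M + 2) + 1))"
    by (rule outcomes_Seq[OF body]) (use g in \<open>auto split: if_splits\<close>)
  then have "outcomes (search_body T ;; ?loop, (h, m)) (concat (map ss ?bs))
      (bit_time T M + 1 + (k * (bit_time T M + 2) + 1))"
    by (simp add: ss_def comp_def)
  then have run: "outcomes (?loop, (h, m)) (concat (map ss ?bs)) (Suc k * (bit_time T M + 2) + 1)"
    using outcomes_While_True[of "(h, m)" "Pos (Tmp 0)"] Suc.prems(2) by (simp add: algebra_simps)
  have "length (concat (map ss ?bs)) = card (agreeing W j (S 1))"
    if T: "extension_test T n I W (j + Suc k)" and I: "S 0 = I" and W: "finite W"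
      "\<forall>w \<in> W. \<forall>q \<ge> j + Suc k. \<not> w q" "agreeing W j (S 1) \<noteq> {}" for I W
  proof -
    let ?A = "\<lambda>b. agreeing W (Suc j) ((S 1)(j := b))"
    note p = exec_probe[where S = S and j = j, OF T I, simplified]
    have l: "length (ss b) = card (?A b)" if "?A b \<noteq> {}" for b
    proof -
      have "?S 1 j" using p by simp
      then have "?C (\<mu> b) A i = ?Sb b A i" for A i using \<mu>[of b] by (simp add: represents_def)
      then have "?C (\<mu> b) 0 = I" "?C (\<mu> b) 1 = (S 1)(j := b)" using p by (auto simp: fun_eq_iff)
      then show ?thesis using len[OF T _ W(1,2), of "\<mu> b"] that by (simp add: ss_def)
    qed
    have fin: "finite (?A b)" for b using W(1) by (simp add: agreeing_def)
    show ?thesis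
      using p(3,4) W(3) l card_Un_disjoint[OF fin fin agreeing_split(2)]
      unfolding agreeing_split(1)[of W j "S 1"] by auto
  qed
  then show ?case using run by blast
qed

theorem search_machine:
  obtains M where "ntm M" "polynomial_time M"
    "\<And>x n W. n = length (takeWhile Not x) \<Longrightarrow>
       extension_test T n (\<lambda>i. i < length x \<and> x ! i) W (aval [n] NE) \<Longrightarrow> finite W \<Longrightarrow> W \<noteq> {} \<Longrightarrow>
       (\<And>w q. w \<in> W \<Longrightarrow> aval [n] NE \<le> q \<Longrightarrow> \<not> w q) \<Longrightarrow> tot M x = card W - 1"
proof -
  \<comment> \<open>Counting the leading zeros costs 5 steps per zero and rewinding the head 3,
    which gives 8; \<open>[:12:]\<close> is the 10 of \<open>bit_time\<close> plus the 2 control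
    steps of each round.\<close>
  define P where "P = [:0, 8:] + atime NE + abound NE *
    (pcompose (ctime (probe T) + ctime clear_bit + [:12:]) ([:0, 1:] + abound NE)) + [:10:]"
  have main: "\<exists>ss. outcomes (search NE T, init_store x) ss (poly P (length x)) \<and>
    (\<forall>W. extension_test T n (\<lambda>i. i < length x \<and> x ! i) W (aval [n] NE) \<longrightarrow> finite W \<longrightarrow> W \<noteq> {} \<longrightarrow>
       (\<forall>w \<in> W. \<forall>q \<ge> aval [n] NE. \<not> w q) \<longrightarrow> length ss = card W)"
    if n: "n = length (takeWhile Not x)" for x n
  proof -
    let ?L = "length x"
    obtain m where init: "init_store x = (\<lambda>_. 0, m)" and
      m: "m = (\<lambda>r i. if r = Arr 0 \<and> i < length x then Some (x ! i) else None)"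
      by (simp add: init_store_def)
    define z :: "reg \<Rightarrow> nat" where "z = (\<lambda>_. 0)"
    let ?N = "aval [n] NE"
    define S :: arrays where "S = (\<lambda>A i. A = 0 \<and> i < length x \<and> x ! i)"
    have S: "represents m S" by (auto simp: represents_def S_def m)
    have nL: "n \<le> ?L" unfolding n by (rule length_takeWhile_le)
    have NL: "?N \<le> poly (abound NE) ?L" using nL by (intro aval_le) auto
    let ?\<sigma> = "\<lambda>i. (z(Arr 0 := i, Var 0 := i), m)"
    have "\<not> x ! i" if "i < n" for i
      using that unfolding n by (metis nth_mem set_takeWhileD takeWhile_nth)
    moreover have "x ! n" if "n < ?L" using that unfolding n by (metis nth_length_takeWhile)
    moreover have "run (Act (Inc (Arr 0)) ;; Act (Inc (Var 0))) (?\<sigma> i) (?\<sigma> (Suc i)) 3" for i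
      by (rule run_eq[OF run_Seq[OF run_Inc run_Inc]]) (auto simp: fun_eq_iff)
    ultimately have 1: "run (While (Holds (Arr 0) (Some False)) (Act (Inc (Arr 0)) ;; Act (Inc (Var 0))))
        (?\<sigma> 0) (?\<sigma> n) (n * (3 + 2) + 1)"
      using nL by (intro run_While[where \<sigma> = "?\<sigma>"]) (auto simp: m)
    have 2: "run (reset (Arr 0)) (?\<sigma> n) (z(Var 0 := n), m) (n * 3 + 1)"
      by (rule run_eq[OF run_reset]) (auto simp: fun_eq_iff z_def)
    let ?h = "z(Var 0 := n, Tmp 0 := ?N)"
    have 3: "run (add_code 1 (Tmp 0) NE) (z(Var 0 := n), m) (?h, m) (poly (atime NE) ?L)"
      by (rule run_eq[OF run_add_code[where \<rho> = "[n]" and M = ?L]])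
         (use nL in \<open>auto simp: fun_eq_iff z_def look_def\<close>)
    let ?M = "?L + poly (abound NE) ?L"
    have "ready [n, 0] 1 ?h"
      by (auto simp: ready_def z_def look_def nth_Cons split: nat.splits)
    from search_loop_outcomes[OF this _ S, of ?N ?M T]
    obtain ss where 4: "outcomes (While (Pos (Tmp 0)) (search_body T), (?h, m)) ss
        (?N * (bit_time T ?M + 2) + 1)"
      and len: "\<And>W. extension_test T n (\<lambda>i. i < length x \<and> x ! i) W ?N \<Longrightarrow> finite W \<Longrightarrow> W \<noteq> {} \<Longrightarrow>
       (\<forall>w \<in> W. \<forall>q \<ge> ?N. \<not> w q) \<Longrightarrow> length ss = card W"
      using nL NL by (auto simp: agreeing_def S_def)
    have le: "?N * (bit_time T ?M + 2) \<le> poly (abound NE) ?L * (bit_time T ?M + 2)"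
      using NL by (rule mult_right_mono) simp
    have s0: "?\<sigma> 0 = init_store x" by (auto simp: init z_def fun_eq_iff)
    have "outcomes (search NE T, init_store x) ss (poly P ?L)"
      unfolding search_def s0[symmetric]
      by (rule outcomes_mono[OF run_Seq_outcomes[OF 1 run_Seq_outcomes[OF 2 run_Seq_outcomes[OF 3 4]]]])
        (use le nL in \<open>simp add: P_def bit_time_def poly_pcompose algebra_simps\<close>)
    then show ?thesis using len by blast
  qed
  then have "\<exists>ss. outcomes (search NE T, init_store x) ss (poly P (length x))" for x by blast
  from machine_for_command[OF this] obtain M where M: "ntm M" "polynomial_time M"
    "\<And>x ss t. outcomes (search NE T, init_store x) ss t \<Longrightarrow> tot M x = length ss - 1" by blast
  show ?thesis
  proof (rule that[OF M(1,2)])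
    fix x n W
    assume n: "n = length (takeWhile Not x)"
      and W: "extension_test T n (\<lambda>i. i < length x \<and> x ! i) W (aval [n] NE)" "finite W" "W \<noteq> {}"
       "\<And>w q. w \<in> W \<Longrightarrow> aval [n] NE \<le> q \<Longrightarrow> \<not> w q"
    obtain ss where "outcomes (search NE T, init_store x) ss (poly P (length x))" "length ss = card W"
      using main[OF n] W by blast
    then show "tot M x = card W - 1" using M(3) by auto
  qed
qed

section \<open>Satisfiability of 2-CNF formulae\<close>

text \<open>The literals of the propositional variable \<open>p\<close> are \<open>2 * p\<close> (positive) and \<open>2 * p + 1\<close>.\<close>

definition neg :: "nat \<Rightarrow> nat" where
  "neg l = (if even l then l + 1 else l - 1)"

abbreviation literals :: "nat \<Rightarrow> nat set" where
  "literals n \<equiv> {..<2 * n}"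

definition lit_true :: "(nat \<Rightarrow> bool) \<Rightarrow> nat \<Rightarrow> bool" where
  "lit_true w l \<longleftrightarrow> w (l div 2) = even l"

definition models :: "(nat \<Rightarrow> bool) \<Rightarrow> (nat \<times> nat) set \<Rightarrow> bool" where
  "models w \<Phi> \<longleftrightarrow> (\<forall>(l, l') \<in> \<Phi>. lit_true w l \<or> lit_true w l')"

text \<open>The implication graph: a clause is read as two implications, from the negation of either
  literal to the other literal.\<close>

definition arcs :: "(nat \<times> nat) set \<Rightarrow> (nat \<times> nat) set" where
  "arcs \<Phi> = (\<lambda>(l, l'). (neg l, l')) ` \<Phi> \<union> (\<lambda>(l, l'). (neg l', l)) ` \<Phi>"

lemma neg_neg [simp]: "neg (neg l) = l"
  by (auto simp: neg_def)

lemma neg_neq: "neg l \<noteq> l"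
  using odd_pos[of l] by (cases "even l") (auto simp: neg_def)

lemma neg_less: "l < 2 * n \<Longrightarrow> neg l < 2 * n"
  by (auto simp: neg_def elim!: evenE)

lemma lit_true_neg [simp]: "lit_true w (neg l) \<longleftrightarrow> \<not> lit_true w l"
  by (auto simp: lit_true_def neg_def elim!: oddE)

lemma models_arcs:
  "models w \<Phi> \<longleftrightarrow> (\<forall>(u, v) \<in> arcs \<Phi>. lit_true w u \<longrightarrow> lit_true w v)"
  by (auto simp: models_def arcs_def ball_Un split_beta)

lemma models_trancl:
  assumes "models w \<Phi>" "(u, v) \<in> (arcs \<Phi>)\<^sup>+" "lit_true w u"
  shows "lit_true w v"
  using assms(2,3)
proof (induction rule: trancl_induct)
  case (base v)
  then show ?case using assms(1) by (auto simp: models_arcs)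
next
  case (step v v')
  then show ?case using assms(1) by (auto simp: models_arcs)
qed

text \<open>Contraposition: the two arcs of a clause are contrapositives of each other, so paths can
  be reversed with all literals negated.\<close>

lemma skew_trancl: "(u, v) \<in> (arcs \<Phi>)\<^sup>+ \<Longrightarrow> (neg v, neg u) \<in> (arcs \<Phi>)\<^sup>+"
proof (induction rule: trancl_induct)
  case (base v)
  then have "(neg v, neg u) \<in> arcs \<Phi>" by (force simp: arcs_def)
  then show ?case by blast
next
  case (step v v')
  then have "(neg v', neg v) \<in> arcs \<Phi>" by (force simp: arcs_def)
  then show ?case using step.IH by (meson trancl_into_trancl2)
qed

text \<open>
  A consistent set of literals that is closed under implication is extended variable by variable:
  of the two literals of an undecided variable, one does not imply its own negation.
\<close>

lemma two_sat_extension: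
  assumes nc: "\<And>p. p < n \<Longrightarrow> \<not> ((2 * p, 2 * p + 1) \<in> R \<and> (2 * p + 1, 2 * p) \<in> R)"
    and R: "trans R" and skew: "\<And>u v. (u, v) \<in> R \<Longrightarrow> (neg v, neg u) \<in> R"
  shows "m \<le> n \<Longrightarrow> \<exists>A. (\<forall>u v. u \<in> A \<longrightarrow> (u, v) \<in> R \<longrightarrow> v \<in> A) \<and>
    (\<forall>u \<in> A. neg u \<notin> A) \<and> (\<forall>p < m. 2 * p \<in> A \<or> 2 * p + 1 \<in> A)"
proof (induction m)
  case 0
  show ?case by (intro exI[of _ "{}"]) simp
next
  case (Suc m)
  from Suc.IH[OF Suc_leD[OF Suc.prems]]
  obtain A where A0: "\<forall>u v. u \<in> A \<longrightarrow> (u, v) \<in> R \<longrightarrow> v \<in> A"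
    "\<forall>u \<in> A. neg u \<notin> A" "\<forall>p < m. 2 * p \<in> A \<or> 2 * p + 1 \<in> A"
    by (elim exE conjE)
  note A = A0(1)[rule_format] A0(2)[rule_format] A0(3)[rule_format]
  show ?case
  proof (cases "2 * m \<in> A \<or> 2 * m + 1 \<in> A")
    case True
    then have "\<forall>p < Suc m. 2 * p \<in> A \<or> 2 * p + 1 \<in> A"
      using A(3) by (metis less_SucE)
    then show ?thesis by (intro exI[of _ A] conjI A0)
  next
    case False
    \<comment> \<open>If one literal of the variable implies its negation, the other is taken; by
      \<open>nc\<close> that one does not imply its own negation.\<close>
    define l where "l = (if (2 * m, 2 * m + 1) \<in> R then 2 * m + 1 else 2 * m)"
    have neg_m: "neg (2 * m) = 2 * m + 1" "neg (2 * m + 1) = 2 * m" by (auto simp: neg_def)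
    have l: "(l, neg l) \<notin> R" using nc[of m] Suc.prems neg_m by (auto simp: l_def)
    have lA: "neg l \<notin> A" using False neg_m by (auto simp: l_def)
    define B where "B = insert l (R `` {l})"
    have R': "(u, v) \<in> R \<Longrightarrow> (v, w) \<in> R \<Longrightarrow> (u, w) \<in> R" for u v w by (rule transD[OF R])
    have 1: "v \<in> A \<union> B" if "u \<in> A \<union> B" "(u, v) \<in> R" for u v
    proof (cases "u \<in> A")
      case True
      then show ?thesis using A(1) that(2) by (intro UnI1)
    next
      case False
      then have "u = l \<or> (l, u) \<in> R" using that(1) by (simp add: B_def)
      then have "(l, v) \<in> R" using that(2) R'[of l u v] by metis
      then show ?thesis by (simp add: B_def)
    qed
    \<comment> \<open>If \<open>l\<close> led to both \<open>u\<close> and \<open>neg u\<close>,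
      contraposition of the latter would give a path from \<open>u\<close> to \<open>neg l\<close>,
      hence one from \<open>l\<close> to \<open>neg l\<close>.\<close>
    have BB: "neg u \<notin> B" if "u \<in> B" for u
    proof
      assume "neg u \<in> B"
      then have "u = neg l \<or> (u, neg l) \<in> R" using skew[of l "neg u"] by (auto simp: B_def)
      moreover have "u = l \<or> (l, u) \<in> R" using that by (auto simp: B_def)
      ultimately show False using l R'[of l u "neg l"] neg_neq[of l] by metis
    qed
    \<comment> \<open>By contraposition \<open>u\<close> would lead to \<open>neg l\<close>, which
      closure would put into \<open>A\<close>, although the variable is undecided there.\<close>
    have AB: "neg u \<notin> B" if "u \<in> A" for u
    proof
      assume "neg u \<in> B"
      then have "u = neg l \<or> (u, neg l) \<in> R" using skew[of l "neg u"] by (auto simp: B_def)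
      then show False using A(1) lA that by blast
    qed
    have BA: "neg u \<notin> A" if "u \<in> B" for u using AB[of "neg u"] that by auto
    have "2 * m \<in> B \<or> 2 * m + 1 \<in> B" by (auto simp: B_def l_def)
    then have 3: "\<forall>p < Suc m. 2 * p \<in> A \<union> B \<or> 2 * p + 1 \<in> A \<union> B"
      using A(3) by (metis UnCI less_SucE)
    have 2: "\<forall>u \<in> A \<union> B. neg u \<notin> A \<union> B"
      using A(2) BB AB BA by (metis Un_iff)
    show ?thesis by (rule exI[of _ "A \<union> B"], intro conjI 2 3) (use 1 in blast)
  qed
qed

text \<open>Truth propagates along paths, so a variable on a common cycle with its negation rules
  out a model. Otherwise the extension lemma, applied to all \<open>n\<close> variables, yields a
  closed consistent set that decides each of them; it is read as an assignment.\<close>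

lemma two_sat:
  assumes "\<Phi> \<subseteq> literals n \<times> literals n"
  shows "(\<exists>w. models w \<Phi>) \<longleftrightarrow>
    \<not> (\<exists>p < n. (2 * p, 2 * p + 1) \<in> (arcs \<Phi>)\<^sup>+ \<and> (2 * p + 1, 2 * p) \<in> (arcs \<Phi>)\<^sup>+)"
    (is "_ \<longleftrightarrow> \<not> ?bad")
proof
  assume "\<exists>w. models w \<Phi>"
  then obtain w where w: "models w \<Phi>" by blast
  show "\<not> ?bad"
  proof
    assume ?bad
    then obtain p where p: "(2 * p, 2 * p + 1) \<in> (arcs \<Phi>)\<^sup>+"
      "(2 * p + 1, 2 * p) \<in> (arcs \<Phi>)\<^sup>+" by blast
    show False using models_trancl[OF w p(1)] models_trancl[OF w p(2)]
      by (auto simp: lit_true_def)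
  qed
next
  assume "\<not> ?bad"
  then have nc: "\<not> ((2 * p, 2 * p + 1) \<in> (arcs \<Phi>)\<^sup>+ \<and> (2 * p + 1, 2 * p) \<in> (arcs \<Phi>)\<^sup>+)"
    if "p < n" for p using that by blast
  have "\<exists>A. (\<forall>u v. u \<in> A \<longrightarrow> (u, v) \<in> (arcs \<Phi>)\<^sup>+ \<longrightarrow> v \<in> A) \<and>
      (\<forall>u \<in> A. neg u \<notin> A) \<and> (\<forall>p < n. 2 * p \<in> A \<or> 2 * p + 1 \<in> A)"
    by (rule two_sat_extension[OF nc trans_trancl skew_trancl order_refl]; assumption)
  then obtain A where A0: "\<forall>u v. u \<in> A \<longrightarrow> (u, v) \<in> (arcs \<Phi>)\<^sup>+ \<longrightarrow> v \<in> A"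
    "\<forall>u \<in> A. neg u \<notin> A" "\<forall>p < n. 2 * p \<in> A \<or> 2 * p + 1 \<in> A"
    by (elim exE conjE)
  note A = A0(1)[rule_format] A0(2)[rule_format] A0(3)[rule_format]
  define w where "w = (\<lambda>p. 2 * p \<in> A)"
  have w: "lit_true w u \<longleftrightarrow> u \<in> A" if "u < 2 * n" for u
  proof (cases "even u")
    case True
    then show ?thesis by (auto simp: w_def lit_true_def)
  next
    case False
    then obtain p where p: "u = 2 * p + 1" by (auto elim: oddE)
    then have "p < n" using that by simp
    then show ?thesis using A(2)[of u] A(3)[of p] by (auto simp: p w_def lit_true_def neg_def)
  qed
  have "lit_true w v" if "(u, v) \<in> arcs \<Phi>" "lit_true w u" for u v
  proof -
    have "u < 2 * n" "v < 2 * n" using that(1) assms neg_less by (auto simp: arcs_def)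
    then show ?thesis using w A(1)[of u v] that by blast
  qed
  then show "\<exists>w. models w \<Phi>" by (auto simp: models_arcs)
qed

section \<open>Transitive closure by the algorithm of Warshall\<close>

fun warshall :: "(nat \<times> nat) set \<Rightarrow> nat \<Rightarrow> (nat \<times> nat) set" where
  "warshall E 0 = E"
| "warshall E (Suc k) = warshall E k \<union> {(u, v). (u, k) \<in> warshall E k \<and> (k, v) \<in> warshall E k}"

text \<open>Later rounds preserve the possibility of composing at vertices already treated. After
  all rounds this covers every vertex, which is transitivity.\<close>

lemma warshall_via: "(u, i) \<in> warshall E k \<Longrightarrow> (i, v) \<in> warshall E k \<Longrightarrow> i < k \<Longrightarrow> (u, v) \<in> warshall E k"
proof (induction k arbitrary: u v i)
  case (Suc k)
  show ?case
  proof (cases "i = k")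
    case True
    then show ?thesis using Suc.prems by auto
  next
    case False
    then have "i < k" using Suc.prems by simp
    then show ?thesis using Suc.prems(1,2) Suc.IH[of _ i] by simp blast
  qed
qed simp

lemma warshall_mono: "E \<subseteq> warshall E k"
  by (induction k) auto

lemma warshall_bounded: "E \<subseteq> {..<m} \<times> {..<m} \<Longrightarrow> warshall E k \<subseteq> {..<m} \<times> {..<m}"
  by (induction k) auto

lemma trancl_warshall:
  assumes "E \<subseteq> {..<m} \<times> {..<m}"
  shows "E\<^sup>+ \<subseteq> warshall E m"
proof -
  have "trans (warshall E m)"
  proof (rule transI)
    fix u i v assume "(u, i) \<in> warshall E m" "(i, v) \<in> warshall E m"
    moreover from this have "i < m" using warshall_bounded[OF assms, of m] by blast
    ultimately show "(u, v) \<in> warshall E m" by (rule warshall_via)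
  qed
  then show ?thesis using warshall_mono[of E m] by (metis trancl_id trancl_mono_subset)
qed

section \<open>Generators: uniform descriptions of 2-CNF formulae\<close>

type_synonym lit = "bool \<times> aexp"

text \<open>\<open>GEmit\<close> contributes one clause, guarded by a condition that can be
  evaluated; \<open>GAny\<close> repeats it for all values of a new level. A term denotes a set of
  clauses (\<open>gval\<close>) and compiles to nested loops that enter the arcs into the matrix
  (\<open>gcmd\<close>).\<close>

datatype gen = GNone | GEmit bexp lit lit | GAny aexp gen | GUn gen gen

fun lexp :: "lit \<Rightarrow> aexp" where
  "lexp (b, e) = Add (Mul (Cst 2) e) (Cst (if b then 0 else 1))"

fun lneg :: "lit \<Rightarrow> lit" where
  "lneg (b, e) = (\<not> b, e)"

fun gval :: "nat list \<Rightarrow> arrays \<Rightarrow> gen \<Rightarrow> (nat \<times> nat) set" where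
  "gval \<rho> S GNone = {}"
| "gval \<rho> S (GEmit b l l') = (if bval \<rho> S b then {(aval \<rho> (lexp l), aval \<rho> (lexp l'))} else {})"
| "gval \<rho> S (GAny e g) = (\<Union>i < aval \<rho> e. gval (\<rho> @ [i]) S g)"
| "gval \<rho> S (GUn g g') = gval \<rho> S g \<union> gval \<rho> S g'"

fun breads :: "bexp \<Rightarrow> nat set" where
  "breads (BLess a b) = {}"
| "breads (BRead A e) = {A}"
| "breads (BNot b) = breads b"
| "breads (BAnd b c) = breads b \<union> breads c"
| "breads (BEx e b) = breads b"

fun greads :: "gen \<Rightarrow> nat set" where
  "greads GNone = {}"
| "greads (GEmit b l l') = breads b"
| "greads (GAny e g) = greads g"
| "greads (GUn g g') = greads g \<union> greads g'"

definition BOr :: "bexp \<Rightarrow> bexp \<Rightarrow> bexp" where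
  "BOr b c = BNot (BAnd (BNot b) (BNot c))"

lemma bval_BOr [simp]: "bval \<rho> S (BOr b c) \<longleftrightarrow> bval \<rho> S b \<or> bval \<rho> S c"
  by (simp add: BOr_def)

lemma breads_BOr [simp]: "breads (BOr b c) = breads b \<union> breads c"
  by (simp add: BOr_def)

lemma bval_cong: "(\<And>A. A \<in> breads b \<Longrightarrow> S A = S' A) \<Longrightarrow> bval \<rho> S b = bval \<rho> S' b"
  by (induction b arbitrary: \<rho>) auto

lemma gval_cong: "(\<And>A. A \<in> greads g \<Longrightarrow> S A = S' A) \<Longrightarrow> gval \<rho> S g = gval \<rho> S' g"
proof (induction g arbitrary: \<rho>)
  case (GEmit b l l')
  then have "bval \<rho> S b = bval \<rho> S' b" by (intro bval_cong) simp
  then show ?case by simp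
qed auto

lemma gval_cong_matrix: "2 \<notin> greads g \<Longrightarrow> (\<forall>A. A \<noteq> 2 \<longrightarrow> S' A = S A) \<Longrightarrow> gval \<rho> S' g = gval \<rho> S g"
  by (rule gval_cong) metis

lemma aval_lneg [simp]: "aval \<rho> (lexp (lneg l)) = neg (aval \<rho> (lexp l))"
  by (cases l) (simp add: neg_def)

definition entry :: "aexp \<Rightarrow> aexp \<Rightarrow> aexp \<Rightarrow> aexp" where
  "entry NE a b = Add (Mul a (Mul (Cst 2) NE)) b"

text \<open>The disjunction with the old entry keeps arcs that are already present, as an assignment
  overwrites its cell in any case.\<close>

definition add_entry :: "aexp \<Rightarrow> bexp \<Rightarrow> aexp \<Rightarrow> aexp \<Rightarrow> cmd" where
  "add_entry NE b a a' = Assign 2 (entry NE a a') (BOr (BRead 2 (entry NE a a')) b)"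

fun gcmd :: "aexp \<Rightarrow> gen \<Rightarrow> cmd" where
  "gcmd NE GNone = Nop"
| "gcmd NE (GEmit b l l') =
     Then (add_entry NE b (lexp (lneg l)) (lexp l')) (add_entry NE b (lexp (lneg l')) (lexp l))"
| "gcmd NE (GAny e g) = For e (gcmd NE g)"
| "gcmd NE (GUn g g') = Then (gcmd NE g) (gcmd NE g')"

definition closure_cmd :: "aexp \<Rightarrow> nat \<Rightarrow> cmd" where
  "closure_cmd NE d = For (Mul (Cst 2) NE) (For (Mul (Cst 2) NE) (For (Mul (Cst 2) NE)
     (add_entry NE
        (BAnd (BRead 2 (entry NE (Lev (d + 1)) (Lev d))) (BRead 2 (entry NE (Lev d) (Lev (d + 2)))))
        (Lev (d + 1)) (Lev (d + 2)))))"

text \<open>The command is run for many values of the first-order variables. It therefore clears the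
  matrix first and adds its verdict disjunctively to cell 0 of array 3.\<close>

definition two_sat_cmd :: "aexp \<Rightarrow> nat \<Rightarrow> gen \<Rightarrow> cmd" where
  "two_sat_cmd NE d g =
     Then (For (Mul (Mul (Cst 2) NE) (Mul (Cst 2) NE)) (Assign 2 (Lev d) bfalse))
     (Then (gcmd NE g)
     (Then (closure_cmd NE d)
     (Assign 3 (Cst 0) (BOr (BRead 3 (Cst 0)) (BNot (BEx NE
        (BAnd (BRead 2 (entry NE (lexp (True, Lev d)) (lexp (False, Lev d))))
          (BRead 2 (entry NE (lexp (False, Lev d)) (lexp (True, Lev d)))))))))))"

definition matrix :: "nat \<Rightarrow> arrays \<Rightarrow> (nat \<times> nat) set" where
  "matrix m S = {(u, v). u < m \<and> v < m \<and> S 2 (u * m + v)}"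

text \<open>Loops only append to the environment; a stable size expression keeps its value inside
  them.\<close>

definition stable :: "nat list \<Rightarrow> aexp \<Rightarrow> nat \<Rightarrow> bool" where
  "stable \<rho> e n \<longleftrightarrow> (\<forall>\<rho>'. aval (\<rho> @ \<rho>') e = n)"

lemma stable_snoc: "stable \<rho> e n \<Longrightarrow> stable (\<rho> @ [i]) e n"
  by (simp add: stable_def)

lemma stable_aval: "stable \<rho> e n \<Longrightarrow> aval \<rho> e = n"
  unfolding stable_def by (metis append_Nil2)

lemma exec_For_invariant:
  assumes "P 0 S" "\<And>i S. i < aval \<rho> e \<Longrightarrow> P i S \<Longrightarrow> P (Suc i) (exec (\<rho> @ [i]) c S)"
  shows "P (aval \<rho> e) (exec \<rho> (For e c) S)"
proof -
  have "P k (fold (\<lambda>i. exec (\<rho> @ [i]) c) [0..<k] S)" if "k \<le> aval \<rho> e" for k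
    using that by (induction k) (use assms in auto)
  then show ?thesis by simp
qed

lemma exec_add_entry:
  fixes S :: arrays and b :: bexp
  assumes "stable \<rho> NE n" "aval \<rho> a < 2 * n" "aval \<rho> a' < 2 * n"
  defines "S' \<equiv> exec \<rho> (add_entry NE b a a') S"
  shows "matrix (2 * n) S' = matrix (2 * n) S \<union> (if bval \<rho> S b then {(aval \<rho> a, aval \<rho> a')} else {})" (is ?goal1)
    and "\<And>A. A \<noteq> 2 \<Longrightarrow> S' A = S A"
proof -
  \<comment> \<open>Distinct arcs occupy distinct cells, by uniqueness of quotient and
    remainder.\<close>
  have inj: "u * m + v = u' * m + v' \<longleftrightarrow> u = u' \<and> v = v'" if "v < m" "v' < m" for u v u' v' m :: nat
  proof -
    have "(u * m + v) div m = u" "(u' * m + v') div m = u'"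
      "(u * m + v) mod m = v" "(u' * m + v') mod m = v'" using that by auto
    then show ?thesis by metis
  qed
  show ?goal1
    using assms(2,3) inj[of _ "2 * n" "aval \<rho> a'" _ "aval \<rho> a"]
    by (auto simp: S'_def add_entry_def entry_def matrix_def stable_aval[OF assms(1)])
  show "\<And>A. A \<noteq> 2 \<Longrightarrow> S' A = S A" by (simp add: S'_def add_entry_def)
qed

text \<open>The guards are evaluated while the matrix is being filled; as they do not read array 2,
  the described set of clauses does not change underway.\<close>

lemma exec_gcmd:
  assumes "stable \<rho> NE n" "2 \<notin> greads g" "gval \<rho> S g \<subseteq> literals n \<times> literals n"
  shows "matrix (2 * n) (exec \<rho> (gcmd NE g) S) = matrix (2 * n) S \<union> arcs (gval \<rho> S g) \<and>
    (\<forall>A. A \<noteq> 2 \<longrightarrow> exec \<rho> (gcmd NE g) S A = S A)"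
  using assms
proof (induction g arbitrary: \<rho> S)
  case GNone
  then show ?case by (simp add: arcs_def)
next
  case (GEmit b l l')
  let ?S = "exec \<rho> (add_entry NE b (lexp (lneg l)) (lexp l')) S"
  show ?case
  proof (cases "bval \<rho> S b")
    case True
    then have lt: "aval \<rho> (lexp l) < 2 * n" "aval \<rho> (lexp l') < 2 * n" using GEmit.prems(3) by auto
    then have lt': "aval \<rho> (lexp (lneg l)) < 2 * n" "aval \<rho> (lexp (lneg l')) < 2 * n"
      by (simp_all add: neg_less)
    note 1 = exec_add_entry[OF GEmit.prems(1) lt'(1) lt(2), where b = b and S = S]
    note 2 = exec_add_entry[OF GEmit.prems(1) lt'(2) lt(1), where b = b and S = ?S]
    have "A \<noteq> 2" if "A \<in> breads b" for A using GEmit.prems(2) that by auto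
    then have "bval \<rho> ?S b = bval \<rho> S b" using 1(2) by (intro bval_cong) auto
    then show ?thesis using True 1 2 by (auto simp: arcs_def)
  next
    case False
    let ?a = "aval \<rho> (entry NE (lexp (lneg l)) (lexp l'))"
    have "?S = S" using False by (auto simp: add_entry_def fun_eq_iff)
    moreover have "exec \<rho> (add_entry NE b (lexp (lneg l')) (lexp l)) S = S"
      using False by (auto simp: add_entry_def fun_eq_iff)
    ultimately show ?thesis using False by (simp add: arcs_def)
  qed
next
  case (GAny e g)
  let ?P = "\<lambda>i S'. matrix (2 * n) S' =
      matrix (2 * n) S \<union> arcs (\<Union>j < i. gval (\<rho> @ [j]) S g) \<and> (\<forall>A. A \<noteq> 2 \<longrightarrow> S' A = S A)"
  have imp: "arcs (A \<union> B) = arcs A \<union> arcs B" for A B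
    by (auto simp: arcs_def)
  have "?P (aval \<rho> e) (exec \<rho> (For e (gcmd NE g)) S)"
  proof (rule exec_For_invariant[where P = ?P])
    fix i S' assume i: "i < aval \<rho> e" and P: "?P i S'"
    have eq: "gval (\<rho> @ [i]) S' g = gval (\<rho> @ [i]) S g"
      using P GAny.prems(2) by (intro gval_cong_matrix) auto
    have "gval (\<rho> @ [i]) S' g \<subseteq> literals n \<times> literals n" unfolding eq using GAny.prems(3) i by fastforce
    from GAny.IH[OF stable_snoc[OF GAny.prems(1)] _ this] GAny.prems(2) P
    show "?P (Suc i) (exec (\<rho> @ [i]) (gcmd NE g) S')"
      by (auto simp: eq lessThan_Suc imp)
  qed (auto simp: arcs_def)
  then show ?case by simp
next
  case (GUn g g')
  let ?S = "exec \<rho> (gcmd NE g) S"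
  have 1: "matrix (2 * n) ?S = matrix (2 * n) S \<union> arcs (gval \<rho> S g) \<and>
      (\<forall>A. A \<noteq> 2 \<longrightarrow> ?S A = S A)"
    using GUn.prems by (intro GUn.IH(1)) auto
  have eq: "gval \<rho> ?S g' = gval \<rho> S g'" using 1 GUn.prems(2) by (intro gval_cong_matrix) auto
  have "matrix (2 * n) (exec \<rho> (gcmd NE g') ?S) = matrix (2 * n) ?S \<union> arcs (gval \<rho> ?S g') \<and>
      (\<forall>A. A \<noteq> 2 \<longrightarrow> exec \<rho> (gcmd NE g') ?S A = ?S A)"
    using GUn.prems eq by (intro GUn.IH(2)) auto
  then show ?case using 1 eq by (auto simp: arcs_def)
qed

text \<open>The matrix is updated in place, so a round may read entries that it has itself added and
  run ahead of \<open>warshall\<close>. It is thus only kept between the entries due so far and the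
  transitive closure; after the last round these bounds coincide.\<close>

lemma exec_closure_cmd:
  assumes NE: "stable \<rho> NE n"
  shows "matrix (2 * n) (exec \<rho> (closure_cmd NE (length \<rho>)) S) = (matrix (2 * n) S)\<^sup>+ \<and>
    (\<forall>A. A \<noteq> 2 \<longrightarrow> exec \<rho> (closure_cmd NE (length \<rho>)) S A = S A)"
proof -
  let ?d = "length \<rho>" and ?m = "2 * n" and ?E = "matrix (2 * n) S"
  let ?ne = "Mul (Cst 2) NE"
  define inner where "inner = add_entry NE
        (BAnd (BRead 2 (entry NE (Lev (?d + 1)) (Lev ?d))) (BRead 2 (entry NE (Lev ?d) (Lev (?d + 2)))))
        (Lev (?d + 1)) (Lev (?d + 2))"
  define P where "P = (\<lambda>X S'. X \<subseteq> matrix ?m S' \<and> matrix ?m S' \<subseteq> ?E\<^sup>+ \<and> (\<forall>A. A \<noteq> 2 \<longrightarrow> S' A = S A))"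
  define W where "W = warshall ?E"
  \<comment> \<open>Due entries of round \<open>k\<close>: those in the rows before
    \<open>i\<close>, and those of row \<open>i\<close> in the columns before
    \<open>j\<close>.\<close>
  let ?below = "\<lambda>k i. {(u, v) \<in> W (Suc k). u < i}"
  let ?row = "\<lambda>k i j. {(u, v) \<in> W (Suc k). u = i \<and> v < j}"
  have ne: "aval \<rho>' ?ne = ?m" if "stable \<rho>' NE n" for \<rho>' using stable_aval[OF that] by simp
  have E: "?E \<subseteq> {..<?m} \<times> {..<?m}" by (auto simp: matrix_def)
  have W_bounded: "W k \<subseteq> {..<?m} \<times> {..<?m}" for k unfolding W_def by (rule warshall_bounded[OF E])
  have inner: "P (W k \<union> ?below k i \<union> ?row k i (Suc j))
      (exec (((\<rho> @ [k]) @ [i]) @ [j]) inner S')"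
    if "k < ?m" "i < ?m" "j < ?m"
      and P: "P (W k \<union> ?below k i \<union> ?row k i j) S'"
    for i j k S'
  proof -
    let ?\<rho> = "((\<rho> @ [k]) @ [i]) @ [j]"
    have st: "stable ?\<rho> NE n" using NE by (intro stable_snoc)
    have lk: "look ?\<rho> ?d = k" "look ?\<rho> (?d + 1) = i" "look ?\<rho> (?d + 2) = j"
      by (simp_all add: look_def nth_append)
    let ?b = "BAnd (BRead 2 (entry NE (Lev (?d + 1)) (Lev ?d))) (BRead 2 (entry NE (Lev ?d) (Lev (?d + 2))))"
    have b: "bval ?\<rho> S' ?b \<longleftrightarrow> (i, k) \<in> matrix ?m S' \<and> (k, j) \<in> matrix ?m S'"
      using that stable_aval[OF st] lk by (simp add: entry_def matrix_def)
    note ex = exec_add_entry[OF st, where a = "Lev (?d + 1)" and a' = "Lev (?d + 2)" and b = ?b and S = S', folded inner_def,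
        unfolded b aval.simps lk, OF that(2,3)]
    let ?M = "matrix ?m S'" and ?M' = "matrix ?m (exec ?\<rho> inner S')"
    let ?X = "W k \<union> ?below k i \<union> ?row k i j"
    let ?Y = "W k \<union> ?below k i \<union> ?row k i (Suc j)"
    note P' = conjunct1[OF P[unfolded P_def]] conjunct1[OF conjunct2[OF P[unfolded P_def]]]
      conjunct2[OF conjunct2[OF P[unfolded P_def]], rule_format]
    have new: "(i, j) \<in> ?M'" if "(i, j) \<in> W (Suc k)"
      using that P'(1) unfolding ex(1) W_def by auto
    have Y: "p \<in> ?X \<or> p = (i, j) \<and> (i, j) \<in> W (Suc k)" if "p \<in> ?Y" for p
      using that by (cases p) (auto simp del: warshall.simps simp: less_Suc_eq)
    have "?Y \<subseteq> ?M'"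
    proof
      fix p assume "p \<in> ?Y"
      from Y[OF this] show "p \<in> ?M'"
      proof
        assume "p \<in> ?X"
        then have "p \<in> ?M" using P'(1) by (rule rev_subsetD)
        then show ?thesis unfolding ex(1) by (rule UnI1)
      next
        assume "p = (i, j) \<and> (i, j) \<in> W (Suc k)"
        then show ?thesis using new by blast
      qed
    qed
    moreover have "?M' \<subseteq> ?E\<^sup>+"
    proof -
      have "(i, j) \<in> ?E\<^sup>+" if "(i, k) \<in> ?M" "(k, j) \<in> ?M"
        by (rule trancl_trans[OF subsetD[OF P'(2) that(1)] subsetD[OF P'(2) that(2)]])
      then show ?thesis using P'(2) unfolding ex(1) by auto
    qed
    moreover have "exec ?\<rho> inner S' A = S A" if "A \<noteq> 2" for A
      using ex(2)[OF that] P'(3)[OF that] by (rule trans)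
    ultimately show ?thesis unfolding P_def by simp
  qed
  have 1: "P (W k \<union> ?below k (Suc i)) (exec ((\<rho> @ [k]) @ [i]) (For ?ne inner) S')"
    if "k < ?m" "i < ?m" and P: "P (W k \<union> ?below k i) S'" for i k S'
  proof -
    let ?\<rho> = "(\<rho> @ [k]) @ [i]"
    let ?Q = "\<lambda>j. P (W k \<union> ?below k i \<union> ?row k i j)"
    have st: "stable ?\<rho> NE n" using NE by (intro stable_snoc)
    have "?Q (aval ?\<rho> ?ne) (exec ?\<rho> (For ?ne inner) S')"
    proof (rule exec_For_invariant[where P = ?Q])
      show "?Q 0 S'" using P by simp
      show "?Q (Suc j) (exec (?\<rho> @ [j]) inner S'')" if "j < aval ?\<rho> ?ne" "?Q j S''" for j S''
        using that(1)[unfolded ne[OF st]] that(2) by (rule inner[OF \<open>k < ?m\<close> \<open>i < ?m\<close>])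
    qed
    moreover have "W k \<union> ?below k i \<union> ?row k i ?m
        = W k \<union> ?below k (Suc i)"
      using W_bounded[of "Suc k"] by auto
    ultimately show ?thesis unfolding ne[OF st] by simp
  qed
  have 2: "P (W (Suc k)) (exec (\<rho> @ [k]) (For ?ne (For ?ne inner)) S')"
    if "k < ?m" and P: "P (W k) S'" for k S'
  proof -
    let ?\<rho> = "\<rho> @ [k]"
    let ?Q = "\<lambda>i. P (W k \<union> ?below k i)"
    have st: "stable ?\<rho> NE n" using NE by (intro stable_snoc)
    have "?Q (aval ?\<rho> ?ne) (exec ?\<rho> (For ?ne (For ?ne inner)) S')"
    proof (rule exec_For_invariant[where P = ?Q])
      show "?Q 0 S'" using P by simp
      show "?Q (Suc i) (exec (?\<rho> @ [i]) (For ?ne inner) S'')" if "i < aval ?\<rho> ?ne" "?Q i S''" for i S''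
        using that(1)[unfolded ne[OF st]] that(2) by (rule 1[OF \<open>k < ?m\<close>])
    qed
    moreover have "W k \<union> ?below k ?m = W (Suc k)"
      using W_bounded[of "Suc k"] by (auto simp: W_def)
    ultimately show ?thesis unfolding ne[OF st] by simp
  qed
  have "P (W (aval \<rho> ?ne)) (exec \<rho> (For ?ne (For ?ne (For ?ne inner))) S)"
  proof (rule exec_For_invariant[where P = "\<lambda>k. P (W k)"])
    show "P (W 0) S" by (auto simp: P_def W_def)
    show "P (W (Suc k)) (exec (\<rho> @ [k]) (For ?ne (For ?ne inner)) S')"
      if "k < aval \<rho> ?ne" "P (W k) S'" for k S'
      using that(1)[unfolded ne[OF NE]] that(2) by (rule 2)
  qed
  then show ?thesis
    unfolding closure_cmd_def inner_def[symmetric] ne[OF NE] P_def W_def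
    using trancl_warshall[OF E] by blast
qed

lemma exec_two_sat_cmd:
  assumes NE: "stable \<rho> NE n" and g: "greads g \<subseteq> {0, 1}" "gval \<rho> S g \<subseteq> literals n \<times> literals n"
  defines "S' \<equiv> exec \<rho> (two_sat_cmd NE (length \<rho>) g) S"
  shows "S' 3 0 \<longleftrightarrow> S 3 0 \<or> (\<exists>w. models w (gval \<rho> S g))" (is ?goal1)
    and "\<And>A. A \<notin> {2, 3} \<Longrightarrow> S' A = S A"
proof -
  let ?d = "length \<rho>"
  let ?c = "Assign 2 (Lev ?d) bfalse" and ?e = "Mul (Mul (Cst 2) NE) (Mul (Cst 2) NE)"
  define S1 where "S1 = exec \<rho> (For ?e ?c) S"
  define S2 where "S2 = exec \<rho> (gcmd NE g) S1"
  define S3 where "S3 = exec \<rho> (closure_cmd NE ?d) S2"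
  have e: "aval \<rho> ?e = (2 * n) * (2 * n)" using stable_aval[OF NE] by simp
  let ?P = "\<lambda>i S'. (\<forall>j < i. \<not> S' 2 j) \<and> (\<forall>A. A \<noteq> 2 \<longrightarrow> S' A = S A)"
  have "?P (aval \<rho> ?e) S1" unfolding S1_def
    by (rule exec_For_invariant[where P = ?P]) (auto simp: look_def less_Suc_eq)
  moreover have "u * (2 * n) + v < (2 * n) * (2 * n)" if "u < 2 * n" "v < 2 * n" for u v
  proof -
    have "u * (2 * n) + v < Suc u * (2 * n)" using that by simp
    also have "\<dots> \<le> (2 * n) * (2 * n)" using that by (intro mult_right_mono) auto
    finally show ?thesis .
  qed
  ultimately have S1: "matrix (2 * n) S1 = {}" "\<And>A. A \<noteq> 2 \<Longrightarrow> S1 A = S A"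
    unfolding e by (auto simp: matrix_def)
  have g2: "2 \<notin> greads g" using g(1) by auto
  then have eq: "gval \<rho> S1 g = gval \<rho> S g" using S1(2) by (intro gval_cong_matrix) auto
  have S2: "matrix (2 * n) S2 = arcs (gval \<rho> S g)" "\<And>A. A \<noteq> 2 \<Longrightarrow> S2 A = S A"
    using exec_gcmd[OF NE g2, of S1] g(2) S1 eq unfolding S2_def by auto
  have S3: "matrix (2 * n) S3 = (arcs (gval \<rho> S g))\<^sup>+" "\<And>A. A \<noteq> 2 \<Longrightarrow> S3 A = S A"
    using exec_closure_cmd[OF NE, of S2] S2 unfolding S3_def by auto
  have S': "S' = exec \<rho> (Assign 3 (Cst 0) (BOr (BRead 3 (Cst 0)) (BNot (BEx NE
        (BAnd (BRead 2 (entry NE (lexp (True, Lev ?d)) (lexp (False, Lev ?d))))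
          (BRead 2 (entry NE (lexp (False, Lev ?d)) (lexp (True, Lev ?d))))))))) S3"
    by (simp add: S'_def two_sat_cmd_def S1_def S2_def S3_def)
  have st: "aval (\<rho> @ [p]) NE = n" for p using NE by (simp add: stable_def)
  have "S' 3 0 \<longleftrightarrow> S3 3 0 \<or> \<not> (\<exists>p < n. (2 * p, 2 * p + 1) \<in> matrix (2 * n) S3 \<and>
      (2 * p + 1, 2 * p) \<in> matrix (2 * n) S3)"
    by (auto simp: S' entry_def matrix_def st stable_aval[OF NE] look_def)
  then show ?goal1
    unfolding two_sat[OF g(2)] S3(1) S3(2)[of 3, simplified] .
  show "\<And>A. A \<notin> {2, 3} \<Longrightarrow> S' A = S A" using S3(2) by (simp add: S')
qed

section \<open>Formulae as sets of witnesses\<close>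

text \<open>The number with digits \<open>is\<close> in base \<open>n\<close>, most significant
  first. Restricted to digits below \<open>n\<close> and a fixed length it is the lexicographic
  rank, which is the order of \<open>product_lists\<close> in the encoding.\<close>

definition horner :: "nat \<Rightarrow> nat list \<Rightarrow> nat" where
  "horner n is = foldl (\<lambda>a i. a * n + i) 0 is"

definition indices :: "nat \<Rightarrow> nat \<Rightarrow> nat list set" where
  "indices n k = {is. length is = k \<and> set is \<subseteq> {..<n}}"

lemma horner_Nil [simp]: "horner n [] = 0"
  by (simp add: horner_def)

lemma horner_snoc [simp]: "horner n (is @ [i]) = horner n is * n + i"
  by (simp add: horner_def)

lemma horner_Cons: "horner n (i # is) = i * n ^ length is + horner n is"
  by (induction "is" rule: rev_induct) (simp_all add: horner_def algebra_simps)

lemma indices_Suc: "indices n (Suc k) = (\<lambda>(is, i). is @ [i]) ` (indices n k \<times> {..<n})"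
proof (intro equalityI subsetI)
  fix js assume js: "js \<in> indices n (Suc k)"
  then have "js \<noteq> []" by (auto simp: indices_def)
  then obtain i "is" where "js = is @ [i]" by (metis rev_exhaust)
  then show "js \<in> (\<lambda>(is, i). is @ [i]) ` (indices n k \<times> {..<n})"
    using js by (auto simp: indices_def)
qed (auto simp: indices_def)

lemma horner_bij: "bij_betw (horner n) (indices n k) {..<n ^ k}"
proof (induction k)
  case 0
  have "indices n 0 = {[]}" by (auto simp: indices_def)
  then show ?case by (simp add: bij_betw_def lessThan_Suc)
next
  case (Suc k)
  have inj: "inj_on (horner n) (indices n (Suc k))"
  proof (rule inj_onI)
    fix js js' assume "js \<in> indices n (Suc k)" "js' \<in> indices n (Suc k)"
    then obtain i "is" i' is' where js: "js = is @ [i]" "is \<in> indices n k" "i < n"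
      and js': "js' = is' @ [i']" "is' \<in> indices n k" "i' < n"
      unfolding indices_Suc by auto
    assume "horner n js = horner n js'"
    then have eq: "horner n is * n + i = horner n is' * n + i'" by (simp add: js js')
    have "i = i'" using arg_cong[OF eq, of "\<lambda>q. q mod n"] js js' by simp
    moreover have "horner n is = horner n is'"
      using arg_cong[OF eq, of "\<lambda>q. q div n"] js js' by simp
    ultimately show "js = js'" using Suc.IH js js' by (auto simp: bij_betw_def dest: inj_onD)
  qed
  have "horner n ` indices n (Suc k) = {..<n ^ Suc k}"
  proof (intro equalityI subsetI)
    fix q assume "q \<in> horner n ` indices n (Suc k)"
    then obtain i "is" where q: "q = horner n is * n + i" "is \<in> indices n k" "i < n"
      unfolding indices_Suc by auto
    then have "horner n is < n ^ k" using Suc.IH by (auto simp: bij_betw_def)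
    then have "Suc (horner n is) * n \<le> n ^ k * n" by (intro mult_right_mono) auto
    then show "q \<in> {..<n ^ Suc k}" using q by (simp add: algebra_simps)
  next
    fix q assume q: "q \<in> {..<n ^ Suc k}"
    then have n: "0 < n" by (cases n) auto
    have "q div n < n ^ k" using q by (simp add: less_mult_imp_div_less mult.commute)
    then have "q div n \<in> horner n ` indices n k" using bij_betw_imp_surj_on[OF Suc.IH] by simp
    then obtain "is" where "is \<in> indices n k" "horner n is = q div n" by force
    then show "q \<in> horner n ` indices n (Suc k)"
      using n unfolding indices_Suc
      by (intro image_eqI[of _ _ "is @ [q mod n]"] image_eqI[of _ _ "(is, q mod n)"]) auto
  qed
  then show ?case using inj by (simp add: bij_betw_def)
qed

lemma horner_less: "is \<in> indices n k \<Longrightarrow> horner n is < n ^ k"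
  using horner_bij by (auto simp: bij_betw_def)

lemma horner_inj: "is \<in> indices n k \<Longrightarrow> is' \<in> indices n k \<Longrightarrow> horner n is = horner n is' \<Longrightarrow> is = is'"
  using horner_bij[of n k] unfolding bij_betw_def by (meson inj_onD)

lemma horner_surj: "q < n ^ k \<Longrightarrow> \<exists>is \<in> indices n k. horner n is = q"
  using bij_betw_imp_surj_on[OF horner_bij[of n k]] by (metis imageE lessThan_iff)

text \<open>For counting witnesses any listing of the universe will do; its order matters only for
  the encoding.\<close>

definition lists_universe :: "'a rel_structure \<Rightarrow> 'a list \<Rightarrow> bool" where
  "lists_universe \<A> as \<longleftrightarrow> set as = universe \<A> \<and> distinct as"

lemma Bex_universe:
  assumes "lists_universe \<A> as"
  shows "(\<exists>a \<in> universe \<A>. P a) \<longleftrightarrow> (\<exists>i < length as. P (as ! i))"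
proof -
  have "universe \<A> = set as" using assms by (simp add: lists_universe_def)
  then show ?thesis by (metis in_set_conv_nth)
qed

lemma Ball_universe:
  assumes "lists_universe \<A> as"
  shows "(\<forall>a \<in> universe \<A>. P a) \<longleftrightarrow> (\<forall>i < length as. P (as ! i))"
  using Bex_universe[OF assms, of "\<lambda>a. \<not> P a"] by blast

definition decode :: "'a list \<Rightarrow> nat \<Rightarrow> (nat \<Rightarrow> bool) \<Rightarrow> 'a list set" where
  "decode as k w = {map ((!) as) is | is. is \<in> indices (length as) k \<and> w (horner (length as) is)}"

lemma map_nth_inj:
  assumes "distinct as" "is \<in> indices (length as) k" "is' \<in> indices (length as) k'"
    "map ((!) as) is = map ((!) as) is'"
  shows "is = is'"
proof -
  have "inj_on ((!) as) (set is \<union> set is')"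
    by (rule inj_on_nth[OF assms(1)]) (use assms(2,3) in \<open>auto simp: indices_def\<close>)
  then show ?thesis by (rule map_inj_on[OF assms(4)])
qed

lemma decode_mem:
  assumes "distinct as" "is \<in> indices (length as) k"
  shows "map ((!) as) is \<in> decode as k w \<longleftrightarrow> w (horner (length as) is)"
  using assms map_nth_inj[OF assms(1)] by (auto simp: decode_def)

lemma tuples_indices:
  assumes "lists_universe \<A> as"
  shows "tuples (universe \<A>) k = map ((!) as) ` indices (length as) k"
proof (intro equalityI subsetI)
  fix t assume t: "t \<in> tuples (universe \<A>) k"
  then have "\<forall>x \<in> set t. \<exists>i < length as. as ! i = x"
    using assms by (auto simp: tuples_def lists_universe_def in_set_conv_nth)
  then obtain f where f: "\<forall>x \<in> set t. f x < length as \<and> as ! f x = x" by metis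
  then have "map ((!) as) (map f t) = t" by (simp add: map_idI)
  moreover have "map f t \<in> indices (length as) k" using f t by (auto simp: indices_def tuples_def)
  ultimately show "t \<in> map ((!) as) ` indices (length as) k" by (metis image_eqI)
next
  fix t assume "t \<in> map ((!) as) ` indices (length as) k"
  then obtain "is" where t: "t = map ((!) as) is" "is \<in> indices (length as) k" by blast
  have "as ! i \<in> universe \<A>" if "i \<in> set is" for i
    using that t(2) assms nth_mem[of i as] by (auto simp: indices_def lists_universe_def)
  then show "t \<in> tuples (universe \<A>) k" using t by (auto simp: tuples_def indices_def)
qed

text \<open>
  The bound variables of a summand: \<open>CFO\<close> and \<open>CSO\<close> stem from \<open>SumFO\<close> and \<open>SumSO\<close> and are
  recorded in the witness, \<open>EFO\<close> stems from the existential block and is not.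
\<close>

datatype quantifier = CFO fo_var | CSO so_var | EFO fo_var

type_synonym summand = "quantifier list \<times> fo_var list \<times> clause list"

text \<open>Sums distribute over \<open>Plus\<close>, which leaves a list of addition-free terms.
  The number \<open>s\<close> becomes \<open>s\<close> copies of the empty conjunction without bound
  variables, each with value 1.\<close>

fun summands :: "qso \<Rightarrow> summand list" where
  "summands (Form \<phi>) = (case \<phi> of ExAll xs ys Cs \<Rightarrow> [(map EFO xs, ys, Cs)])"
| "summands (Const s) = replicate s ([], [], [])"
| "summands (Plus \<alpha> \<beta>) = summands \<alpha> @ summands \<beta>"
| "summands (SumFO x \<alpha>) = map (\<lambda>(bs, r). (CFO x # bs, r)) (summands \<alpha>)"
| "summands (SumSO X \<alpha>) = map (\<lambda>(bs, r). (CSO X # bs, r)) (summands \<alpha>)"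

text \<open>
  A witness is a sequence of bits: a block of \<open>n\<close> bits with a single one for each \<open>CFO\<close>, a
  characteristic string of length \<open>n\<^sup>k\<close> for each \<open>CSO\<close> of arity \<open>k\<close>, and zeros from there on.
\<close>

fun witness :: "'a rel_structure \<Rightarrow> 'a list \<Rightarrow> fo_var list \<times> clause list \<Rightarrow> quantifier list \<Rightarrow>
    'a fo_assignment \<Rightarrow> 'a so_assignment \<Rightarrow> (nat \<Rightarrow> bool) \<Rightarrow> bool" where
  "witness \<A> as r [] v V w \<longleftrightarrow>
     all_block (universe \<A>) (fst r) (\<lambda>u. \<forall>C \<in> set (snd r). sat_clause \<A> u V C) v \<and> (\<forall>q. \<not> w q)"
| "witness \<A> as r (CFO x # bs) v V w \<longleftrightarrow>
     (\<exists>i < length as. (\<forall>q < length as. w q = (q = i)) \<and>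
        witness \<A> as r bs (v(x := as ! i)) V (\<lambda>q. w (length as + q)))"
| "witness \<A> as r (CSO X # bs) v V w \<longleftrightarrow>
     witness \<A> as r bs v (V(X := decode as (arity X) w)) (\<lambda>q. w (length as ^ arity X + q))"
| "witness \<A> as r (EFO x # bs) v V w \<longleftrightarrow>
     (\<exists>i < length as. witness \<A> as r bs (v(x := as ! i)) V w)"

definition witnesses :: "'a rel_structure \<Rightarrow> 'a list \<Rightarrow> 'a fo_assignment \<Rightarrow> 'a so_assignment \<Rightarrow>
    summand \<Rightarrow> (nat \<Rightarrow> bool) set" where
  "witnesses \<A> as v V s = {w. witness \<A> as (snd s) (fst s) v V w}"

section \<open>Counting witnesses block by block\<close>

definition glue :: "nat \<Rightarrow> (nat \<Rightarrow> bool) \<Rightarrow> (nat \<Rightarrow> bool) \<Rightarrow> nat \<Rightarrow> bool" where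
  "glue n a w = (\<lambda>q. if q < n then a q else w (q - n))"

lemma glue_shift [simp]: "(\<lambda>q. glue n a w (n + q)) = w"
  by (simp add: glue_def)

lemma glue_eqI: "(\<And>q. q < n \<Longrightarrow> u q = a q) \<Longrightarrow> u = glue n a (\<lambda>q. u (n + q))"
  by (auto simp: glue_def)

lemma inj_glue: "inj (glue n a)"
  by (metis glue_shift injI)

text \<open>Different prefixes keep the parts disjoint, and prepending a fixed prefix is
  injective.\<close>

lemma card_glue_UN:
  assumes "finite I" "\<And>i. i \<in> I \<Longrightarrow> finite (X i)"
    and "\<And>i j. i \<in> I \<Longrightarrow> j \<in> I \<Longrightarrow> (\<And>q. q < n \<Longrightarrow> a i q = a j q) \<Longrightarrow> i = j"
  shows "finite (\<Union>i \<in> I. glue n (a i) ` X i)" (is ?goal1)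
    and "card (\<Union>i \<in> I. glue n (a i) ` X i) = (\<Sum>i \<in> I. card (X i))" (is ?goal2)
proof -
  show ?goal1 using assms(1,2) by blast
  have "glue n (a i) ` X i \<inter> glue n (a j) ` X j = {}" if "i \<in> I" "j \<in> I" "i \<noteq> j" for i j
  proof (rule ccontr)
    assume "glue n (a i) ` X i \<inter> glue n (a j) ` X j \<noteq> {}"
    then obtain w w' where eq: "glue n (a i) w = glue n (a j) w'" by auto
    have "a i q = a j q" if "q < n" for q
      using fun_cong[OF eq, of q] that by (simp add: glue_def)
    then show False using assms(3) that by blast
  qed
  then have "card (\<Union>i \<in> I. glue n (a i) ` X i) = (\<Sum>i \<in> I. card (glue n (a i) ` X i))"
    using assms(1,2) by (intro card_UN_disjoint) auto
  then show ?goal2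
    by (simp add: card_image inj_on_subset[OF inj_glue])
qed

text \<open>Serves both for the values of a \<open>CFO\<close> variable and for the tags that name a
  summand.\<close>

lemma card_one_hot:
  fixes X :: "nat \<Rightarrow> (nat \<Rightarrow> bool) set" and n :: nat
  assumes fin: "\<And>i. i \<in> {..<n} \<Longrightarrow> finite (X i)"
  defines "Y \<equiv> {w. \<exists>i < n. (\<forall>q < n. w q = (q = i)) \<and> (\<lambda>q. w (n + q)) \<in> X i}"
  shows "finite Y" and "card Y = (\<Sum>i<n. card (X i))"
proof -
  have eq: "Y = (\<Union>i \<in> {..<n}. glue n (\<lambda>q. q = i) ` X i)"
  proof (intro equalityI subsetI)
    fix w assume "w \<in> Y"
    then obtain i where i: "i < n" "\<forall>q < n. w q = (q = i)" "(\<lambda>q. w (n + q)) \<in> X i"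
      unfolding Y_def by blast
    then have "w = glue n (\<lambda>q. q = i) (\<lambda>q. w (n + q))" by (intro glue_eqI) auto
    then show "w \<in> (\<Union>i \<in> {..<n}. glue n (\<lambda>q. q = i) ` X i)" using i(1,3) by blast
  next
    fix w assume "w \<in> (\<Union>i \<in> {..<n}. glue n (\<lambda>q. q = i) ` X i)"
    then obtain i w' where i: "i < n" "w' \<in> X i" and "w = glue n (\<lambda>q. q = i) w'" by auto
    then have "(\<lambda>q. w (n + q)) = w'" "\<forall>q < n. w q = (q = i)"
      by (simp_all add: glue_def)
    then show "w \<in> Y" unfolding Y_def mem_Collect_eq using i by (intro exI[of _ i]) simp
  qed
  have inj: "i = j" if "i \<in> {..<n}" "\<And>q. q < n \<Longrightarrow> (q = i) = (q = j)" for i j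
    using that(2)[of i] that(1) by simp
  note * = card_glue_UN[of "{..<n}" X n "\<lambda>i q. q = i", OF finite_lessThan fin inj]
  show "finite Y" unfolding eq by (rule *(1))
  show "card Y = (\<Sum>i<n. card (X i))" unfolding eq by (rule *(2))
qed

lemma card_witnesses_CFO:
  assumes as: "lists_universe \<A> as"
    and fin: "\<And>v. finite (witnesses \<A> as v V (bs, r))"
  shows "finite (witnesses \<A> as v V (CFO x # bs, r))" (is ?goal1)
    and "card (witnesses \<A> as v V (CFO x # bs, r)) =
      (\<Sum>a \<in> universe \<A>. card (witnesses \<A> as (v(x := a)) V (bs, r)))" (is ?goal2)
proof -
  let ?n = "length as"
  let ?X = "\<lambda>i. witnesses \<A> as (v(x := as ! i)) V (bs, r)"
  have eq: "witnesses \<A> as v V (CFO x # bs, r) =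
      {w. \<exists>i < ?n. (\<forall>q < ?n. w q = (q = i)) \<and> (\<lambda>q. w (?n + q)) \<in> ?X i}"
    by (simp add: witnesses_def)
  note * = card_one_hot[of ?n ?X, OF fin]
  show ?goal1 unfolding eq by (rule *(1))
  have card: "card (witnesses \<A> as v V (CFO x # bs, r)) = (\<Sum>i<?n. card (?X i))"
    unfolding eq by (rule *(2))
  have "bij_betw ((!) as) {..<?n} (universe \<A>)"
    by (rule bij_betw_nth) (use as in \<open>simp_all add: lists_universe_def\<close>)
  from sum.reindex_bij_betw[OF this, of "\<lambda>a. card (witnesses \<A> as (v(x := a)) V (bs, r))"]
  show ?goal2
    by (rule trans[OF card])
qed

lemma card_witnesses_CSO:
  assumes as: "lists_universe \<A> as"
    and fin: "\<And>V. finite (witnesses \<A> as v V (bs, r))"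
  shows "finite (witnesses \<A> as v V (CSO X # bs, r))" (is ?goal1)
    and "card (witnesses \<A> as v V (CSO X # bs, r)) =
      (\<Sum>B \<in> Pow (tuples (universe \<A>) (arity X)). card (witnesses \<A> as v (V(X := B)) (bs, r)))"
proof -
  let ?n = "length as" and ?k = "arity X"
  let ?T = "tuples (universe \<A>) ?k"
  have d: "distinct as" using as by (simp add: lists_universe_def)
  \<comment> \<open>The characteristic string of \<open>B\<close>, inverse to \<open>decode\<close>
    on the first \<open>?n ^ ?k\<close> bits.\<close>
  define code where "code = (\<lambda>B q. \<exists>is \<in> indices ?n ?k. horner ?n is = q \<and> map ((!) as) is \<in> B)"
  let ?X = "\<lambda>B. witnesses \<A> as v (V(X := B)) (bs, r)"
  have code: "code B (horner ?n is) \<longleftrightarrow> map ((!) as) is \<in> B" if "is \<in> indices ?n ?k" for B "is"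
  proof
    assume "code B (horner ?n is)"
    then obtain is' where "is' \<in> indices ?n ?k" "horner ?n is' = horner ?n is" "map ((!) as) is' \<in> B"
      unfolding code_def by auto
    then show "map ((!) as) is \<in> B" using horner_inj[of is' ?n ?k "is"] that by simp
  next
    assume "map ((!) as) is \<in> B"
    then show "code B (horner ?n is)" using that unfolding code_def by (intro bexI[of _ "is"]) auto
  qed
  have dec: "decode as ?k w = B" if "B \<subseteq> ?T" "\<And>q. q < ?n ^ ?k \<Longrightarrow> w q = code B q" for B w
  proof (intro equalityI subsetI)
    fix t assume "t \<in> decode as ?k w"
    then obtain "is" where t: "t = map ((!) as) is" "is \<in> indices ?n ?k" "w (horner ?n is)"
      by (auto simp: decode_def)
    show "t \<in> B" using t(3) that(2)[OF horner_less[OF t(2)]] code[OF t(2)] t(1) by simp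
  next
    fix t assume "t \<in> B"
    then have "t \<in> map ((!) as) ` indices ?n ?k"
      using that(1) unfolding tuples_indices[OF as] by (rule rev_subsetD)
    then obtain "is" where t: "t = map ((!) as) is" "is \<in> indices ?n ?k" by (elim imageE)
    show "t \<in> decode as ?k w"
      using \<open>t \<in> B\<close> that(2)[OF horner_less[OF t(2)]] code[OF t(2)] t(1) decode_mem[OF d t(2)] by simp
  qed
  have eq: "witnesses \<A> as v V (CSO X # bs, r) = (\<Union>B \<in> Pow ?T. glue (?n ^ ?k) (code B) ` ?X B)"
  proof (intro equalityI subsetI)
    fix w assume w: "w \<in> witnesses \<A> as v V (CSO X # bs, r)"
    let ?B = "decode as ?k w"
    have "w = glue (?n ^ ?k) (code ?B) (\<lambda>q. w (?n ^ ?k + q))"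
    proof (rule glue_eqI)
      fix q assume "q < ?n ^ ?k"
      then obtain "is" where i: "is \<in> indices ?n ?k" "horner ?n is = q" using horner_surj by blast
      show "w q = code ?B q" using code[OF i(1)] decode_mem[OF d i(1)] i(2) by simp
    qed
    moreover have "?B \<in> Pow ?T" unfolding tuples_indices[OF as] decode_def by blast
    moreover have "(\<lambda>q. w (?n ^ ?k + q)) \<in> ?X ?B" using w by (simp add: witnesses_def)
    ultimately show "w \<in> (\<Union>B \<in> Pow ?T. glue (?n ^ ?k) (code B) ` ?X B)" by blast
  next
    fix w assume "w \<in> (\<Union>B \<in> Pow ?T. glue (?n ^ ?k) (code B) ` ?X B)"
    then obtain B w' where B: "B \<subseteq> ?T" "w' \<in> ?X B" "w = glue (?n ^ ?k) (code B) w'" by auto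
    have "decode as ?k w = B" by (rule dec) (use B in \<open>auto simp: glue_def\<close>)
    then show "w \<in> witnesses \<A> as v V (CSO X # bs, r)" using B by (simp add: witnesses_def)
  qed
  have finT: "finite (Pow ?T)"
    unfolding tuples_indices[OF as] indices_def
    using finite_lists_length_eq[of "{..<?n}" ?k] by (simp add: conj_commute)
  have inj: "B = B'" if "B \<in> Pow ?T" "B' \<in> Pow ?T" "\<And>q. q < ?n ^ ?k \<Longrightarrow> code B q = code B' q" for B B'
  proof -
    have "decode as ?k (code B) = B" by (rule dec[OF PowD[OF that(1)] refl])
    moreover have "decode as ?k (code B) = B'" by (rule dec[OF PowD[OF that(2)] that(3)])
    ultimately show ?thesis by simp
  qed
  note * = card_glue_UN[of "Pow ?T" ?X "?n ^ ?k" code, OF finT fin inj]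
  show ?goal1 unfolding eq by (rule *(1))
  show "card (witnesses \<A> as v V (CSO X # bs, r)) =
      (\<Sum>B \<in> Pow ?T. card (witnesses \<A> as v (V(X := B)) (bs, r)))"
    unfolding eq by (rule *(2))
qed

text \<open>The existential block consumes no bits, and after it only zeros may follow. Hence there
  is one witness or none, in accordance with the value 0 or 1 of a formula.\<close>

lemma witness_EFO:
  assumes "lists_universe \<A> as"
  shows "witness \<A> as r (map EFO xs) v V w \<longleftrightarrow>
    ex_block (universe \<A>) xs
      (all_block (universe \<A>) (fst r) (\<lambda>u. \<forall>C \<in> set (snd r). sat_clause \<A> u V C)) v \<and> (\<forall>q. \<not> w q)"
proof (induction xs arbitrary: v)
  case (Cons x xs)
  show ?case unfolding list.map witness.simps ex_block.simps Cons.IH Bex_universe[OF assms] by blast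
qed simp

lemma sum_list_sum_swap:
  "sum_list (map (\<lambda>s. \<Sum>a \<in> I. f a s) xs) = (\<Sum>a \<in> I. sum_list (map (f a) xs))"
  for f :: "'i \<Rightarrow> 's \<Rightarrow> nat"
  by (induction xs) (auto simp: sum.distrib)

text \<open>The step shared by \<open>SumFO\<close> and \<open>SumSO\<close>: prefixing all summands
  by the variable (\<open>g\<close>) interchanges the sum over its values with the sum over the
  summands.\<close>

lemma sum_summands:
  fixes e :: "'i \<Rightarrow> nat"
  assumes IH: "\<And>a. (\<forall>s \<in> set ss. finite (W a s)) \<and> e a = (\<Sum>s \<leftarrow> ss. card (W a s))"
    and g: "\<And>s. s \<in> set ss \<Longrightarrow> finite (U (g s)) \<and> card (U (g s)) = (\<Sum>a \<in> I. card (W a s))"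
  shows "(\<forall>s \<in> set (map g ss). finite (U s)) \<and> (\<Sum>a \<in> I. e a) = (\<Sum>s \<leftarrow> map g ss. card (U s))"
proof -
  have "(\<Sum>a \<in> I. e a) = (\<Sum>a \<in> I. \<Sum>s \<leftarrow> ss. card (W a s))"
    by (intro sum.cong refl conjunct2[OF IH])
  also have "\<dots> = (\<Sum>s \<leftarrow> ss. \<Sum>a \<in> I. card (W a s))"
    by (rule sum_list_sum_swap[symmetric])
  also have "\<dots> = (\<Sum>s \<leftarrow> ss. card (U (g s)))"
    by (rule arg_cong[where f = sum_list], rule map_cong[OF refl]) (simp add: g)
  finally show ?thesis using g by (simp add: comp_def)
qed

theorem eval_summands:
  assumes as: "lists_universe \<A> as"
  shows "(\<forall>s \<in> set (summands \<alpha>). finite (witnesses \<A> as v V s)) \<and>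
    eval \<A> v V \<alpha> = (\<Sum>s \<leftarrow> summands \<alpha>. card (witnesses \<A> as v V s))"
proof (induction \<alpha> arbitrary: v V)
  case (Form \<phi>)
  obtain xs ys Cs where \<phi>: "\<phi> = ExAll xs ys Cs" by (cases \<phi>)
  have "witnesses \<A> as v V (map EFO xs, ys, Cs) =
      (if sat_sigma2 \<A> v V \<phi> then {\<lambda>_. False} else {})"
    by (auto simp: witnesses_def witness_EFO[OF as] \<phi>)
  then show ?case by (simp add: \<phi>)
next
  case (Const s)
  have "witnesses \<A> as v V ([], [], []) = {\<lambda>_. False}"
    by (auto simp: witnesses_def)
  then show ?case by (simp add: sum_list_replicate)
next
  case (SumFO x \<alpha>)
  show ?case unfolding summands.simps eval.simps
  proof (rule sum_summands[where W = "\<lambda>a. witnesses \<A> as (v(x := a)) V"])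
    fix s assume "s \<in> set (summands \<alpha>)"
    note fin = bspec[OF conjunct1[OF SumFO.IH] this]
    obtain bs r where s: "s = (bs, r)" by (cases s)
    show "finite (witnesses \<A> as v V (case s of (bs, r) \<Rightarrow> (CFO x # bs, r))) \<and>
        card (witnesses \<A> as v V (case s of (bs, r) \<Rightarrow> (CFO x # bs, r))) =
        (\<Sum>a \<in> universe \<A>. card ((\<lambda>a. witnesses \<A> as (v(x := a)) V) a s))"
      unfolding s prod.case by (rule conjI; rule card_witnesses_CFO[OF as fin[unfolded s]])
  qed (rule SumFO.IH)
next
  case (SumSO X \<alpha>)
  show ?case unfolding summands.simps eval.simps
  proof (rule sum_summands[where W = "\<lambda>B. witnesses \<A> as v (V(X := B))"])
    fix s assume "s \<in> set (summands \<alpha>)"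
    note fin = bspec[OF conjunct1[OF SumSO.IH] this]
    obtain bs r where s: "s = (bs, r)" by (cases s)
    show "finite (witnesses \<A> as v V (case s of (bs, r) \<Rightarrow> (CSO X # bs, r))) \<and>
        card (witnesses \<A> as v V (case s of (bs, r) \<Rightarrow> (CSO X # bs, r))) =
        (\<Sum>a \<in> Pow (tuples (universe \<A>) (arity X)). card ((\<lambda>B. witnesses \<A> as v (V(X := B))) a s))"
      unfolding s prod.case by (rule conjI; rule card_witnesses_CSO[OF as fin[unfolded s]])
  qed (rule SumSO.IH)
qed auto

text \<open>The tag makes the witness sets of different summands disjoint, so that the cardinality
  of the union is the sum.\<close>

definition tagged_witnesses :: "'a rel_structure \<Rightarrow> 'a list \<Rightarrow> 'a fo_assignment \<Rightarrow> 'a so_assignment \<Rightarrow>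
    summand list \<Rightarrow> (nat \<Rightarrow> bool) set" where
  "tagged_witnesses \<A> as v V ss =
     {w. \<exists>i < length ss. (\<forall>q < length ss. w q = (q = i)) \<and>
        (\<lambda>q. w (length ss + q)) \<in> witnesses \<A> as v V (ss ! i)}"

lemma card_tagged_witnesses:
  assumes fin: "\<And>s. s \<in> set ss \<Longrightarrow> finite (witnesses \<A> as v V s)"
  shows "finite (tagged_witnesses \<A> as v V ss)" (is ?goal1)
    and "card (tagged_witnesses \<A> as v V ss) = (\<Sum>s \<leftarrow> ss. card (witnesses \<A> as v V s))" (is ?goal2)
proof -
  let ?X = "\<lambda>i. witnesses \<A> as v V (ss ! i)"
  have fin': "finite (?X i)" if "i \<in> {..<length ss}" for i using fin that by simp
  note * = card_one_hot[of "length ss" ?X, OF fin', folded tagged_witnesses_def]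
  show ?goal1 by (rule *(1))
  have "card (tagged_witnesses \<A> as v V ss) = (\<Sum>i<length ss. card (?X i))" by (rule *(2))
  then show ?goal2
    by (simp add: sum_list_sum_nth atLeast0LessThan)
qed

section \<open>From formulae to 2-CNF constraints\<close>

text \<open>Positions are described by the exponents of the blocks in front of them. Exponent 0 is a
  single bit, exponent 1 a block of \<open>n\<close> bits; the description is independent of
  \<open>n\<close> and can be computed by an expression.\<close>

definition offset :: "nat \<Rightarrow> nat list \<Rightarrow> nat" where
  "offset n ks = (\<Sum>k \<leftarrow> ks. n ^ k)"

lemma offset_simps [simp]:
  "offset n [] = 0" "offset n (k # ks) = n ^ k + offset n ks"
  "offset n (ks @ ks') = offset n ks + offset n ks'"
  by (simp_all add: offset_def)

lemma offset_replicate_0 [simp]: "offset n (replicate m 0) = m"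
  by (induction m) auto

text \<open>The expressions below take the size of the structure from level \<open>0\<close>.\<close>

fun pow_exp :: "nat \<Rightarrow> aexp" where
  "pow_exp 0 = Cst 1"
| "pow_exp (Suc k) = Mul (Lev 0) (pow_exp k)"

fun offset_exp :: "nat list \<Rightarrow> aexp" where
  "offset_exp [] = Cst 0"
| "offset_exp (k # ks) = Add (pow_exp k) (offset_exp ks)"

definition horner_exp :: "nat list \<Rightarrow> aexp" where
  "horner_exp ls = foldl (\<lambda>a l. Add (Mul a (Lev 0)) (Lev l)) (Cst 0) ls"

definition position_exp :: "nat list \<Rightarrow> nat list \<Rightarrow> aexp" where
  "position_exp ks ls = Add (offset_exp ks) (horner_exp ls)"

lemma aval_offset_exp [simp]: "aval \<rho> (offset_exp ks) = offset (look \<rho> 0) ks"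
proof -
  have "aval \<rho> (pow_exp k) = look \<rho> 0 ^ k" for k by (induction k) auto
  then show ?thesis by (induction ks) auto
qed

lemma aval_position_exp [simp]:
  "aval \<rho> (position_exp ks ls) = offset (look \<rho> 0) ks + horner (look \<rho> 0) (map (look \<rho>) ls)"
proof -
  have "aval \<rho> (horner_exp ls) = horner (look \<rho> 0) (map (look \<rho>) ls)"
    by (induction ls rule: rev_induct) (simp_all add: horner_exp_def horner_def)
  then show ?thesis by (simp add: position_exp_def)
qed

section \<open>Evaluation of first-order formulae on the encoded structure\<close>

definition BEq :: "aexp \<Rightarrow> aexp \<Rightarrow> bexp" where
  "BEq a b = BAnd (BNot (BLess a b)) (BNot (BLess b a))"

lemma bval_BEq [simp]: "bval \<rho> S (BEq a b) \<longleftrightarrow> aval \<rho> a = aval \<rho> b"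
  by (auto simp: BEq_def)

lemma breads_simps [simp]: "breads (BEq a b) = {}" "breads btrue = {}" "breads bfalse = {}"
  by (simp_all add: BEq_def btrue_def bfalse_def)

text \<open>Every variable has a level, also those not yet bound; its value is the index of an
  element in the listing.\<close>

definition fits :: "nat \<Rightarrow> nat list \<Rightarrow> (fo_var \<Rightarrow> nat) \<Rightarrow> bool" where
  "fits n \<rho> \<eta> \<longleftrightarrow> look \<rho> 0 = n \<and> (\<forall>x. \<eta> x < length \<rho> \<and> look \<rho> (\<eta> x) < n)"

definition fo_value :: "'a list \<Rightarrow> nat list \<Rightarrow> (fo_var \<Rightarrow> nat) \<Rightarrow> 'a fo_assignment" where
  "fo_value as \<rho> \<eta> = (\<lambda>x. as ! look \<rho> (\<eta> x))"

lemma look_snoc_less: "k < length \<rho> \<Longrightarrow> look (\<rho> @ [i]) k = look \<rho> k"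
  by (simp add: look_snoc)

lemma fits_nonempty: "fits n \<rho> \<eta> \<Longrightarrow> 0 < length \<rho>"
  unfolding fits_def by (metis gr_zeroI less_nat_zero_code)

lemma fits_snoc: "fits n \<rho> \<eta> \<Longrightarrow> i < n \<Longrightarrow> fits n (\<rho> @ [i]) (\<eta>(x := length \<rho>))"
  using fits_nonempty[of n \<rho> \<eta>] by (auto simp: fits_def look_snoc_less look_snoc less_Suc_eq)

lemma fo_value_snoc:
  "fits n \<rho> \<eta> \<Longrightarrow> fo_value as (\<rho> @ [i]) (\<eta>(x := length \<rho>)) = (fo_value as \<rho> \<eta>)(x := as ! i)"
proof
  fix y assume "fits n \<rho> \<eta>"
  then have "\<eta> y < length \<rho>" by (simp add: fits_def)
  then show "fo_value as (\<rho> @ [i]) (\<eta>(x := length \<rho>)) y = ((fo_value as \<rho> \<eta>)(x := as ! i)) y"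
    by (simp add: fo_value_def look_snoc)
qed

text \<open>The prefix \<open>1 # 0\<close> accounts for the header of \<open>n ^ 1\<close> zeros
  and \<open>n ^ 0\<close> ones; the blocks of the earlier relation symbols follow.\<close>

definition encodes :: "vocabulary \<Rightarrow> 'a rel_structure \<Rightarrow> 'a list \<Rightarrow> (nat \<Rightarrow> bool) \<Rightarrow> bool" where
  "encodes \<sigma> \<A> as I \<longleftrightarrow>
     (\<forall>i < length \<sigma>. \<forall>is \<in> indices (length as) (\<sigma> ! i).
        I (offset (length as) (1 # 0 # take i \<sigma>) + horner (length as) is) \<longleftrightarrow>
        map ((!) as) is \<in> interp \<A> i)"

fun fo_bexp :: "vocabulary \<Rightarrow> nat \<Rightarrow> (fo_var \<Rightarrow> nat) \<Rightarrow> fo_formula \<Rightarrow> bexp" where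
  "fo_bexp \<sigma> d \<eta> (Eq x y) = BEq (Lev (\<eta> x)) (Lev (\<eta> y))"
| "fo_bexp \<sigma> d \<eta> (Rel i xs) = BRead 0 (position_exp (1 # 0 # take i \<sigma>) (map \<eta> xs))"
| "fo_bexp \<sigma> d \<eta> (Neg \<phi>) = BNot (fo_bexp \<sigma> d \<eta> \<phi>)"
| "fo_bexp \<sigma> d \<eta> (Or \<phi> \<psi>) = BOr (fo_bexp \<sigma> d \<eta> \<phi>) (fo_bexp \<sigma> d \<eta> \<psi>)"
| "fo_bexp \<sigma> d \<eta> (Ex x \<phi>) = BEx (Lev 0) (fo_bexp \<sigma> (d + 1) (\<eta>(x := d)) \<phi>)"
| "fo_bexp \<sigma> d \<eta> Top = btrue"
| "fo_bexp \<sigma> d \<eta> Bot = bfalse"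

lemma breads_fo_bexp: "breads (fo_bexp \<sigma> d \<eta> \<phi>) \<subseteq> {0}"
  by (induction \<phi> arbitrary: d \<eta>) auto

lemma fits_indices:
  assumes "fits n \<rho> \<eta>" "length xs = k"
  shows "map (look \<rho>) (map \<eta> xs) \<in> indices n k"
    and "map ((!) as) (map (look \<rho>) (map \<eta> xs)) = map (fo_value as \<rho> \<eta>) xs"
  using assms by (auto simp: fits_def indices_def fo_value_def)

lemma bval_fo_bexp:
  assumes as: "lists_universe \<A> as" and I: "encodes \<sigma> \<A> as (S 0)"
  shows "fits (length as) \<rho> \<eta> \<Longrightarrow> over_fo \<sigma> \<phi> \<Longrightarrow>
    bval \<rho> S (fo_bexp \<sigma> (length \<rho>) \<eta> \<phi>) \<longleftrightarrow> sat_fo \<A> (fo_value as \<rho> \<eta>) \<phi>"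
proof (induction \<phi> arbitrary: \<rho> \<eta>)
  case (Eq x y)
  have "distinct as" using as by (simp add: lists_universe_def)
  then show ?case using Eq.prems(1) by (simp add: fits_def fo_value_def nth_eq_iff_index_eq)
next
  case (Rel i xs)
  have i: "i < length \<sigma>" "length xs = \<sigma> ! i" using Rel.prems(2) by auto
  have n: "look \<rho> 0 = length as" using Rel.prems(1) by (simp add: fits_def)
  note idx = fits_indices[OF Rel.prems(1) i(2)]
  have "S 0 (offset (length as) (1 # 0 # take i \<sigma>) +
      horner (length as) (map (look \<rho>) (map \<eta> xs))) \<longleftrightarrow> map (fo_value as \<rho> \<eta>) xs \<in> interp \<A> i"
    using I i(1) idx(1) unfolding encodes_def idx(2)[symmetric, of as] by blast
  then show ?case unfolding fo_bexp.simps bval.simps aval_position_exp n sat_fo.simps .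
next
  case (Neg \<phi>)
  then show ?case by simp
next
  case (Or \<phi> \<psi>)
  then show ?case by simp
next
  case (Ex x \<phi>)
  have n: "look \<rho> 0 = length as" using Ex.prems(1) by (simp add: fits_def)
  have "bval (\<rho> @ [i]) S (fo_bexp \<sigma> (length \<rho> + 1) (\<eta>(x := length \<rho>)) \<phi>) \<longleftrightarrow>
      sat_fo \<A> ((fo_value as \<rho> \<eta>)(x := as ! i)) \<phi>" if "i < length as" for i
  proof -
    have "bval (\<rho> @ [i]) S (fo_bexp \<sigma> (length (\<rho> @ [i])) (\<eta>(x := length \<rho>)) \<phi>) \<longleftrightarrow>
        sat_fo \<A> (fo_value as (\<rho> @ [i]) (\<eta>(x := length \<rho>))) \<phi>"
      by (rule Ex.IH[OF fits_snoc[OF Ex.prems(1) that]]) (use Ex.prems(2) in simp)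
    then show ?thesis unfolding fo_value_snoc[OF Ex.prems(1)] by simp
  qed
  then show ?case
    unfolding fo_bexp.simps bval.simps sat_fo.simps Bex_universe[OF as] aval.simps n by blast
qed simp_all

section \<open>Clauses with evaluated first-order parts as 2-CNF constraints\<close>

definition so_value :: "'a list \<Rightarrow> (so_var \<Rightarrow> nat list option) \<Rightarrow> (nat \<Rightarrow> bool) \<Rightarrow>
    'a so_assignment" where
  "so_value as \<xi> w = (\<lambda>X. case \<xi> X of None \<Rightarrow> {} | Some ks \<Rightarrow>
     decode as (arity X) (\<lambda>q. w (offset (length as) ks + q)))"

text \<open>\<open>Inl\<close> is a literal about an unknown bit of the witness, \<open>Inr\<close>
  a condition that can be evaluated. A relation variable without a position denotes the empty
  relation, so its literals are constants.\<close>

fun translate :: "vocabulary \<Rightarrow> nat \<Rightarrow> (fo_var \<Rightarrow> nat) \<Rightarrow> (so_var \<Rightarrow> nat list option) \<Rightarrow> disjunct \<Rightarrow>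
    lit + bexp" where
  "translate \<sigma> d \<eta> \<xi> (Lit (PosLit X xs)) =
     (case \<xi> X of None \<Rightarrow> Inr bfalse | Some ks \<Rightarrow> Inl (True, position_exp ks (map \<eta> xs)))"
| "translate \<sigma> d \<eta> \<xi> (Lit (NegLit X xs)) =
     (case \<xi> X of None \<Rightarrow> Inr btrue | Some ks \<Rightarrow> Inl (False, position_exp ks (map \<eta> xs)))"
| "translate \<sigma> d \<eta> \<xi> (FO \<phi>) = Inr (fo_bexp \<sigma> d \<eta> \<phi>)"

definition holds :: "nat list \<Rightarrow> arrays \<Rightarrow> (nat \<Rightarrow> bool) \<Rightarrow> lit + bexp \<Rightarrow> bool" where
  "holds \<rho> S w c = (case c of Inl l \<Rightarrow> lit_true w (aval \<rho> (lexp l)) | Inr b \<Rightarrow> bval \<rho> S b)"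

lemma lit_true_lexp: "lit_true w (aval \<rho> (lexp (b, e))) \<longleftrightarrow> w (aval \<rho> e) = b"
  by (auto simp: lit_true_def)

definition in_range :: "nat \<Rightarrow> nat \<Rightarrow> (so_var \<Rightarrow> nat list option) \<Rightarrow> bool" where
  "in_range n N \<xi> \<longleftrightarrow> (\<forall>X ks. \<xi> X = Some ks \<longrightarrow> offset n ks + n ^ arity X \<le> N)"

lemma holds_translate:
  assumes as: "lists_universe \<A> as" and I: "encodes \<sigma> \<A> as (S 0)"
    and fits: "fits (length as) \<rho> \<eta>" and d: "over_disjunct \<sigma> d"
  shows "holds \<rho> S w (translate \<sigma> (length \<rho>) \<eta> \<xi> d) \<longleftrightarrow>
    sat_disjunct \<A> (fo_value as \<rho> \<eta>) (so_value as \<xi> w) d"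
proof -
  have dist: "distinct as" using as by (simp add: lists_universe_def)
  have n: "look \<rho> 0 = length as" using fits by (simp add: fits_def)
  have lit: "map (fo_value as \<rho> \<eta>) xs \<in> so_value as \<xi> w X \<longleftrightarrow>
      w (aval \<rho> (position_exp ks (map \<eta> xs)))"
    if "length xs = arity X" "\<xi> X = Some ks" for X xs ks
  proof -
    note idx = fits_indices[OF fits that(1)]
    show ?thesis
      unfolding so_value_def that(2) option.case idx(2)[symmetric, of as]
        decode_mem[OF dist idx(1)] aval_position_exp n ..
  qed
  have none: "so_value as \<xi> w X = {}" if "\<xi> X = None" for X
    using that by (simp add: so_value_def)
  show ?thesis
  proof (cases d)
    case (Lit l)
    show ?thesis
    proof (cases l)
      case (PosLit X xs)
      then show ?thesis using Lit d lit[of xs X] none[of X]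
        by (cases "\<xi> X") (simp_all add: holds_def lit_true_lexp del: lexp.simps aval_position_exp)
    next
      case (NegLit X xs)
      then show ?thesis using Lit d lit[of xs X] none[of X]
        by (cases "\<xi> X") (simp_all add: holds_def lit_true_lexp del: lexp.simps aval_position_exp)
    qed
  next
    case (FO \<phi>)
    then show ?thesis using bval_fo_bexp[where S = S, OF as I fits] d by (simp add: holds_def)
  qed
qed

lemma translate_bounded:
  assumes fits: "fits n \<rho> \<eta>" and d: "over_disjunct \<sigma> d" and \<xi>: "in_range n N \<xi>"
    and l: "translate \<sigma> k \<eta> \<xi> d = Inl l"
  shows "aval \<rho> (lexp l) < 2 * N"
proof -
  have n: "look \<rho> 0 = n" using fits by (simp add: fits_def)
  have "aval \<rho> (position_exp ks (map \<eta> xs)) < N \<and>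
      Suc (2 * aval \<rho> (position_exp ks (map \<eta> xs))) < 2 * N"
    if "length xs = arity X" "\<xi> X = Some ks" for X xs ks
  proof -
    have "horner n (map (look \<rho>) (map \<eta> xs)) < n ^ arity X"
      by (rule horner_less[OF fits_indices(1)[OF fits that(1)]])
    moreover have "offset n ks + n ^ arity X \<le> N" using \<xi> that(2) unfolding in_range_def by blast
    ultimately show ?thesis unfolding aval_position_exp n by simp
  qed
  then show ?thesis
    using d l by (cases "(\<sigma>, k, \<eta>, \<xi>, d)" rule: translate.cases)
      (auto split: option.splits simp del: aval_position_exp)
qed

text \<open>The evaluable disjuncts turn into a guard: the clause constrains the bits only if all of
  them fail. If no literal is left, falsity is expressed by two contradictory unit clauses on bit 0;
  a single literal is doubled.\<close>

definition emit_clause :: "(lit + bexp) list \<Rightarrow> gen" where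
  "emit_clause cs =
     (let b = foldr BAnd [BNot b. Inr b \<leftarrow> cs] btrue in
      case [l. Inl l \<leftarrow> cs] of
        [] \<Rightarrow> GUn (GEmit b (True, Cst 0) (True, Cst 0)) (GEmit b (False, Cst 0) (False, Cst 0))
      | [l] \<Rightarrow> GEmit b l l
      | l # l' # _ \<Rightarrow> GEmit b l l')"

lemma models_simps [simp]:
  "models w {}" "models w (\<Phi> \<union> \<Psi>) \<longleftrightarrow> models w \<Phi> \<and> models w \<Psi>"
  "models w (\<Union>i \<in> I. F i) \<longleftrightarrow> (\<forall>i \<in> I. models w (F i))"
  "models w {(l, l')} \<longleftrightarrow> lit_true w l \<or> lit_true w l'"
  "models w (if P then \<Phi> else \<Psi>) \<longleftrightarrow> (if P then models w \<Phi> else models w \<Psi>)"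
  by (auto simp: models_def)

lemma bval_conj: "bval \<rho> S (foldr BAnd bs btrue) \<longleftrightarrow> (\<forall>b \<in> set bs. bval \<rho> S b)"
  by (induction bs) auto

lemma breads_conj: "breads (foldr BAnd bs btrue) = (\<Union>b \<in> set bs. breads b)"
  by (induction bs) auto

lemma models_emit_clause:
  assumes "length [l. Inl l \<leftarrow> cs] \<le> 2"
  shows "models w (gval \<rho> S (emit_clause cs)) \<longleftrightarrow> (\<exists>c \<in> set cs. holds \<rho> S w c)"
proof -
  let ?b = "foldr BAnd [BNot b. Inr b \<leftarrow> cs] btrue"
  let ?ls = "[l. Inl l \<leftarrow> cs]"
  have b: "bval \<rho> S ?b \<longleftrightarrow> (\<forall>b. Inr b \<in> set cs \<longrightarrow> \<not> bval \<rho> S b)"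
    unfolding bval_conj by (induction cs) (auto split: sum.splits)
  have ls: "set ?ls = {l. Inl l \<in> set cs}" by (induction cs) (auto split: sum.splits)
  have "(\<exists>c \<in> set cs. holds \<rho> S w c) \<longleftrightarrow>
      (\<exists>l. Inl l \<in> set cs \<and> holds \<rho> S w (Inl l)) \<or> (\<exists>b. Inr b \<in> set cs \<and> holds \<rho> S w (Inr b))"
    by (metis sum.exhaust)
  then have h: "(\<exists>c \<in> set cs. holds \<rho> S w c) \<longleftrightarrow>
      (\<exists>l \<in> set ?ls. lit_true w (aval \<rho> (lexp l))) \<or> \<not> bval \<rho> S ?b"
    unfolding b ls by (simp add: holds_def Bex_def)
  consider "?ls = []" | l where "?ls = [l]" | l l' where "?ls = [l, l']"
    using assms by (cases ?ls rule: remdups_adj.cases) (auto simp: Suc_le_eq)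
  then show ?thesis
  proof cases
    case 1
    then show ?thesis unfolding h unfolding emit_clause_def 1 Let_def
      by (auto simp: lit_true_def)
  next
    case (2 l)
    then show ?thesis unfolding h unfolding emit_clause_def 2 Let_def by auto
  next
    case (3 l l')
    then show ?thesis unfolding h unfolding emit_clause_def 3 Let_def by auto
  qed
qed

lemma gval_emit_clause:
  assumes "0 < N" "\<And>l. Inl l \<in> set cs \<Longrightarrow> aval \<rho> (lexp l) < 2 * N"
  shows "gval \<rho> S (emit_clause cs) \<subseteq> literals N \<times> literals N"
proof -
  have "set [l. Inl l \<leftarrow> cs] = {l. Inl l \<in> set cs}" by (induction cs) (auto split: sum.splits)
  then have l: "aval \<rho> (lexp l) < 2 * N" if "l \<in> set [l. Inl l \<leftarrow> cs]" for l
    using assms(2) that by blast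
  consider "[l. Inl l \<leftarrow> cs] = []" | l where "[l. Inl l \<leftarrow> cs] = [l]"
    | l l' ls where "[l. Inl l \<leftarrow> cs] = l # l' # ls"
    by (cases "[l. Inl l \<leftarrow> cs]" rule: remdups_adj.cases)
  then show ?thesis
  proof cases
    case 1
    then show ?thesis using assms(1) unfolding emit_clause_def 1 Let_def by simp
  next
    case (2 k)
    have "aval \<rho> (lexp k) < 2 * N" by (rule l) (simp only: 2, simp)
    then show ?thesis unfolding emit_clause_def 2 Let_def by (simp del: lexp.simps)
  next
    case (3 k k' ls)
    have "aval \<rho> (lexp k) < 2 * N" "aval \<rho> (lexp k') < 2 * N" by (rule l, simp only: 3, simp)+
    then show ?thesis unfolding emit_clause_def 3 Let_def by (simp del: lexp.simps)
  qed
qed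

lemma greads_emit_clause: "(\<And>b. Inr b \<in> set cs \<Longrightarrow> breads b \<subseteq> R) \<Longrightarrow> greads (emit_clause cs) \<subseteq> R"
proof -
  assume R: "\<And>b. Inr b \<in> set cs \<Longrightarrow> breads b \<subseteq> R"
  have "set [BNot b. Inr b \<leftarrow> cs] = BNot ` {b. Inr b \<in> set cs}" by (induction cs) (auto split: sum.splits)
  then have "breads (foldr BAnd [BNot b. Inr b \<leftarrow> cs] btrue) \<subseteq> R"
    unfolding breads_conj using R by auto
  then show ?thesis unfolding emit_clause_def Let_def by (auto split: list.split)
qed

fun clause_gen :: "vocabulary \<Rightarrow> nat \<Rightarrow> (fo_var \<Rightarrow> nat) \<Rightarrow> (so_var \<Rightarrow> nat list option) \<Rightarrow> clause \<Rightarrow> gen"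
  where
  "clause_gen \<sigma> d \<eta> \<xi> (d1, d2, d3) = emit_clause (map (translate \<sigma> d \<eta> \<xi>) [d1, d2, d3])"

definition union_gen :: "gen list \<Rightarrow> gen" where
  "union_gen gs = foldr GUn gs GNone"

lemma union_gen_simps [simp]:
  "gval \<rho> S (union_gen gs) = (\<Union>g \<in> set gs. gval \<rho> S g)"
  "greads (union_gen gs) = (\<Union>g \<in> set gs. greads g)"
  by (induction gs) (auto simp: union_gen_def)

text \<open>Universal quantification is conjunction over all values, that is, a union of clause
  sets.\<close>

fun matrix_gen :: "vocabulary \<Rightarrow> nat \<Rightarrow> (fo_var \<Rightarrow> nat) \<Rightarrow> (so_var \<Rightarrow> nat list option) \<Rightarrow> clause list \<Rightarrow>
    fo_var list \<Rightarrow> gen" where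
  "matrix_gen \<sigma> d \<eta> \<xi> Cs [] = union_gen (map (clause_gen \<sigma> d \<eta> \<xi>) Cs)"
| "matrix_gen \<sigma> d \<eta> \<xi> Cs (y # ys) = GAny (Lev 0) (matrix_gen \<sigma> (d + 1) (\<eta>(y := d)) \<xi> Cs ys)"

lemma clause_gen_correct:
  assumes as: "lists_universe \<A> as" and I: "encodes \<sigma> \<A> as (S 0)"
    and fits: "fits (length as) \<rho> \<eta>" and C: "is_2SAT_clause \<sigma> C"
    and \<xi>: "in_range (length as) N \<xi>" and N: "0 < N"
  shows "models w (gval \<rho> S (clause_gen \<sigma> (length \<rho>) \<eta> \<xi> C)) \<longleftrightarrow>
      sat_clause \<A> (fo_value as \<rho> \<eta>) (so_value as \<xi> w) C" (is ?goal1)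
    and "gval \<rho> S (clause_gen \<sigma> (length \<rho>) \<eta> \<xi> C) \<subseteq> literals N \<times> literals N" (is ?goal2)
proof -
  obtain d1 d2 d3 where d: "C = (d1, d2, d3)" by (cases C)
  have over: "over_disjunct \<sigma> d'" if "d' \<in> {d1, d2, d3}" for d' using C that by (auto simp: d)
  let ?t = "translate \<sigma> (length \<rho>) \<eta> \<xi>"
  note h = holds_translate[where S = S and w = w and \<xi> = \<xi>, OF as I fits over]
  \<comment> \<open>This is where the first-order disjunct of a 2SAT clause enters: it translates to
    \<open>Inr\<close>, leaving at most two literals.\<close>
  have "length [l. Inl l \<leftarrow> map ?t [d1, d2, d3]] \<le> 2"
    using C by (auto simp: d split: sum.splits)
  from models_emit_clause[OF this, of w \<rho> S]
  show ?goal1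
    using h[of d1] h[of d2] h[of d3] by (simp add: d)
  show ?goal2
    unfolding d clause_gen.simps
  proof (rule gval_emit_clause[OF N])
    fix l assume "Inl l \<in> set (map ?t [d1, d2, d3])"
    then obtain d' where d': "d' \<in> {d1, d2, d3}" "Inl l = ?t d'" by auto
    show "aval \<rho> (lexp l) < 2 * N"
      by (rule translate_bounded[OF fits over[OF d'(1)] \<xi> d'(2)[symmetric]])
  qed
qed

lemma greads_clause_gen: "greads (clause_gen \<sigma> d \<eta> \<xi> C) \<subseteq> {0}"
proof -
  obtain d1 d2 d3 where d: "C = (d1, d2, d3)" by (cases C)
  have "breads b \<subseteq> {0}" if "translate \<sigma> d \<eta> \<xi> d' = Inr b" for d' b
  proof (cases d')
    case (Lit l)
    then show ?thesis using that by (cases l) (auto split: option.splits)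
  next
    case (FO \<phi>)
    then have "b = fo_bexp \<sigma> d \<eta> \<phi>" using that by simp
    then show ?thesis using breads_fo_bexp by simp
  qed
  then have *: "breads b \<subseteq> {0}" if "Inr b = translate \<sigma> d \<eta> \<xi> d'" for d' b using that by metis
  show ?thesis unfolding d clause_gen.simps
  proof (rule greads_emit_clause)
    fix b assume "Inr b \<in> set (map (translate \<sigma> d \<eta> \<xi>) [d1, d2, d3])"
    then obtain d' where "Inr b = translate \<sigma> d \<eta> \<xi> d'" by auto
    then show "breads b \<subseteq> {0}" by (rule *)
  qed
qed

lemma greads_matrix_gen: "greads (matrix_gen \<sigma> d \<eta> \<xi> Cs ys) \<subseteq> {0}"
  by (induction ys arbitrary: d \<eta>) (use greads_clause_gen in \<open>simp_all add: UN_least\<close>)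

lemma matrix_gen_correct:
  assumes as: "lists_universe \<A> as" and I: "encodes \<sigma> \<A> as (S 0)"
    and Cs: "\<forall>C \<in> set Cs. is_2SAT_clause \<sigma> C"
    and \<xi>: "in_range (length as) N \<xi>" and N: "0 < N"
  shows "fits (length as) \<rho> \<eta> \<Longrightarrow>
    (models w (gval \<rho> S (matrix_gen \<sigma> (length \<rho>) \<eta> \<xi> Cs ys)) \<longleftrightarrow>
      all_block (universe \<A>) ys (\<lambda>u. \<forall>C \<in> set Cs. sat_clause \<A> u (so_value as \<xi> w) C)
        (fo_value as \<rho> \<eta>)) \<and>
    gval \<rho> S (matrix_gen \<sigma> (length \<rho>) \<eta> \<xi> Cs ys) \<subseteq> literals N \<times> literals N"
proof (induction ys arbitrary: \<rho> \<eta>)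
  case Nil
  note c = clause_gen_correct[where S = S, OF as I Nil bspec[OF Cs] \<xi> N]
  have "models w (gval \<rho> S (matrix_gen \<sigma> (length \<rho>) \<eta> \<xi> Cs [])) \<longleftrightarrow>
      (\<forall>C \<in> set Cs. sat_clause \<A> (fo_value as \<rho> \<eta>) (so_value as \<xi> w) C)"
    using c(1) by simp
  moreover have "gval \<rho> S (matrix_gen \<sigma> (length \<rho>) \<eta> \<xi> Cs []) \<subseteq> literals N \<times> literals N"
    using c(2) by (simp add: UN_least)
  ultimately show ?case by simp
next
  case (Cons y ys)
  have n: "look \<rho> 0 = length as" using Cons.prems by (simp add: fits_def)
  have IH: "models w (gval (\<rho> @ [i]) S (matrix_gen \<sigma> (length \<rho> + 1) (\<eta>(y := length \<rho>)) \<xi> Cs ys)) \<longleftrightarrow>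
      all_block (universe \<A>) ys (\<lambda>u. \<forall>C \<in> set Cs. sat_clause \<A> u (so_value as \<xi> w) C)
        ((fo_value as \<rho> \<eta>)(y := as ! i))"
    "gval (\<rho> @ [i]) S (matrix_gen \<sigma> (length \<rho> + 1) (\<eta>(y := length \<rho>)) \<xi> Cs ys) \<subseteq>
      literals N \<times> literals N" if "i < length as" for i
    using Cons.IH[OF fits_snoc[OF Cons.prems that, of y], unfolded fo_value_snoc[OF Cons.prems]]
    unfolding length_append_singleton Suc_eq_plus1 by (rule conjunct1, rule conjunct2)
  have "models w (gval \<rho> S (matrix_gen \<sigma> (length \<rho>) \<eta> \<xi> Cs (y # ys))) \<longleftrightarrow>
      all_block (universe \<A>) (y # ys) (\<lambda>u. \<forall>C \<in> set Cs. sat_clause \<A> u (so_value as \<xi> w) C)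
        (fo_value as \<rho> \<eta>)"
    unfolding matrix_gen.simps gval.simps models_simps all_block.simps Ball_universe[OF as] aval.simps n
    using IH(1) by auto
  moreover have "gval \<rho> S (matrix_gen \<sigma> (length \<rho>) \<eta> \<xi> Cs (y # ys)) \<subseteq> literals N \<times> literals N"
    unfolding matrix_gen.simps gval.simps aval.simps n
    by (rule UN_least) (use IH(2) in simp)
  ultimately show ?case by blast
qed

text \<open>Fixes a bit to an evaluable truth value by two unit clauses with opposite guards, of
  which one is active.\<close>

definition force :: "bexp \<Rightarrow> aexp \<Rightarrow> gen" where
  "force b e = GUn (GEmit b (True, e) (True, e)) (GEmit (BNot b) (False, e) (False, e))"

lemma models_force [simp]: "models w (gval \<rho> S (force b e)) \<longleftrightarrow> w (aval \<rho> e) = bval \<rho> S b"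
  by (auto simp: force_def lit_true_lexp simp del: lexp.simps)

lemma gval_force: "aval \<rho> e < N \<Longrightarrow> gval \<rho> S (force b e) \<subseteq> literals N \<times> literals N"
  by (auto simp: force_def)

lemma greads_force [simp]: "greads (force b e) = breads b"
  by (simp add: force_def)

text \<open>
  The constraints on a witness for summand \<open>i\<close> of \<open>m\<close> once the values of the first-order
  variables are fixed: it extends the bits chosen so far, carries the tag \<open>i\<close>, marks the values of
  the \<open>CFO\<close> variables (\<open>acc\<close> lists their blocks and levels), is zero from \<open>cur\<close> on, and satisfies
  the clauses.
\<close>

definition summand_gen :: "vocabulary \<Rightarrow> aexp \<Rightarrow> nat \<Rightarrow> nat \<Rightarrow> nat \<Rightarrow> nat list \<Rightarrow> (nat list \<times> nat) list \<Rightarrow>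
    (fo_var \<Rightarrow> nat) \<Rightarrow> (so_var \<Rightarrow> nat list option) \<Rightarrow> fo_var list \<times> clause list \<Rightarrow> gen" where
  "summand_gen \<sigma> NE m i d cur acc \<eta> \<xi> r =
     GUn (GAny (Add (Lev 1) (Cst 1)) (force (BRead 1 (Lev d)) (Lev d)))
     (GUn (GAny (Cst m) (force (BEq (Lev d) (Cst i)) (Lev d)))
     (GUn (union_gen (map (\<lambda>(ks, k).
         GAny (Lev 0) (force (BEq (Lev d) (Lev k)) (Add (offset_exp ks) (Lev d)))) acc))
     (GUn (GAny NE (GEmit (BNot (BLess (Lev d) (offset_exp cur))) (False, Lev d) (False, Lev d)))
       (matrix_gen \<sigma> d \<eta> \<xi> (snd r) (fst r)))))"

definition marks :: "nat \<Rightarrow> nat list \<Rightarrow> (nat list \<times> nat) list \<Rightarrow> (nat \<Rightarrow> bool) \<Rightarrow> bool" where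
  "marks n \<rho> acc w \<longleftrightarrow> (\<forall>(ks, k) \<in> set acc. \<forall>q < n. w (offset n ks + q) = (q = look \<rho> k))"

text \<open>The levels are bound already, so that appending to the environment keeps their values,
  and the blocks lie among the \<open>N\<close> bits.\<close>

definition placed :: "nat \<Rightarrow> nat \<Rightarrow> nat \<Rightarrow> (nat list \<times> nat) list \<Rightarrow> bool" where
  "placed n N d acc \<longleftrightarrow> (\<forall>(ks, k) \<in> set acc. k < d \<and> offset n ks + n \<le> N)"

text \<open>Only the bits below \<open>N\<close> are propositional variables; accordingly the zeros
  behind \<open>cur\<close> are enforced just for \<open>q < N\<close>.\<close>

lemma summand_gen_correct:
  fixes S :: arrays and cur :: "nat list" and i :: nat
  assumes as: "lists_universe \<A> as" and I: "encodes \<sigma> \<A> as (S 0)"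
    and Cs: "\<forall>C \<in> set (snd r). is_2SAT_clause \<sigma> C"
    and \<xi>: "in_range (length as) N \<xi>" and fits: "fits (length as) \<rho> \<eta>"
    and \<rho>: "2 \<le> length \<rho>" "look \<rho> 1 = j" "j < N" and NE: "stable \<rho> NE N" and m: "m \<le> N"
    and placed: "placed (length as) N (length \<rho>) acc"
  defines "\<Phi> \<equiv> gval \<rho> S (summand_gen \<sigma> NE m i (length \<rho>) cur acc \<eta> \<xi> r)"
  shows "models w \<Phi> \<longleftrightarrow> (\<forall>q \<le> j. w q = S 1 q) \<and> (\<forall>q < m. w q = (q = i)) \<and>
      marks (length as) \<rho> acc w \<and> (\<forall>q < N. offset (length as) cur \<le> q \<longrightarrow> \<not> w q) \<and>
      all_block (universe \<A>) (fst r)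
        (\<lambda>u. \<forall>C \<in> set (snd r). sat_clause \<A> u (so_value as \<xi> w) C) (fo_value as \<rho> \<eta>)" (is ?goal1)
    and "\<Phi> \<subseteq> literals N \<times> literals N" (is ?goal2)
proof -
  let ?d = "length \<rho>" and ?n = "length as"
  have acc: "k < length \<rho> \<and> offset (length as) ks + length as \<le> N" if "(ks, k) \<in> set acc" for ks k
    using placed that by (auto simp: placed_def)
  have n: "look \<rho> 0 = ?n" using fits by (simp add: fits_def)
  have "0 < length \<rho>" using \<rho>(1) by linarith
  then have d0: "look (\<rho> @ [q]) 0 = ?n" for q by (simp only: look_snoc_less n)
  have dd: "look (\<rho> @ [q]) ?d = q" for q by (simp add: look_snoc)
  have ne: "aval \<rho> NE = N" using NE by (rule stable_aval)
  define g1 where "g1 = GAny (Add (Lev 1) (Cst 1)) (force (BRead 1 (Lev ?d)) (Lev ?d))"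
  define g2 where "g2 = GAny (Cst m) (force (BEq (Lev ?d) (Cst i)) (Lev ?d))"
  define g3 where "g3 = (\<lambda>(ks, k). GAny (Lev 0)
    (force (BEq (Lev ?d) (Lev k)) (Add (offset_exp ks) (Lev ?d))))"
  define g4 where "g4 = GAny NE (GEmit (BNot (BLess (Lev ?d) (offset_exp cur)))
    (False, Lev ?d) (False, Lev ?d))"
  define g5 where "g5 = matrix_gen \<sigma> ?d \<eta> \<xi> (snd r) (fst r)"
  have \<Phi>: "\<Phi> = gval \<rho> S g1 \<union> (gval \<rho> S g2 \<union> ((\<Union>p \<in> set acc. gval \<rho> S (g3 p)) \<union>
      (gval \<rho> S g4 \<union> gval \<rho> S g5)))"
    unfolding \<Phi>_def summand_gen_def g1_def g2_def g3_def g4_def g5_def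
    by (simp only: gval.simps union_gen_simps set_map UN_simps image_image)
  have j: "aval \<rho> (Add (Lev 1) (Cst 1)) = Suc j" using \<rho>(2) by simp
  have 1: "models w (gval \<rho> S g1) \<longleftrightarrow> (\<forall>q \<le> j. w q = S 1 q)"
    unfolding g1_def gval.simps(3) j by (simp add: dd Ball_def less_Suc_eq_le)
  have u1: "gval \<rho> S g1 \<subseteq> literals N \<times> literals N"
    unfolding g1_def gval.simps(3) j by (intro UN_least gval_force) (use \<rho>(3) in \<open>simp add: dd\<close>)
  have 2: "models w (gval \<rho> S g2) \<longleftrightarrow> (\<forall>q < m. w q = (q = i))"
    unfolding g2_def gval.simps(3) by (simp add: dd Ball_def)
  have u2: "gval \<rho> S g2 \<subseteq> literals N \<times> literals N"
    unfolding g2_def gval.simps(3) by (intro UN_least gval_force) (use m in \<open>simp add: dd\<close>)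
  have g3: "(models w (gval \<rho> S (g3 (ks, k))) \<longleftrightarrow> (\<forall>q < ?n. w (offset ?n ks + q) = (q = look \<rho> k))) \<and>
    gval \<rho> S (g3 (ks, k)) \<subseteq> literals N \<times> literals N" if "(ks, k) \<in> set acc" for ks k
  proof -
    have k: "look (\<rho> @ [q]) k = look \<rho> k" for q using acc[OF that] by (simp add: look_snoc)
    have lt: "offset ?n ks + q < N" if "q < ?n" for q using acc[OF \<open>(ks, k) \<in> set acc\<close>] that by simp
    have "gval \<rho> S (g3 (ks, k)) \<subseteq> literals N \<times> literals N"
      unfolding g3_def prod.case gval.simps
      by (intro UN_least gval_force) (use lt in \<open>simp add: dd d0 n\<close>)
    then show ?thesis unfolding g3_def prod.case gval.simps
      by (simp add: dd d0 n k Ball_def)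
  qed
  have 3: "models w (\<Union>p \<in> set acc. gval \<rho> S (g3 p)) \<longleftrightarrow> marks ?n \<rho> acc w"
    "(\<Union>p \<in> set acc. gval \<rho> S (g3 p)) \<subseteq> literals N \<times> literals N"
  proof -
    show "models w (\<Union>p \<in> set acc. gval \<rho> S (g3 p)) \<longleftrightarrow> marks ?n \<rho> acc w"
      unfolding models_simps marks_def by (rule ball_cong[OF refl]) (use g3 in \<open>auto simp del: split_paired_All\<close>)
    show "(\<Union>p \<in> set acc. gval \<rho> S (g3 p)) \<subseteq> literals N \<times> literals N"
    proof (rule UN_least)
      fix p assume p: "p \<in> set acc"
      obtain ks k where "p = (ks, k)" by fastforce
      then show "gval \<rho> S (g3 p) \<subseteq> literals N \<times> literals N" using g3[of ks k] p by blast
    qed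
  qed
  have 4: "models w (gval \<rho> S g4) \<longleftrightarrow> (\<forall>q < N. offset ?n cur \<le> q \<longrightarrow> \<not> w q)"
    "gval \<rho> S g4 \<subseteq> literals N \<times> literals N"
    unfolding g4_def gval.simps ne
    by (auto simp: dd d0 lit_true_def not_less)
  note 5 = matrix_gen_correct[where S = S and w = w and ys = "fst r", OF as I Cs \<xi> _ fits, folded g5_def]
  have N: "0 < N" using \<rho>(3) by simp
  show ?goal1
    unfolding \<Phi> models_simps(2) 1 2 3(1) 4(1) conjunct1[OF 5[OF N]] ..
  show ?goal2
    unfolding \<Phi> by (intro Un_least u1 u2 3(2) 4(2) conjunct2[OF 5[OF N]])
qed

lemma greads_summand_gen: "greads (summand_gen \<sigma> NE m i d cur acc \<eta> \<xi> r) \<subseteq> {0, 1}"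
  using greads_matrix_gen[of \<sigma> d \<eta> \<xi> "snd r" "fst r"]
  by (auto simp: summand_gen_def split: prod.splits)

section \<open>The extension test and the theorem\<close>

fun blocks :: "quantifier list \<Rightarrow> nat list" where
  "blocks [] = []"
| "blocks (CFO x # bs) = 1 # blocks bs"
| "blocks (CSO X # bs) = arity X # blocks bs"
| "blocks (EFO x # bs) = blocks bs"

lemma witness_zero:
  "witness \<A> as r bs v V w \<Longrightarrow> offset (length as) (blocks bs) \<le> q \<Longrightarrow> \<not> w q"
proof (induction bs arbitrary: v V w q)
  case (Cons b bs)
  let ?n = "length as"
  show ?case
  proof (cases b)
    case (CFO x)
    then obtain i where "witness \<A> as r bs (v(x := as ! i)) V (\<lambda>q. w (?n + q))"
      using Cons.prems(1) by auto
    from Cons.IH[OF this, of "q - ?n"] show ?thesis using Cons.prems(2) CFO by simp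
  next
    case (CSO X)
    let ?k = "?n ^ arity X"
    have "witness \<A> as r bs v (V(X := decode as (arity X) w)) (\<lambda>q. w (?k + q))"
      using Cons.prems(1) CSO by simp
    from Cons.IH[OF this, of "q - ?k"] show ?thesis using Cons.prems(2) CSO by simp
  next
    case (EFO x)
    then obtain i where "witness \<A> as r bs (v(x := as ! i)) V w"
      using Cons.prems(1) by auto
    from Cons.IH[OF this] show ?thesis using Cons.prems(2) EFO by simp
  qed
qed simp

text \<open>First-order values are enumerated by loops; relations are merely assigned positions,
  since their bits are the unknowns of the 2-CNF formula. Both \<open>CFO\<close> and
  \<open>EFO\<close> become loops, but only \<open>CFO\<close> reserves a block and records it in
  \<open>acc\<close>.\<close>

fun summand_cmd :: "vocabulary \<Rightarrow> aexp \<Rightarrow> nat \<Rightarrow> nat \<Rightarrow> fo_var list \<times> clause list \<Rightarrow> nat \<Rightarrow> nat list \<Rightarrow>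
    (nat list \<times> nat) list \<Rightarrow> (fo_var \<Rightarrow> nat) \<Rightarrow> (so_var \<Rightarrow> nat list option) \<Rightarrow> quantifier list \<Rightarrow> cmd" where
  "summand_cmd \<sigma> NE m i r d cur acc \<eta> \<xi> [] = two_sat_cmd NE d (summand_gen \<sigma> NE m i d cur acc \<eta> \<xi> r)"
| "summand_cmd \<sigma> NE m i r d cur acc \<eta> \<xi> (CFO x # bs) =
     For (Lev 0) (summand_cmd \<sigma> NE m i r (d + 1) (cur @ [1]) ((cur, d) # acc) (\<eta>(x := d)) \<xi> bs)"
| "summand_cmd \<sigma> NE m i r d cur acc \<eta> \<xi> (CSO X # bs) =
     summand_cmd \<sigma> NE m i r d (cur @ [arity X]) acc \<eta> (\<xi>(X := Some cur)) bs"
| "summand_cmd \<sigma> NE m i r d cur acc \<eta> \<xi> (EFO x # bs) =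
     For (Lev 0) (summand_cmd \<sigma> NE m i r (d + 1) cur acc (\<eta>(x := d)) \<xi> bs)"

definition same_input :: "arrays \<Rightarrow> arrays \<Rightarrow> bool" where
  "same_input S S' \<longleftrightarrow> (\<forall>A. A \<notin> {2, 3} \<longrightarrow> S' A = S A)"

lemma same_input_simps: "same_input S S' \<Longrightarrow> S' 0 = S 0 \<and> S' 1 = S 1 \<and> S' 4 = S 4"
  by (simp add: same_input_def)

lemma same_input_trans: "same_input S S' \<Longrightarrow> same_input S' S'' \<Longrightarrow> same_input S S''"
  by (simp add: same_input_def)

lemma same_input_refl: "same_input S S"
  by (simp add: same_input_def)

text \<open>With results collected by disjunction, a loop computes an existential
  quantifier.\<close>

lemma exec_For_disj:
  assumes "\<And>k S'. k < aval \<rho> e \<Longrightarrow> same_input S S' \<Longrightarrow>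
     (exec (\<rho> @ [k]) c S' 3 0 \<longleftrightarrow> S' 3 0 \<or> Q k) \<and> same_input S' (exec (\<rho> @ [k]) c S')"
  shows "(exec \<rho> (For e c) S 3 0 \<longleftrightarrow> S 3 0 \<or> (\<exists>k < aval \<rho> e. Q k)) \<and> same_input S (exec \<rho> (For e c) S)"
proof -
  let ?P = "\<lambda>i S'. (S' 3 0 \<longleftrightarrow> S 3 0 \<or> (\<exists>k < i. Q k)) \<and> same_input S S'"
  show ?thesis
  proof (rule exec_For_invariant[where P = ?P])
    show "?P 0 S" by (simp add: same_input_refl)
    fix i S' assume i: "i < aval \<rho> e" and P: "?P i S'"
    note s = assms[OF i conjunct2[OF P]]
    have "(\<exists>k < Suc i. Q k) \<longleftrightarrow> (\<exists>k < i. Q k) \<or> Q i" by (metis less_Suc_eq)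
    then show "?P (Suc i) (exec (\<rho> @ [i]) c S')"
      using conjunct1[OF s] conjunct1[OF P] same_input_trans[OF conjunct2[OF P] conjunct2[OF s]] by simp
  qed
qed

text \<open>The statement decided halfway: \<open>w\<close> is a complete candidate, the variables
  passed so far are described by \<open>\<eta>\<close>, \<open>\<xi>\<close> and \<open>acc\<close>,
  and \<open>bs\<close> is to be satisfied by the bits behind \<open>cur\<close>.\<close>

definition extendable :: "'a rel_structure \<Rightarrow> 'a list \<Rightarrow> nat \<Rightarrow> nat \<Rightarrow> nat \<Rightarrow> (nat \<Rightarrow> bool) \<Rightarrow>
    fo_var list \<times> clause list \<Rightarrow> nat list \<Rightarrow> nat list \<Rightarrow> (nat list \<times> nat) list \<Rightarrow> (fo_var \<Rightarrow> nat) \<Rightarrow>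
    (so_var \<Rightarrow> nat list option) \<Rightarrow> quantifier list \<Rightarrow> bool" where
  "extendable \<A> as m i j u r \<rho> cur acc \<eta> \<xi> bs \<longleftrightarrow>
     (\<exists>w. (\<forall>q \<le> j. w q = u q) \<and> (\<forall>q < m. w q = (q = i)) \<and> marks (length as) \<rho> acc w \<and>
        witness \<A> as r bs (fo_value as \<rho> \<eta>) (so_value as \<xi> w)
          (\<lambda>q. w (offset (length as) cur + q)))"

text \<open>A witness must vanish from \<open>N\<close> on, where the formula says nothing; any
  model can be cut off there.\<close>

lemma models_restrict:
  assumes "\<Phi> \<subseteq> literals N \<times> literals N"
  shows "models (\<lambda>q. q < N \<and> w q) \<Phi> \<longleftrightarrow> models w \<Phi>"
proof -
  have "lit_true (\<lambda>q. q < N \<and> w q) l = lit_true w l" if "l < 2 * N" for l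
    using that by (auto simp: lit_true_def)
  then show ?thesis using assms unfolding models_def by (intro ball_cong) auto
qed

text \<open>The choice of a first-order value commutes with the choice of \<open>w\<close>, which
  lets loops stand outside the 2-SAT test. For \<open>CSO\<close> nothing is executed: the relation
  is decoded from \<open>w\<close> itself at position \<open>cur\<close>.\<close>

lemma exec_summand_cmd:
  assumes as: "lists_universe \<A> as" and Cs: "\<forall>C \<in> set (snd r). is_2SAT_clause \<sigma> C" and m: "m \<le> N"
  shows "encodes \<sigma> \<A> as (S 0) \<Longrightarrow> fits (length as) \<rho> \<eta> \<Longrightarrow> in_range (length as) N \<xi> \<Longrightarrow>
    2 \<le> length \<rho> \<Longrightarrow> look \<rho> 1 = j \<Longrightarrow> j < N \<Longrightarrow> stable \<rho> NE N \<Longrightarrow>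
    placed (length as) N (length \<rho>) acc \<Longrightarrow>
    offset (length as) (cur @ blocks bs) \<le> N \<Longrightarrow>
    (exec \<rho> (summand_cmd \<sigma> NE m i r (length \<rho>) cur acc \<eta> \<xi> bs) S 3 0 \<longleftrightarrow>
      S 3 0 \<or> extendable \<A> as m i j (S 1) r \<rho> cur acc \<eta> \<xi> bs) \<and>
    same_input S (exec \<rho> (summand_cmd \<sigma> NE m i r (length \<rho>) cur acc \<eta> \<xi> bs) S)"
proof (induction bs arbitrary: \<rho> cur acc \<eta> \<xi> S)
  case Nil
  let ?n = "length as"
  define \<Phi> where "\<Phi> = gval \<rho> S (summand_gen \<sigma> NE m i (length \<rho>) cur acc \<eta> \<xi> r)"
  note c = summand_gen_correct[where cur = cur and i = i and S = S, OF as Nil.prems(1) Cs Nil.prems(3,2,4,5,6,7) m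
      Nil.prems(8), folded \<Phi>_def]
  note ex = exec_two_sat_cmd[where S = S, OF Nil.prems(7) greads_summand_gen c(2)[unfolded \<Phi>_def],
      folded \<Phi>_def]
  have "(\<exists>w. models w \<Phi>) \<longleftrightarrow> extendable \<A> as m i j (S 1) r \<rho> cur acc \<eta> \<xi> []"
  proof
    assume "\<exists>w. models w \<Phi>"
    then obtain w where "models w \<Phi>" by blast
    define w' where "w' = (\<lambda>q. q < N \<and> w q)"
    have w': "models w' \<Phi>"
      using \<open>models w \<Phi>\<close> unfolding w'_def by (rule iffD2[OF models_restrict[OF c(2)]])
    have "\<not> w' (offset ?n cur + q)" for q
      using w' unfolding c(1) by (cases "offset ?n cur + q < N") (auto simp: w'_def)
    then show "extendable \<A> as m i j (S 1) r \<rho> cur acc \<eta> \<xi> []"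
      using w' unfolding c(1) extendable_def witness.simps by blast
  next
    assume "extendable \<A> as m i j (S 1) r \<rho> cur acc \<eta> \<xi> []"
    then obtain w where w: "\<forall>q \<le> j. w q = S 1 q" "\<forall>q < m. w q = (q = i)" "marks ?n \<rho> acc w"
      "all_block (universe \<A>) (fst r)
        (\<lambda>u. \<forall>C \<in> set (snd r). sat_clause \<A> u (so_value as \<xi> w) C) (fo_value as \<rho> \<eta>)"
      "\<forall>q. \<not> w (offset ?n cur + q)"
      unfolding extendable_def witness.simps by blast
    have "\<not> w q" if "offset ?n cur \<le> q" for q using w(5) that by (metis le_add_diff_inverse)
    then have "models w \<Phi>" unfolding c(1) using w(1-4) by blast
    then show "\<exists>w. models w \<Phi>" by blast
  qed
  then show ?case using ex unfolding summand_cmd.simps same_input_def by blast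
next
  case (Cons b bs)
  let ?n = "length as" and ?d = "length \<rho>"
  have n: "aval \<rho> (Lev 0) = ?n" using Cons.prems(2) by (simp add: fits_def)
  have d: "length (\<rho> @ [k]) = ?d + 1" for k by simp
  have \<rho>: "2 \<le> length (\<rho> @ [k])" "look (\<rho> @ [k]) 1 = j" for k
    using Cons.prems(4,5) look_snoc_less[of 1 \<rho> k] by simp_all
  have marks: "marks ?n (\<rho> @ [k]) acc w \<longleftrightarrow> marks ?n \<rho> acc w" for k w
    unfolding marks_def
  proof (rule ball_cong[OF refl], clarify)
    fix ks l assume "(ks, l) \<in> set acc"
    then have "look (\<rho> @ [k]) l = look \<rho> l"
      using Cons.prems(8) by (intro look_snoc_less) (auto simp: placed_def)
    then show "(\<forall>q < ?n. w (offset ?n ks + q) = (q = look (\<rho> @ [k]) l)) \<longleftrightarrow>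
        (\<forall>q < ?n. w (offset ?n ks + q) = (q = look \<rho> l))" by simp
  qed
  let ?c = "\<lambda>x cur acc. summand_cmd \<sigma> NE m i r (?d + 1) cur acc (\<eta>(x := ?d)) \<xi> bs"
  let ?Q = "\<lambda>x cur acc k. extendable \<A> as m i j (S 1) r (\<rho> @ [k]) cur acc (\<eta>(x := ?d)) \<xi> bs"
  have loop: "(exec \<rho> (For (Lev 0) (?c x cur' acc')) S 3 0 \<longleftrightarrow> S 3 0 \<or> (\<exists>k < ?n. ?Q x cur' acc' k)) \<and>
      same_input S (exec \<rho> (For (Lev 0) (?c x cur' acc')) S)"
    if range: "offset ?n (cur' @ blocks bs) \<le> N" and acc: "placed ?n N (?d + 1) acc'"
    for x cur' acc'
    unfolding n[symmetric]
  proof (rule exec_For_disj)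
    fix k S' assume k: "k < aval \<rho> (Lev 0)" and S': "same_input S S'"
    have I: "encodes \<sigma> \<A> as (S' 0)" and eq1: "S' 1 = S 1"
      using Cons.prems(1) same_input_simps[OF S'] by simp_all
    show "(exec (\<rho> @ [k]) (?c x cur' acc') S' 3 0 \<longleftrightarrow> S' 3 0 \<or> ?Q x cur' acc' k) \<and>
        same_input S' (exec (\<rho> @ [k]) (?c x cur' acc') S')"
      by (rule Cons.IH[where S = S' and \<rho> = "\<rho> @ [k]" and cur = cur' and \<xi> = \<xi>, OF I
          fits_snoc[OF Cons.prems(2) k[unfolded n], of x] Cons.prems(3) \<rho> Cons.prems(6)
          stable_snoc[OF Cons.prems(7)] acc[folded d[of k]] range, unfolded d eq1])
  qed
  show ?case
  proof (cases b)
    case (CFO x)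
    have range: "offset ?n ((cur @ [1]) @ blocks bs) \<le> N" using Cons.prems(9) CFO by simp
    have acc: "placed ?n N (?d + 1) ((cur, ?d) # acc)"
      using Cons.prems(8) range by (auto simp: placed_def)
    have "marks ?n (\<rho> @ [k]) ((cur, ?d) # acc) w \<longleftrightarrow>
        (\<forall>q < ?n. w (offset ?n cur + q) = (q = k)) \<and> marks ?n \<rho> acc w" for k w
      using marks[of k w] by (simp add: marks_def look_snoc)
    then have "(\<exists>k < ?n. ?Q x (cur @ [1]) ((cur, ?d) # acc) k) \<longleftrightarrow>
        extendable \<A> as m i j (S 1) r \<rho> cur acc \<eta> \<xi> (b # bs)"
      unfolding extendable_def CFO witness.simps fo_value_snoc[OF Cons.prems(2)]
        offset_simps power_one_right add_0_right add.assoc by blast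
    then show ?thesis using loop[OF range acc, of x] unfolding CFO summand_cmd.simps by simp
  next
    case (CSO X)
    have so: "so_value as (\<xi>(X := Some cur)) w =
        (so_value as \<xi> w)(X := decode as (arity X) (\<lambda>q. w (offset ?n cur + q)))" for w
      by (auto simp: so_value_def fun_eq_iff)
    have range: "offset ?n ((cur @ [arity X]) @ blocks bs) \<le> N" using Cons.prems(9) CSO by simp
    then have "in_range ?n N (\<xi>(X := Some cur))"
      using Cons.prems(3) by (auto simp: in_range_def)
    note IH = Cons.IH[where S = S and cur = "cur @ [arity X]", OF Cons.prems(1,2) this Cons.prems(4,5,6,7,8) range]
    have ext: "extendable \<A> as m i j (S 1) r \<rho> (cur @ [arity X]) acc \<eta> (\<xi>(X := Some cur)) bs \<longleftrightarrow>
        extendable \<A> as m i j (S 1) r \<rho> cur acc \<eta> \<xi> (b # bs)"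
      unfolding extendable_def CSO witness.simps so offset_simps add_0_right add.assoc by blast
    show ?thesis unfolding ext[symmetric] unfolding CSO summand_cmd.simps by (rule IH)
  next
    case (EFO x)
    have range: "offset ?n (cur @ blocks bs) \<le> N" using Cons.prems(9) EFO by simp
    have acc: "placed ?n N (?d + 1) acc" using Cons.prems(8) by (auto simp: placed_def)
    have "(\<exists>k < ?n. ?Q x cur acc k) \<longleftrightarrow> extendable \<A> as m i j (S 1) r \<rho> cur acc \<eta> \<xi> (b # bs)"
      unfolding extendable_def EFO witness.simps fo_value_snoc[OF Cons.prems(2)] marks by blast
    then show ?thesis using loop[OF range acc, of x] unfolding EFO summand_cmd.simps by simp
  qed
qed

text \<open>The tag takes one bit per summand. All summands begin right behind it and may overlap;
  the sum of their lengths serves as a common bound, as expressions have no maximum.\<close>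

definition layout :: "summand list \<Rightarrow> nat list" where
  "layout ss = replicate (length ss) 0 @ concat (map (\<lambda>s. blocks (fst s)) ss)"

text \<open>Three levels are bound at this point: the size, the position of the current bit, and a
  constant 0 for variables that are not bound.\<close>

definition tagged_cmd :: "vocabulary \<Rightarrow> summand list \<Rightarrow> nat \<Rightarrow> cmd" where
  "tagged_cmd \<sigma> ss i = summand_cmd \<sigma> (offset_exp (layout ss)) (length ss) i (snd (ss ! i)) 3
     (replicate (length ss) 0) [] (\<lambda>_. 2) (\<lambda>_. None) (fst (ss ! i))"

text \<open>
  The loop \<open>For (Cst 1)\<close> runs once and binds level \<open>2\<close> to \<open>0\<close>; this is the value of the free
  first-order variables.
\<close>

definition test_cmd :: "vocabulary \<Rightarrow> summand list \<Rightarrow> cmd" where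
  "test_cmd \<sigma> ss = Then (Assign 3 (Cst 0) bfalse)
     (For (Cst 1) (foldr Then (map (tagged_cmd \<sigma> ss) [0..<length ss]) Nop))"

lemma offset_member: "k \<in> set ks \<Longrightarrow> offset n k \<le> offset n (concat ks)"
  by (induction ks) auto

lemma extension_test_cmd:
  assumes as: "lists_universe \<A> as" and n: "0 < length as"
    and Cs: "\<And>s C. s \<in> set ss \<Longrightarrow> C \<in> set (snd (snd s)) \<Longrightarrow> is_2SAT_clause \<sigma> C"
    and I: "encodes \<sigma> \<A> as I"
  shows "extension_test (test_cmd \<sigma> ss) (length as) I
    (tagged_witnesses \<A> as (\<lambda>_. as ! 0) (\<lambda>_. {}) ss) (offset (length as) (layout ss))"
  unfolding extension_test_def
proof (intro allI impI)
  fix S :: arrays and j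
  let ?n = "length as" and ?m = "length ss"
  let ?N = "offset ?n (layout ss)"
  let ?\<rho> = "[?n, j, 0]"
  assume S: "S 0 = I" and j: "j < ?N"
  define S0 where "S0 = S(3 := (S 3)(0 := False))"
  let ?ext = "\<lambda>i. extendable \<A> as ?m i j (S 1) (snd (ss ! i)) ?\<rho> (replicate ?m 0) [] (\<lambda>_. 2)
      (\<lambda>_. None) (fst (ss ! i))"
  have one: "(exec ?\<rho> (tagged_cmd \<sigma> ss i) S' 3 0 \<longleftrightarrow> S' 3 0 \<or> ?ext i) \<and>
      same_input S' (exec ?\<rho> (tagged_cmd \<sigma> ss i) S')"
    if "i < ?m" "S' 0 = S 0" "S' 1 = S 1" for i S'
  proof -
    have "ss ! i \<in> set ss" using that(1) by simp
    then have "offset ?n (blocks (fst (ss ! i))) \<le> offset ?n (concat (map (\<lambda>s. blocks (fst s)) ss))"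
      by (intro offset_member) simp
    then have range: "offset ?n (replicate ?m 0 @ blocks (fst (ss ! i))) \<le> ?N"
      by (simp add: layout_def)
    have C: "\<forall>C \<in> set (snd (snd (ss ! i))). is_2SAT_clause \<sigma> C" using Cs \<open>ss ! i \<in> set ss\<close> by blast
    have m: "?m \<le> ?N" by (simp add: layout_def)
    have I': "encodes \<sigma> \<A> as (S' 0)" using I S that(2) by simp
    have fits: "fits ?n ?\<rho> (\<lambda>_. 2)" using n by (simp add: fits_def look_def)
    have st: "stable ?\<rho> (offset_exp (layout ss)) ?N" by (simp add: stable_def look_def)
    have l: "length ?\<rho> = 3" "2 \<le> length ?\<rho>" "look ?\<rho> 1 = j" by (simp_all add: look_def)
    have r: "in_range ?n ?N (\<lambda>_. None)" by (simp add: in_range_def)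
    have acc: "placed ?n ?N (length ?\<rho>) []" by (simp add: placed_def)
    show ?thesis
      using exec_summand_cmd[where i = i and S = S' and \<rho> = ?\<rho> and acc = "[]", OF as C m I' fits r l(2,3) j st acc range]
      unfolding l(1) that(3) tagged_cmd_def by simp
  qed
  have seq: "(exec ?\<rho> (foldr Then (map (tagged_cmd \<sigma> ss) is) Nop) S' 3 0 \<longleftrightarrow>
      S' 3 0 \<or> (\<exists>i \<in> set is. ?ext i)) \<and>
      same_input S' (exec ?\<rho> (foldr Then (map (tagged_cmd \<sigma> ss) is) Nop) S')"
    if "set is \<subseteq> {..<?m}" "S' 0 = S 0" "S' 1 = S 1" for "is" S'
    using that
  proof (induction "is" arbitrary: S')
    case Nil
    then show ?case by (simp add: same_input_refl)
  next
    case (Cons i "is")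
    let ?S = "exec ?\<rho> (tagged_cmd \<sigma> ss i) S'"
    have 1: "(?S 3 0 \<longleftrightarrow> S' 3 0 \<or> ?ext i) \<and> same_input S' ?S" using Cons.prems by (intro one) auto
    have eq: "?S 0 = S 0" "?S 1 = S 1" using same_input_simps[OF conjunct2[OF 1]] Cons.prems by simp_all
    have "set is \<subseteq> {..<?m}" using Cons.prems(1) by simp
    note 2 = Cons.IH[OF this eq]
    show ?case using 1 2 same_input_trans[OF conjunct2[OF 1] conjunct2[OF 2]] by simp
  qed
  have S0: "S0 0 = S 0" "S0 1 = S 1" "S0 4 = S 4" by (simp_all add: S0_def)
  have e: "exec [?n, j] (test_cmd \<sigma> ss) S = exec ?\<rho> (foldr Then (map (tagged_cmd \<sigma> ss) [0..<?m]) Nop) S0"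
    by (simp add: test_cmd_def S0_def)
  have "set [0..<?m] \<subseteq> {..<?m}" by auto
  note sq = seq[OF this S0(1,2)]
  have "exec [?n, j] (test_cmd \<sigma> ss) S 3 0 \<longleftrightarrow> S0 3 0 \<or> (\<exists>i \<in> set [0..<?m]. ?ext i)"
    unfolding e by (rule conjunct1[OF sq])
  moreover have "\<not> S0 3 0" by (simp add: S0_def)
  ultimately have T1: "exec [?n, j] (test_cmd \<sigma> ss) S 3 0 \<longleftrightarrow> (\<exists>i < ?m. ?ext i)"
    by (metis atLeastLessThan_iff le0 set_upt)
  have T2: "same_input S0 (exec [?n, j] (test_cmd \<sigma> ss) S)"
    unfolding e by (rule conjunct2[OF sq])
  have v: "fo_value as ?\<rho> (\<lambda>_. 2) = (\<lambda>_. as ! 0)" by (simp add: fo_value_def look_def)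
  have V: "so_value as (\<lambda>_. None) w = (\<lambda>_. {})" for w by (simp add: so_value_def)
  have "(\<exists>i < ?m. ?ext i) \<longleftrightarrow>
      (\<exists>w \<in> tagged_witnesses \<A> as (\<lambda>_. as ! 0) (\<lambda>_. {}) ss. \<forall>q \<le> j. w q = S 1 q)"
    unfolding extendable_def v V tagged_witnesses_def witnesses_def mem_Collect_eq
    by (simp add: marks_def) blast
  then show "(exec [?n, j] (test_cmd \<sigma> ss) S 3 0 \<longleftrightarrow>
      (\<exists>w \<in> tagged_witnesses \<A> as (\<lambda>_. as ! 0) (\<lambda>_. {}) ss. \<forall>q \<le> j. w q = S 1 q)) \<and>
      (\<forall>A \<in> {0, 1, 4}. exec [?n, j] (test_cmd \<sigma> ss) S A = S A)"
    using T1 same_input_simps[OF T2] S0 by simp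
qed

lemma tagged_witnesses_zero:
  assumes "w \<in> tagged_witnesses \<A> as v V ss" "offset (length as) (layout ss) \<le> q"
  shows "\<not> w q"
proof -
  let ?n = "length as" and ?m = "length ss"
  obtain i where i: "i < ?m" "witness \<A> as (snd (ss ! i)) (fst (ss ! i)) v V (\<lambda>q. w (?m + q))"
    using assms(1) by (auto simp: tagged_witnesses_def witnesses_def)
  have "offset ?n (blocks (fst (ss ! i))) \<le> offset ?n (concat (map (\<lambda>s. blocks (fst s)) ss))"
    using i(1) by (intro offset_member) simp
  then have "?m \<le> q" "offset ?n (blocks (fst (ss ! i))) \<le> q - ?m" using assms(2) by (simp_all add: layout_def)
  then show ?thesis using witness_zero[OF i(2), of "q - ?m"] by simp
qed

section \<open>The string encoding of an ordered structure\<close>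

lemma sorted_list_exists:
  assumes "finite F" "F \<subseteq> A" "trans r" "total_on A r" "refl_on A r"
  shows "\<exists>as. set as = F \<and> distinct as \<and> sorted_wrt (\<lambda>a b. (a, b) \<in> r) as"
  using assms(1,2)
proof (induction F rule: finite_induct)
  case empty
  show ?case by (intro exI[of _ "[]"]) simp
next
  case (insert x F)
  then obtain as where as: "set as = F" "distinct as" "sorted_wrt (\<lambda>a b. (a, b) \<in> r) as" by auto
  let ?l = "filter (\<lambda>a. (a, x) \<in> r) as" and ?u = "filter (\<lambda>a. (a, x) \<notin> r) as"
  have u: "(x, a) \<in> r" if "a \<in> F" "(a, x) \<notin> r" for a
  proof -
    have "a \<in> A" "x \<in> A" "a \<noteq> x" using insert.prems insert.hyps(2) that by auto
    then show ?thesis using assms(4) that(2) unfolding total_on_def by blast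
  qed
  have "(a, b) \<in> r" if "a \<in> set ?l" "b \<in> set ?u" for a b
  proof (rule transD[OF assms(3)])
    show "(a, x) \<in> r" using that(1) by simp
    show "(x, b) \<in> r" using that(2) as(1) u by simp
  qed
  then have "sorted_wrt (\<lambda>a b. (a, b) \<in> r) (?l @ x # ?u)"
    using as u by (simp add: sorted_wrt_append sorted_wrt_filter)
  moreover have "set (?l @ x # ?u) = insert x F" "distinct (?l @ x # ?u)"
    using as insert.hyps(2) by auto
  ultimately show ?case by blast
qed

lemma sorted_list_unique:
  assumes "antisym r"
  shows "set as = set bs \<Longrightarrow> distinct as \<Longrightarrow> distinct bs \<Longrightarrow> sorted_wrt (\<lambda>a b. (a, b) \<in> r) as \<Longrightarrow>
    sorted_wrt (\<lambda>a b. (a, b) \<in> r) bs \<Longrightarrow> as = bs"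
proof (induction as arbitrary: bs)
  case (Cons a as)
  then obtain b bs' where bs: "bs = b # bs'" by (cases bs) auto
  have "a = b"
  proof (rule ccontr)
    assume "a \<noteq> b"
    then have "a \<in> set bs'" "b \<in> set as" using Cons.prems(1) bs by auto
    then have "(b, a) \<in> r" "(a, b) \<in> r" using Cons.prems(4,5) bs by simp_all
    then show False using assms \<open>a \<noteq> b\<close> by (meson antisymD)
  qed
  moreover from this have "set as = set bs'" using Cons.prems(1,2,3) bs by auto
  ultimately show ?case using Cons.IH[of bs'] Cons.prems bs by simp
qed simp

text \<open>Existence and uniqueness of the sorted list justify the definite description in
  \<open>enumeration\<close>.\<close>

lemma lists_universe_enumeration:
  assumes "\<A> \<in> ordered_structures \<sigma>"
  shows "lists_universe \<A> (enumeration \<A>)"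
proof -
  let ?P = "\<lambda>as. set as = universe \<A> \<and> distinct as \<and> sorted_wrt (\<lambda>a b. (a, b) \<in> order_of \<A>) as"
  have fin: "finite (universe \<A>)" and lin: "linear_order_on (universe \<A>) (order_of \<A>)"
    using assms by (simp_all add: ordered_structures_def)
  then have r: "trans (order_of \<A>)" "total_on (universe \<A>) (order_of \<A>)" "antisym (order_of \<A>)"
    "refl_on (universe \<A>) (order_of \<A>)"
    by (simp_all add: order_on_defs)
  have "\<exists>as. ?P as" using sorted_list_exists[OF fin order_refl r(1,2,4)] .
  then have "\<exists>!as. ?P as" using sorted_list_unique[OF r(3)] by (metis (no_types, lifting))
  from theI'[OF this] show ?thesis unfolding enumeration_def lists_universe_def by blast
qed

lemma nth_concat_equal:
  "(\<And>a. length (g a) = l) \<Longrightarrow> i < length xs \<Longrightarrow> h < l \<Longrightarrow>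
    concat (map g xs) ! (i * l + h) = g (xs ! i) ! h"
proof (induction xs arbitrary: i)
  case (Cons x xs)
  show ?case
  proof (cases i)
    case 0
    then show ?thesis using Cons.prems by (simp add: nth_append)
  next
    case (Suc i')
    have "concat (map g (x # xs)) ! (i * l + h) = concat (map g xs) ! (i' * l + h)"
      using Cons.prems Suc by (simp add: nth_append)
    then show ?thesis using Cons.IH[of i'] Cons.prems Suc by simp
  qed
qed simp

lemma length_product_lists_replicate: "length (product_lists (replicate k as)) = length as ^ k"
  by (induction k) (simp_all add: length_concat comp_def sum_list_triv)

text \<open>\<open>product_lists\<close> lets the first component vary slowest, so it is the most
  significant digit of the rank.\<close>

lemma nth_product_lists:
  "is \<in> indices (length as) k \<Longrightarrow>
    product_lists (replicate k as) ! horner (length as) is = map ((!) as) is"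
proof (induction k arbitrary: "is")
  case 0
  then show ?case by (simp add: indices_def)
next
  case (Suc k)
  let ?n = "length as" and ?P = "product_lists (replicate k as)"
  obtain i js where "is": "is = i # js" "i < ?n" "js \<in> indices ?n k"
    using Suc.prems by (cases "is") (auto simp: indices_def)
  have len: "length js = k" using "is"(3) by (simp add: indices_def)
  have P: "length ?P = ?n ^ k" by (rule length_product_lists_replicate)
  have "product_lists (replicate (Suc k) as) = concat (map (\<lambda>a. map ((#) a) ?P) as)" by simp
  then have "product_lists (replicate (Suc k) as) ! horner ?n is =
      concat (map (\<lambda>a. map ((#) a) ?P) as) ! (i * ?n ^ k + horner ?n js)"
    by (simp add: "is"(1) horner_Cons len)
  also have "\<dots> = map ((#) (as ! i)) ?P ! horner ?n js"
    using "is"(2) horner_less[OF "is"(3)] by (intro nth_concat_equal) (simp_all add: P)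
  also have "\<dots> = map ((!) as) is"
    using Suc.IH[OF "is"(3)] horner_less[OF "is"(3)] by (simp add: P "is"(1))
  finally show ?case .
qed

lemma nth_concat_blocks:
  assumes "\<And>i. i < length ks \<Longrightarrow> length (f i) = n ^ (ks ! i)" "i < length ks" "h < n ^ (ks ! i)"
  shows "offset n (take i ks) + h < length (concat (map f [0..<length ks]))" (is ?goal1)
    and "concat (map f [0..<length ks]) ! (offset n (take i ks) + h) = f i ! h"
proof -
  have "length (concat (map f [0..<i])) = offset n (take i ks)" if "i \<le> length ks" for i
    using that
  proof (induction i)
    case (Suc i)
    then show ?case using assms(1)[of i] by (simp add: take_Suc_conv_app_nth)
  qed simp
  then have len: "length (concat (map f [0..<i])) = offset n (take i ks)" using assms(2) by simp
  have "[0..<length ks] = [0..<i] @ i # [Suc i..<length ks]"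
    using upt_add_eq_append[of 0 i "length ks - i"] assms(2) by (simp add: upt_conv_Cons)
  then have split: "concat (map f [0..<length ks]) =
      concat (map f [0..<i]) @ f i @ concat (map f [Suc i..<length ks])" by simp
  have "h < length (f i)" using assms by simp
  then show ?goal1
    "concat (map f [0..<length ks]) ! (offset n (take i ks) + h) = f i ! h"
    unfolding split using len by (simp_all add: nth_append)
qed

text \<open>Links the string to what the machine assumes of it: the size is the number of zeros
  before the first one, and the bit for a tuple lies at the offset of its block plus its
  rank.\<close>

lemma encode_correct:
  assumes A: "\<A> \<in> ordered_structures \<sigma>"
  defines "as \<equiv> enumeration \<A>" and "x \<equiv> encode \<sigma> \<A>"
  shows "length (takeWhile Not x) = length as"
    and "encodes \<sigma> \<A> as (\<lambda>i. i < length x \<and> x ! i)" (is ?goal2)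
proof -
  have as: "lists_universe \<A> as" unfolding as_def by (rule lists_universe_enumeration[OF A])
  then have n: "card (universe \<A>) = length as" by (metis distinct_card lists_universe_def)
  let ?n = "length as"
  define f where "f = (\<lambda>i. map (\<lambda>t. t \<in> interp \<A> i) (product_lists (replicate (\<sigma> ! i) as)))"
  define y where "y = concat (map f [0..<length \<sigma>])"
  have x: "x = replicate ?n False @ True # y"
    by (simp add: x_def encode_def n y_def f_def as_def)
  show "length (takeWhile Not x) = ?n" unfolding x by (simp add: takeWhile_append)
  show ?goal2
    unfolding encodes_def
  proof (intro allI impI ballI)
    fix i "is" assume i: "i < length \<sigma>" and "is": "is \<in> indices ?n (\<sigma> ! i)"
    let ?h = "horner ?n is"
    have h: "?h < ?n ^ (\<sigma> ! i)" by (rule horner_less[OF "is"])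
    have f: "length (f i) = ?n ^ (\<sigma> ! i)" for i by (simp add: f_def length_product_lists_replicate)
    note y = nth_concat_blocks[where f = f, OF f i h, folded y_def]
    have "f i ! ?h \<longleftrightarrow> map ((!) as) is \<in> interp \<A> i"
      using h nth_product_lists[OF "is"] by (simp add: f_def length_product_lists_replicate)
    then show "offset ?n (1 # 0 # take i \<sigma>) + ?h < length x \<and> x ! (offset ?n (1 # 0 # take i \<sigma>) + ?h) \<longleftrightarrow>
        map ((!) as) is \<in> interp \<A> i"
      unfolding x using y by (simp add: nth_append)
  qed
qed

lemma summands_2SAT:
  "is_SigmaQSO_Sigma2_2SAT \<sigma> \<alpha> \<Longrightarrow> s \<in> set (summands \<alpha>) \<Longrightarrow> C \<in> set (snd (snd s)) \<Longrightarrow> is_2SAT_clause \<sigma> C"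
proof (induction \<alpha> arbitrary: s)
  case (Form \<phi>)
  then show ?case by (cases \<phi>) auto
qed (auto split: if_splits)

theorem theorem3:
  fixes \<sigma> :: vocabulary
  assumes "ordered_vocabulary \<sigma>"
  shows "(SigmaQSO_Sigma2_2SAT \<sigma> :: ('a rel_structure \<Rightarrow> nat) set) \<subseteq> on_encodings \<sigma> TotP"
proof
  fix F :: "'a rel_structure \<Rightarrow> nat"
  assume "F \<in> SigmaQSO_Sigma2_2SAT \<sigma>"
  then obtain \<alpha> where F: "F = counting_function \<alpha>" and \<alpha>: "is_SigmaQSO_Sigma2_2SAT \<sigma> \<alpha>" "sentence \<alpha>"
    by (auto simp: SigmaQSO_Sigma2_2SAT_def)
  define ss where "ss = summands (Plus (Const 1) \<alpha>)"
  have Cs: "is_2SAT_clause \<sigma> C" if "s \<in> set ss" "C \<in> set (snd (snd s))" for s C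
    using summands_2SAT[of \<sigma> "Plus (Const 1) \<alpha>" s C] \<alpha>(1) that by (simp add: ss_def)
  let ?NE = "offset_exp (layout ss)"
  show "F \<in> on_encodings \<sigma> TotP"
  proof (rule search_machine[where NE = ?NE and T = "test_cmd \<sigma> ss"])
    fix M
    assume M: "ntm M" "polynomial_time M"
    "\<And>x n W. n = length (takeWhile Not x) \<Longrightarrow>
       extension_test (test_cmd \<sigma> ss) n (\<lambda>i. i < length x \<and> x ! i) W (aval [n] ?NE) \<Longrightarrow> finite W \<Longrightarrow>
       W \<noteq> {} \<Longrightarrow> (\<And>w q. w \<in> W \<Longrightarrow> aval [n] ?NE \<le> q \<Longrightarrow> \<not> w q) \<Longrightarrow> tot M x = card W - 1"
    have "F \<A> = tot M (encode \<sigma> \<A>)" if A: "\<A> \<in> ordered_structures \<sigma>" for \<A>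
    proof -
      define as where "as = enumeration \<A>"
      let ?n = "length as" and ?x = "encode \<sigma> \<A>"
      have as: "lists_universe \<A> as" unfolding as_def by (rule lists_universe_enumeration[OF A])
      have "set as \<noteq> {}" using A as by (simp add: ordered_structures_def lists_universe_def)
      then have n: "0 < ?n" by simp
      note enc = encode_correct[OF A, folded as_def]
      let ?W = "tagged_witnesses \<A> as (\<lambda>_. as ! 0) (\<lambda>_. {}) ss"
      have N: "aval [?n] ?NE = offset ?n (layout ss)" by (simp add: look_def)
      note ev = eval_summands[OF as, of "Plus (Const 1) \<alpha>" "\<lambda>_. as ! 0" "\<lambda>_. {}", folded ss_def]
      have fin: "finite (witnesses \<A> as (\<lambda>_. as ! 0) (\<lambda>_. {}) s)" if "s \<in> set ss" for s
        by (rule bspec[OF conjunct1[OF ev] that])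
      note W = card_tagged_witnesses[of ss \<A> as "\<lambda>_. as ! 0" "\<lambda>_. {}", OF fin]
      have "card ?W = eval \<A> (\<lambda>_. as ! 0) (\<lambda>_. {}) (Plus (Const 1) \<alpha>)"
        by (rule trans[OF W(2) conjunct2[OF ev, symmetric]])
      \<comment> \<open>The test interprets free variables by \<open>as ! 0\<close>, whereas
        \<open>counting_function\<close> starts from \<open>undefined\<close>; a sentence has the
        same value under both.\<close>
      also have "\<dots> = Suc (F \<A>)" unfolding eval.simps eval_sentence[OF \<alpha>(2)] F by simp
      finally have card: "card ?W = Suc (F \<A>)" .
      have "tot M ?x = card ?W - 1"
      proof (rule M(3)[OF enc(1)[symmetric]])
        show "extension_test (test_cmd \<sigma> ss) ?n (\<lambda>i. i < length ?x \<and> ?x ! i) ?W (aval [?n] ?NE)"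
          unfolding N by (rule extension_test_cmd[OF as n Cs enc(2)])
        show "finite ?W" by (rule W(1))
        show "?W \<noteq> {}" using card by auto
        show "\<not> w q" if "w \<in> ?W" "aval [?n] ?NE \<le> q" for w q
          using tagged_witnesses_zero[OF that(1)] that(2) unfolding N by blast
      qed
      then show ?thesis using card by simp
    qed
    then show "F \<in> on_encodings \<sigma> TotP"
      using M(1,2) unfolding on_encodings_def TotP_def by blast
  qed
qed

end
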